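(* Let $\pi_0$ be a unitary representation of $G$ on a Hilbert space $H_0$ satisfying the technical condition (TC) with auxiliary data $\pi, H, L, P_L, P_0$, and let $\overline{\pi_0}^{\rm p}$ be the associated unitary representation of $\overline G$. For every $\Gamma_0\in\mathcal S$ fix right coset representatives $s_i$, $\Gamma=\bigsqcup_{i=1}^{[\Gamma:\Gamma_0]}\Gamma_0 s_i$, and let $(e_{\Gamma_0 s_i,\Gamma_0 s_j})_{i,j=1,\dots,[\Gamma:\Gamma_0]}$ be the corresponding matrix unit of $B(\ell^2(\Gamma_0\backslash\Gamma))$. For $\Gamma_0\in\mathcal S$ and $\sigma\in G$, the Hecke operators associated to $\pi_0$ corresponding to the double coset $\Gamma_0\sigma\Gamma_0$ are $$[\Gamma_0:(\Gamma_0)_\sigma]\,P_{H_0^{\Gamma_0}}\overline{\pi_0}^{\rm p}(\sigma)P_{H_0^{\Gamma_0}}.$$ Using the unitary equivalence $B(\ell^2(\Gamma_0\backslash\Gamma))\otimes B(L)\cong B(H^{\Gamma_0})$ and the matrix unit $(e_{\Gamma_0 s_i,\Gamma_0 s_j})_{i,j=1,\dots,[\Gamma:\Gamma_0]}$ of $B(\ell^2(\Gamma_0\backslash\Gamma))$, these Hecke operators (for fixed $\Gamma_0$ and all $\sigma\in G$) are unitarily equivalent to the operators in $B(\ell^2(\Gamma_0\backslash\Gamma))\otimes B(L)$ given by $$\sum_{i,j}\ \sum_{\theta\in s_i^{-1}\Gamma_0\sigma\Gamma_0 s_j}P_L\pi_0(\theta)P_L\otimes e_{\Gamma_0 s_i,\Gamma_0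 s_j}.$$
   Context: Setting. $G$ is a countable discrete group and $\Gamma\subseteq G$ is an almost normal subgroup: for every $\sigma\in G$ the group $\Gamma_\sigma=\Gamma\cap\sigma\Gamma\sigma^{-1}$ has finite index in $\Gamma$. It is assumed that $[\Gamma:\Gamma_\sigma]=[\Gamma:\Gamma_{\sigma^{-1}}]$ for all $\sigma\in G$. $\mathcal S$ is the smallest family of finite index subgroups of $\Gamma$ containing $\Gamma$ and closed under finite intersections and under the operations $\Gamma_0\mapsto(\Gamma_0)_\sigma=\Gamma_0\cap\sigma\Gamma_0\sigma^{-1}$, $\sigma\in G$; the intersection of all groups in $\mathcal S$ is assumed trivial. $K$ is the profinite completion of $\Gamma$ with respect to $\mathcal S$, and $\overline G$ is the Schlichting completion of $G$ with respect to $\mathcal S$: a totally disconnected locally compact group containing $G$ as a dense subgroup, with $K$ (the closure of $\Gamma$) as a compact open subgroup. Technical condition (TC) on a unitary representation $\pi_0$ of $G$ on $H_0$: $\pi_0|_\Gamma$ is a (not necessarily integer) multiple of the left regular representation $\lambda_\Gamma$, and there is a unitary representation $\pi$ of $G$ on a Hilbert space $H\supseteq H_0$ such that: (i) $\pi|_\Gamma$ is an integer (possibly infinite) multiple of $\lambda_\Gamma$, so there is a closed subspace $L\subseteq H$ with $H\cong\ell^2(\Gamma)\otimes L$, $\pi|_\Gamma\cong\lambda_\Gamma\otimes{\rm Id}_L$, $L\cong\mathbb C e\otimes L$; (ii) with $P_L$ the orthogonal projection of $H$ onto $L$, the projections $\pi(g)P_L\pi(g^{-1})$, $g\in G$, commute;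 (iii) $H_0$ is $\pi(G)$-invariant and $\pi_0=\pi|_{H_0}$; with $P_0$ the orthogonal projection of $H$ onto $H_0$, $\pi_0(g)$ also denotes $P_0\pi(g)P_0$; (iv) $P_0P_L$ is trace class; (v) for all $g\in G$, $\Gamma_0\in\mathcal S$ the sum $\sum_{\theta\in\Gamma_0 g}P_L\pi_0(\theta)P_L$ converges in the Hilbert–Schmidt operators on $L$; (vi) the sum of the traces of the terms of this sum is absolutely convergent, the sum is trace class and its trace is the sum of the traces of its terms; (vii) the Murray–von Neumann dimension $\dim_{\{\pi_0(\Gamma)\}''}H_0$ is finite and strictly positive. Virtual invariant vectors. For $\Gamma_0\in\mathcal S$ with $\Gamma=\bigsqcup_i\Gamma_0 s_i$ put $L^{\Gamma_0}=\bigoplus_i\pi(s_i)L\subseteq H$, with orthogonal projection $P_{L^{\Gamma_0}}$. Let $\mathcal D_{L,\pi}=\{h\in H:\sum_{\gamma\in\Gamma_0}P_L\pi(\gamma)h\text{ converges for all }\Gamma_0\in\mathcal S\}$. $H_0^{\Gamma_0}$ is the space of formal sums $\sum_{\gamma\in\Gamma_0}\pi_0(\gamma)h$, $h\in\mathcal D_{L,\pi}$, where such a sum is identified with $\sum_{\gamma\in\Gamma_0}\pi_0(\gamma)l_0$, $l_0=\sum_{\gamma\in\Gamma_0}P_{L^{\Gamma_0}}\pi_0(\gamma)h\in L^{\Gamma_0}$; its scalar product is $$\Big\langle\sum_{\gamma\in\Gamma_0}\pi_0(\gamma)h_1,\sum_{\gamma'\in\Gamma_0}\pi_0(\gamma')h_2\Big\rangle_\infty=\frac1{[\Gamma:\Gamma_0]}\Big\langle\sum_{\gamma\in\Gamma_0}P_{L^{\Gamma_0}}\pi_0(\gamma)h_1,\sum_{\gamma'\in\Gamma_0}P_{L^{\Gamma_0}}\pi_0(\gamma')h_2\Big\rangle_H.$$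 For $\Gamma_1\subseteq\Gamma_0$ in $\mathcal S$, $\Gamma_0=\bigsqcup_j\Gamma_1r_j$, $H_0^{\Gamma_0}\subseteq H_0^{\Gamma_1}$ isometrically via $\sum_{\gamma\in\Gamma_0}\pi_0(\gamma)h=\sum_{\gamma\in\Gamma_1}\pi_0(\gamma)\big(\sum_j\pi(r_j)h\big)$. $\overline H_0^{\rm p}$ is the Hilbert completion of $\bigvee_{\Gamma_0\in\mathcal S}H_0^{\Gamma_0}$, and $P_{H_0^{\Gamma_0}}$ is the orthogonal projection onto $H_0^{\Gamma_0}$. $\overline{\pi_0}^{\rm p}$ is the unitary representation of $G$ (extending to $\overline G$) on $\overline H_0^{\rm p}$ determined as follows: given $g\in G$ and a vector in $H_0^{\Gamma_0}$, write it as an element $\sum_{\gamma\in\Gamma_1}\pi_0(\gamma)h$ of $H_0^{\Gamma_1}$, $\Gamma_1=(\Gamma_0)_{g^{-1}}$; then $\overline{\pi_0}^{\rm p}(g)$ maps it to $\sum_{\gamma\in g\Gamma_1g^{-1}}\pi_0(\gamma)\pi(g)h$ (note $g\Gamma_1g^{-1}=(\Gamma_0)_g\in\mathcal S$). The same construction with $\pi$, $H$ in place of $\pi_0$, $H_0$ gives Hilbert spaces $H^{\Gamma_0}\cong\ell^2(\Gamma_0\backslash\Gamma)\otimes L$, and $H_0^{\Gamma_0}$ is viewed as a subspace of $H^{\Gamma_0}$ via $\sum\pi_0(\gamma)h\mapsto\sum\pi(\gamma)P_0h$; the Hecke operators, which act on $H_0^{\Gamma_0}$, are extended by $0$ on the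 orthogonal complement of $H_0^{\Gamma_0}$ in $H^{\Gamma_0}$. *)

theory Defs
  imports "HOL-Analysis.Analysis" "HOL-Algebra.Coset"
begin

section \<open>Complex Hilbert spaces\<close>

text \<open>The scalar product \<open>cinner\<close> is linear in the first argument; the norm and the topology
  are those of the underlying real inner product space.\<close>

class chilbert = real_inner + complete_space +
  fixes scaleC :: "complex \<Rightarrow> 'a \<Rightarrow> 'a"
    and cinner :: "'a \<Rightarrow> 'a \<Rightarrow> complex"
  assumes scaleC_of_real: "scaleC (complex_of_real r) x = scaleR r x"
    and scaleC_add_right: "scaleC a (x + y) = scaleC a x + scaleC a y"
    and scaleC_add_left: "scaleC (a + b) x = scaleC a x + scaleC b x"
    and scaleC_scaleC: "scaleC a (scaleC b x) = scaleC (a * b) x"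
    and cinner_add_left: "cinner (x + y) z = cinner x z + cinner y z"
    and cinner_scaleC_left: "cinner (scaleC a x) y = a * cinner x y"
    and cinner_commute: "cinner x y = cnj (cinner y x)"
    and inner_eq_Re_cinner: "inner x y = Re (cinner x y)"

definition csubspace :: "'a::chilbert set \<Rightarrow> bool" where
  "csubspace M \<longleftrightarrow>
     0 \<in> M \<and> (\<forall>x\<in>M. \<forall>y\<in>M. x + y \<in> M) \<and> (\<forall>a. \<forall>x\<in>M. scaleC a x \<in> M)"

definition closed_csubspace :: "'a::chilbert set \<Rightarrow> bool" where
  "closed_csubspace M \<longleftrightarrow> csubspace M \<and> closed M"

definition cspan :: "'a::chilbert set \<Rightarrow> 'a set" where
  "cspan X = csubspace hull X"

definition clinear_on :: "'a::chilbert set \<Rightarrow> ('a \<Rightarrow> 'b::chilbert) \<Rightarrow> bool" where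
  "clinear_on M T \<longleftrightarrow>
     (\<forall>x\<in>M. \<forall>y\<in>M. T (x + y) = T x + T y) \<and> (\<forall>a. \<forall>x\<in>M. T (scaleC a x) = scaleC a (T x))"

definition bounded_clinear :: "('a::chilbert \<Rightarrow> 'b::chilbert) \<Rightarrow> bool" where
  "bounded_clinear T \<longleftrightarrow> clinear_on UNIV T \<and> (\<exists>C. \<forall>x. norm (T x) \<le> C * norm x)"

definition proj :: "'a::chilbert set \<Rightarrow> 'a \<Rightarrow> 'a" where
  "proj M x = (THE y. y \<in> M \<and> (\<forall>z\<in>M. cinner (x - y) z = 0))"

definition is_onb :: "'a::chilbert set \<Rightarrow> 'a set \<Rightarrow> bool" where
  "is_onb M B \<longleftrightarrow>
     B \<subseteq> M \<and> (\<forall>b\<in>B. norm b = 1) \<and> (\<forall>b\<in>B. \<forall>c\<in>B. b \<noteq> c \<longrightarrow> cinner b c = 0) \<and>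
     closure (cspan B) = M"

definition some_onb :: "'a::chilbert set \<Rightarrow> 'a set" where
  "some_onb M = (SOME B. is_onb M B)"


section \<open>Hilbert--Schmidt and trace class operators\<close>

text \<open>Operators on a closed subspace \<open>L\<close> of a Hilbert space occur in the form \<open>P\<^sub>L T P\<^sub>L\<close>, that is,
  extended by \<open>0\<close> on the orthogonal complement of \<open>L\<close>. This changes neither Hilbert--Schmidt norms
  nor traces, so these notions are only needed for operators defined on the whole space.\<close>

definition hilbert_schmidt :: "('a::chilbert \<Rightarrow> 'a) \<Rightarrow> bool" where
  "hilbert_schmidt T \<longleftrightarrow>
     bounded_clinear T \<and> (\<lambda>b. (norm (T b))\<^sup>2) summable_on some_onb UNIV"

definition hs_norm :: "('a::chilbert \<Rightarrow> 'a) \<Rightarrow> real" where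
  "hs_norm T = sqrt (\<Sum>\<^sub>\<infinity>b\<in>some_onb UNIV. (norm (T b))\<^sup>2)"

text \<open>Unconditional convergence: the net of finite partial sums converges in Hilbert--Schmidt norm.\<close>

definition hs_has_sum :: "('i \<Rightarrow> 'a::chilbert \<Rightarrow> 'a) \<Rightarrow> 'i set \<Rightarrow> ('a \<Rightarrow> 'a) \<Rightarrow> bool" where
  "hs_has_sum A X T \<longleftrightarrow>
     (\<forall>i\<in>X. hilbert_schmidt (A i)) \<and> hilbert_schmidt T \<and>
     ((\<lambda>F. hs_norm (\<lambda>x. (\<Sum>i\<in>F. A i x) - T x)) \<longlongrightarrow> 0) (finite_subsets_at_top X)"

text \<open>The operator \<open>Q\<close> is the absolute value of \<open>T\<close>: it is positive and \<open>Q\<^sup>*Q = T\<^sup>*T\<close>.\<close>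

definition trace_class :: "('a::chilbert \<Rightarrow> 'a) \<Rightarrow> bool" where
  "trace_class T \<longleftrightarrow>
     bounded_clinear T \<and>
     (\<exists>Q. bounded_clinear Q \<and> (\<forall>x. Im (cinner (Q x) x) = 0 \<and> 0 \<le> Re (cinner (Q x) x)) \<and>
          (\<forall>x y. cinner (Q x) (Q y) = cinner (T x) (T y)) \<and>
          (\<lambda>b. cinner (Q b) b) summable_on some_onb UNIV)"

definition op_trace :: "('a::chilbert \<Rightarrow> 'a) \<Rightarrow> complex" where
  "op_trace T = (\<Sum>\<^sub>\<infinity>b\<in>some_onb UNIV. cinner (T b) b)"


section \<open>The Hilbert space tensor product of \<open>\<ell>\<^sup>2(I)\<close> and \<open>L\<close>\<close>

text \<open>It is realised as the space of square summable families \<open>I \<rightarrow> L\<close>, extended by \<open>0\<close> outside \<open>I\<close>;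
  the family \<open>delta_tensor i l\<close> stands for \<open>\<delta>\<^sub>i \<otimes> l\<close>.\<close>

definition l2_tensor :: "'i set \<Rightarrow> 'a::chilbert set \<Rightarrow> ('i \<Rightarrow> 'a) set" where
  "l2_tensor I L =
     {f. (\<forall>i\<in>I. f i \<in> L) \<and> (\<forall>i. i \<notin> I \<longrightarrow> f i = 0) \<and> (\<lambda>i. (norm (f i))\<^sup>2) summable_on I}"

definition l2_inner :: "'i set \<Rightarrow> ('i \<Rightarrow> 'a::chilbert) \<Rightarrow> ('i \<Rightarrow> 'a) \<Rightarrow> complex" where
  "l2_inner I f g = (\<Sum>\<^sub>\<infinity>i\<in>I. cinner (f i) (g i))"

definition delta_tensor :: "'i \<Rightarrow> 'a::chilbert \<Rightarrow> 'i \<Rightarrow> 'a" where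
  "delta_tensor i l = (\<lambda>j. if j = i then l else 0)"

text \<open>\<open>unit_tensor c d A\<close> is \<open>A \<otimes> e\<^bsub>c,d\<^esub>\<close>, where \<open>e\<^bsub>c,d\<^esub>\<close> is the matrix unit of \<open>B(\<ell>\<^sup>2(I))\<close> which sends
  \<open>\<delta>\<^sub>d\<close> to \<open>\<delta>\<^sub>c\<close>.\<close>

definition unit_tensor ::
    "'i \<Rightarrow> 'i \<Rightarrow> ('a::chilbert \<Rightarrow> 'a) \<Rightarrow> ('i \<Rightarrow> 'a) \<Rightarrow> 'i \<Rightarrow> 'a" where
  "unit_tensor c d A f = delta_tensor c (A (f d))"

definition l2_isometry ::
    "'b::chilbert set \<Rightarrow> 'i set \<Rightarrow> 'a::chilbert set \<Rightarrow> ('b \<Rightarrow> 'i \<Rightarrow> 'a) \<Rightarrow> bool" where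
  "l2_isometry M I L W \<longleftrightarrow>
     (\<forall>x\<in>M. W x \<in> l2_tensor I L) \<and>
     (\<forall>x\<in>M. \<forall>y\<in>M. W (x + y) = (\<lambda>i. W x i + W y i)) \<and>
     (\<forall>a. \<forall>x\<in>M. W (scaleC a x) = (\<lambda>i. scaleC a (W x i))) \<and>
     (\<forall>x\<in>M. \<forall>y\<in>M. l2_inner I (W x) (W y) = cinner x y)"

definition l2_unitary ::
    "'b::chilbert set \<Rightarrow> 'i set \<Rightarrow> 'a::chilbert set \<Rightarrow> ('b \<Rightarrow> 'i \<Rightarrow> 'a) \<Rightarrow> bool" where
  "l2_unitary M I L W \<longleftrightarrow> l2_isometry M I L W \<and> W ` M = l2_tensor I L"


section \<open>Almost normal subgroups and the Schlichting completion\<close>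

definition index :: "('g, 'm) monoid_scheme \<Rightarrow> 'g set \<Rightarrow> 'g set \<Rightarrow> nat" where
  "index G K H = card (rcosets\<^bsub>G\<lparr>carrier := K\<rparr>\<^esub> H)"

definition conj_subgroup :: "('g, 'm) monoid_scheme \<Rightarrow> 'g \<Rightarrow> 'g set \<Rightarrow> 'g set" where
  "conj_subgroup G \<sigma> H = (\<sigma> <#\<^bsub>G\<^esub> H) #>\<^bsub>G\<^esub> (inv\<^bsub>G\<^esub> \<sigma>)"

text \<open>\<open>conj_meet G H \<sigma>\<close> is \<open>H\<^sub>\<sigma> = H \<inter> \<sigma>H\<sigma>\<^sup>-\<^sup>1\<close>.\<close>

definition conj_meet :: "('g, 'm) monoid_scheme \<Rightarrow> 'g set \<Rightarrow> 'g \<Rightarrow> 'g set" where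
  "conj_meet G H \<sigma> = H \<inter> conj_subgroup G \<sigma> H"

inductive_set subgroup_family :: "('g, 'm) monoid_scheme \<Rightarrow> 'g set \<Rightarrow> 'g set set"
  for G :: "('g, 'm) monoid_scheme" and \<Gamma> :: "'g set" where
  base: "\<Gamma> \<in> subgroup_family G \<Gamma>"
| inter: "A \<in> subgroup_family G \<Gamma> \<Longrightarrow> B \<in> subgroup_family G \<Gamma> \<Longrightarrow> A \<inter> B \<in> subgroup_family G \<Gamma>"
| conj: "A \<in> subgroup_family G \<Gamma> \<Longrightarrow> \<sigma> \<in> carrier G \<Longrightarrow> conj_meet G A \<sigma> \<in> subgroup_family G \<Gamma>"

definition hecke_pair :: "('g, 'm) monoid_scheme \<Rightarrow> 'g set \<Rightarrow> bool" where
  "hecke_pair G \<Gamma> \<longleftrightarrow>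
     group G \<and> countable (carrier G) \<and> subgroup \<Gamma> G \<and>
     (\<forall>\<sigma>\<in>carrier G. finite (rcosets\<^bsub>G\<lparr>carrier := \<Gamma>\<rparr>\<^esub> (conj_meet G \<Gamma> \<sigma>))) \<and>
     (\<forall>\<sigma>\<in>carrier G. index G \<Gamma> (conj_meet G \<Gamma> \<sigma>) = index G \<Gamma> (conj_meet G \<Gamma> (inv\<^bsub>G\<^esub> \<sigma>))) \<and>
     \<Inter> (subgroup_family G \<Gamma>) = {\<one>\<^bsub>G\<^esub>}"

definition right_transversal :: "('g, 'm) monoid_scheme \<Rightarrow> 'g set \<Rightarrow> 'g set \<Rightarrow> 'g set \<Rightarrow> bool" where
  "right_transversal G K H R \<longleftrightarrow>
     R \<subseteq> K \<and> bij_betw (\<lambda>r. H #>\<^bsub>G\<^esub> r) R (rcosets\<^bsub>G\<lparr>carrier := K\<rparr>\<^esub> H)"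

definition coset_reps :: "('g, 'm) monoid_scheme \<Rightarrow> 'g set \<Rightarrow> 'g set \<Rightarrow> (nat \<Rightarrow> 'g) \<Rightarrow> bool" where
  "coset_reps G K H s \<longleftrightarrow>
     s ` {1..index G K H} \<subseteq> K \<and>
     bij_betw (\<lambda>i. H #>\<^bsub>G\<^esub> s i) {1..index G K H} (rcosets\<^bsub>G\<lparr>carrier := K\<rparr>\<^esub> H)"

definition topological_group :: "('c, 'm) monoid_scheme \<Rightarrow> 'c topology \<Rightarrow> bool" where
  "topological_group C T \<longleftrightarrow>
     group C \<and> topspace T = carrier C \<and>
     continuous_map (prod_topology T T) T (\<lambda>(x, y). x \<otimes>\<^bsub>C\<^esub> y) \<and>
     continuous_map T T (\<lambda>x. inv\<^bsub>C\<^esub> x)"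

text \<open>The Schlichting completion \<open>C\<close> of \<open>G\<close>, embedded by \<open>\<iota>\<close>. The closures of the groups in the
  family form a neighbourhood base of the identity and meet \<open>G\<close> in the original groups; hence the
  closure of \<open>\<Gamma>\<close> is the completion of \<open>\<Gamma>\<close> with respect to this family.\<close>

definition schlichting_completion ::
    "('g, 'm) monoid_scheme \<Rightarrow> 'g set \<Rightarrow> ('c, 'n) monoid_scheme \<Rightarrow> 'c topology \<Rightarrow> ('g \<Rightarrow> 'c) \<Rightarrow> bool" where
  "schlichting_completion G \<Gamma> C T \<iota> \<longleftrightarrow>
     topological_group C T \<and> Hausdorff_space T \<and> locally_compact_space T \<and>
     (\<forall>X. connectedin T X \<longrightarrow> (\<exists>x. X \<subseteq> {x})) \<and>
     \<iota> \<in> hom G C \<and> inj_on \<iota> (carrier G) \<and> T closure_of (\<iota> ` carrier G) = carrier C \<and>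
     (\<forall>\<Gamma>\<^sub>0\<in>subgroup_family G \<Gamma>.
        compactin T (T closure_of (\<iota> ` \<Gamma>\<^sub>0)) \<and> openin T (T closure_of (\<iota> ` \<Gamma>\<^sub>0)) \<and>
        (T closure_of (\<iota> ` \<Gamma>\<^sub>0)) \<inter> \<iota> ` carrier G = \<iota> ` \<Gamma>\<^sub>0) \<and>
     (\<forall>U. openin T U \<and> \<one>\<^bsub>C\<^esub> \<in> U \<longrightarrow>
        (\<exists>\<Gamma>\<^sub>0\<in>subgroup_family G \<Gamma>. T closure_of (\<iota> ` \<Gamma>\<^sub>0) \<subseteq> U))"


section \<open>Unitary representations and the technical condition\<close>

definition unitary_rep ::
    "('g, 'm) monoid_scheme \<Rightarrow> 'a::chilbert set \<Rightarrow> ('g \<Rightarrow> 'a \<Rightarrow> 'a) \<Rightarrow> bool" where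
  "unitary_rep G M \<pi> \<longleftrightarrow>
     (\<forall>g\<in>carrier G. bij_betw (\<pi> g) M M \<and> clinear_on M (\<pi> g) \<and>
        (\<forall>x\<in>M. \<forall>y\<in>M. cinner (\<pi> g x) (\<pi> g y) = cinner x y)) \<and>
     (\<forall>g\<in>carrier G. \<forall>h\<in>carrier G. \<forall>x\<in>M. \<pi> (g \<otimes>\<^bsub>G\<^esub> h) x = \<pi> g (\<pi> h x))"

text \<open>The operator \<open>\<lambda>\<^sub>\<Gamma>(\<gamma>) \<otimes> Id\<close> on \<open>\<ell>\<^sup>2(\<Gamma>) \<otimes> L\<close>.\<close>

definition left_regular ::
    "('g, 'm) monoid_scheme \<Rightarrow> 'g set \<Rightarrow> 'g \<Rightarrow> ('g \<Rightarrow> 'a::chilbert) \<Rightarrow> 'g \<Rightarrow> 'a" where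
  "left_regular G \<Gamma> \<gamma> f = (\<lambda>k. if k \<in> \<Gamma> then f (inv\<^bsub>G\<^esub> \<gamma> \<otimes>\<^bsub>G\<^esub> k) else 0)"

text \<open>An integer multiple of the left regular representation of \<open>\<Gamma>\<close>, in which \<open>L\<close> is \<open>\<complex>\<delta>\<^sub>e \<otimes> L\<close>.\<close>

definition regular_multiple ::
    "('g, 'm) monoid_scheme \<Rightarrow> 'g set \<Rightarrow> ('g \<Rightarrow> 'a::chilbert \<Rightarrow> 'a) \<Rightarrow> 'a set \<Rightarrow> bool" where
  "regular_multiple G \<Gamma> \<pi> L \<longleftrightarrow>
     (\<exists>W. l2_unitary UNIV \<Gamma> L W \<and>
          (\<forall>\<gamma>\<in>\<Gamma>. \<forall>x. W (\<pi> \<gamma> x) = left_regular G \<Gamma> \<gamma> (W x)) \<and>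
          (\<forall>l\<in>L. W l = delta_tensor \<one>\<^bsub>G\<^esub> l))"

text \<open>A not necessarily integer multiple is a subrepresentation of an integer multiple.\<close>

definition regular_submultiple ::
    "('g, 'm) monoid_scheme \<Rightarrow> 'g set \<Rightarrow> 'a::chilbert set \<Rightarrow> ('g \<Rightarrow> 'a \<Rightarrow> 'a) \<Rightarrow> bool" where
  "regular_submultiple G \<Gamma> M \<rho> \<longleftrightarrow>
     (\<exists>(N :: 'a set) W. closed_csubspace N \<and> l2_isometry M \<Gamma> N W \<and>
        (\<forall>\<gamma>\<in>\<Gamma>. \<forall>x\<in>M. W (\<rho> \<gamma> x) = left_regular G \<Gamma> \<gamma> (W x)))"

text \<open>For a \<open>\<Gamma>\<close>-invariant closed subspace \<open>M\<close> of \<open>\<ell>\<^sup>2(\<Gamma>) \<otimes> L\<close> this is the Murray--von Neumann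
  dimension of \<open>M\<close>, that is, the trace \<open>(\<tau> \<otimes> Tr)(P\<^sub>M) = \<Sum>\<^sub>b \<langle>P\<^sub>M(\<delta>\<^sub>e \<otimes> b), \<delta>\<^sub>e \<otimes> b\<rangle>\<close> of the
  projection \<open>P\<^sub>M\<close>, which lies in the commutant of \<open>\<lambda>\<^sub>\<Gamma> \<otimes> Id\<close>; \<open>b\<close> runs over an orthonormal
  basis of \<open>L\<close>.\<close>

definition mvn_dim :: "'a::chilbert set \<Rightarrow> 'a set \<Rightarrow> ennreal" where
  "mvn_dim L M = (\<Sum>\<^sub>\<infinity>b\<in>some_onb L. ennreal (Re (cinner (proj M b) b)))"

text \<open>\<open>compress P T\<close> is \<open>PTP\<close>.\<close>

definition compress :: "('a \<Rightarrow> 'a) \<Rightarrow> ('a \<Rightarrow> 'a) \<Rightarrow> 'a \<Rightarrow> 'a" where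
  "compress P T = P \<circ> T \<circ> P"

text \<open>The representation \<open>\<pi>\<^sub>0\<close> on \<open>H\<^sub>0\<close> is regarded as a family of operators on the ambient space,
  \<open>\<pi>\<^sub>0(g)\<close> being extended by \<open>0\<close> on the orthogonal complement of \<open>H\<^sub>0\<close>.\<close>

definition technical_condition ::
    "('g, 'm) monoid_scheme \<Rightarrow> 'g set \<Rightarrow> ('g \<Rightarrow> 'a::chilbert \<Rightarrow> 'a) \<Rightarrow> 'a set \<Rightarrow>
     ('g \<Rightarrow> 'a \<Rightarrow> 'a) \<Rightarrow> 'a set \<Rightarrow> bool" where
  "technical_condition G \<Gamma> \<pi>\<^sub>0 H\<^sub>0 \<pi> L \<longleftrightarrow>
     closed_csubspace H\<^sub>0 \<and> unitary_rep G H\<^sub>0 \<pi>\<^sub>0 \<and> regular_submultiple G \<Gamma> H\<^sub>0 \<pi>\<^sub>0 \<and>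
     unitary_rep G UNIV \<pi> \<and> closed_csubspace L \<and> regular_multiple G \<Gamma> \<pi> L \<and>
     (\<forall>g\<in>carrier G. \<forall>h\<in>carrier G.
        (\<pi> g \<circ> proj L \<circ> \<pi> (inv\<^bsub>G\<^esub> g)) \<circ> (\<pi> h \<circ> proj L \<circ> \<pi> (inv\<^bsub>G\<^esub> h)) =
        (\<pi> h \<circ> proj L \<circ> \<pi> (inv\<^bsub>G\<^esub> h)) \<circ> (\<pi> g \<circ> proj L \<circ> \<pi> (inv\<^bsub>G\<^esub> g))) \<and>
     (\<forall>g\<in>carrier G. \<pi> g ` H\<^sub>0 \<subseteq> H\<^sub>0 \<and> (\<forall>x\<in>H\<^sub>0. \<pi>\<^sub>0 g x = \<pi> g x) \<and>
        \<pi>\<^sub>0 g = compress (proj H\<^sub>0) (\<pi> g)) \<and>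
     trace_class (proj H\<^sub>0 \<circ> proj L) \<and>
     (\<forall>g\<in>carrier G. \<forall>\<Gamma>\<^sub>0\<in>subgroup_family G \<Gamma>. \<exists>T.
        hs_has_sum (\<lambda>\<theta>. compress (proj L) (\<pi>\<^sub>0 \<theta>)) (\<Gamma>\<^sub>0 #>\<^bsub>G\<^esub> g) T \<and>
        (\<lambda>\<theta>. cmod (op_trace (compress (proj L) (\<pi>\<^sub>0 \<theta>)))) summable_on (\<Gamma>\<^sub>0 #>\<^bsub>G\<^esub> g) \<and>
        trace_class T \<and>
        op_trace T = (\<Sum>\<^sub>\<infinity>\<theta>\<in>\<Gamma>\<^sub>0 #>\<^bsub>G\<^esub> g. op_trace (compress (proj L) (\<pi>\<^sub>0 \<theta>)))) \<and>
     0 < mvn_dim L H\<^sub>0 \<and> mvn_dim L H\<^sub>0 < \<infinity>"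


section \<open>Virtual invariant vectors\<close>

text \<open>Below, \<open>s \<Gamma>\<^sub>0\<close> enumerates the fixed right coset representatives of \<open>\<Gamma>\<^sub>0\<close> in \<open>\<Gamma>\<close>, and \<open>\<rho>\<close> is
  either \<open>\<pi>\<^sub>0\<close> or \<open>\<pi>\<close>.\<close>

definition level_space ::
    "('g, 'm) monoid_scheme \<Rightarrow> 'g set \<Rightarrow> ('g \<Rightarrow> 'a::chilbert \<Rightarrow> 'a) \<Rightarrow> 'a set \<Rightarrow>
     ('g set \<Rightarrow> nat \<Rightarrow> 'g) \<Rightarrow> 'g set \<Rightarrow> 'a set" where
  "level_space G \<Gamma> \<pi> L s \<Gamma>\<^sub>0 =
     {\<Sum>i=1..index G \<Gamma> \<Gamma>\<^sub>0. \<pi> (s \<Gamma>\<^sub>0 i) (l i) | l. \<forall>i. l i \<in> L}"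

definition conv_domain ::
    "('g, 'm) monoid_scheme \<Rightarrow> 'g set \<Rightarrow> ('g \<Rightarrow> 'a::chilbert \<Rightarrow> 'a) \<Rightarrow> 'a set \<Rightarrow> 'a set" where
  "conv_domain G \<Gamma> \<pi> L =
     {h. \<forall>\<Gamma>\<^sub>0\<in>subgroup_family G \<Gamma>. (\<lambda>\<gamma>. proj L (\<pi> \<gamma> h)) summable_on \<Gamma>\<^sub>0}"

text \<open>The vectors of \<open>conv_domain\<close> for which the sum defining \<open>l\<^sub>0\<close> (see \<open>virtual_coeff\<close>) converges, so that
  the formal sum \<open>\<Sum>\<^bsub>\<gamma>\<in>\<Gamma>\<^sub>0\<^esub> \<rho>(\<gamma>)h\<close> has a meaning.\<close>

definition sum_domain ::
    "('g, 'm) monoid_scheme \<Rightarrow> 'g set \<Rightarrow> ('g \<Rightarrow> 'a::chilbert \<Rightarrow> 'a) \<Rightarrow> 'a set \<Rightarrow>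
     ('g set \<Rightarrow> nat \<Rightarrow> 'g) \<Rightarrow> ('g \<Rightarrow> 'a \<Rightarrow> 'a) \<Rightarrow> 'g set \<Rightarrow> 'a set" where
  "sum_domain G \<Gamma> \<pi> L s \<rho> \<Gamma>\<^sub>0 =
     {h \<in> conv_domain G \<Gamma> \<pi> L.
        (\<lambda>\<gamma>. proj (level_space G \<Gamma> \<pi> L s \<Gamma>\<^sub>0) (\<rho> \<gamma> h)) summable_on \<Gamma>\<^sub>0}"

definition virtual_coeff ::
    "('g, 'm) monoid_scheme \<Rightarrow> 'g set \<Rightarrow> ('g \<Rightarrow> 'a::chilbert \<Rightarrow> 'a) \<Rightarrow> 'a set \<Rightarrow>
     ('g set \<Rightarrow> nat \<Rightarrow> 'g) \<Rightarrow> ('g \<Rightarrow> 'a \<Rightarrow> 'a) \<Rightarrow> 'g set \<Rightarrow> 'a \<Rightarrow> 'a" where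
  "virtual_coeff G \<Gamma> \<pi> L s \<rho> \<Gamma>\<^sub>0 h =
     (\<Sum>\<^sub>\<infinity>\<gamma>\<in>\<Gamma>\<^sub>0. proj (level_space G \<Gamma> \<pi> L s \<Gamma>\<^sub>0) (\<rho> \<gamma> h))"

text \<open>The Hilbert space \<open>'k\<close>, in which \<open>V \<Gamma>\<^sub>0 h\<close> is the class of the formal sum
  \<open>\<Sum>\<^bsub>\<gamma>\<in>\<Gamma>\<^sub>0\<^esub> \<rho>(\<gamma>)h\<close>, is the completion of the space of virtual vectors: scalar product,
  identification of formal sums, inclusions between levels, density. These properties determine
  \<open>'k\<close> together with \<open>V\<close> up to a unique unitary.\<close>

definition virtual_completion ::
    "('g, 'm) monoid_scheme \<Rightarrow> 'g set \<Rightarrow> ('g \<Rightarrow> 'a::chilbert \<Rightarrow> 'a) \<Rightarrow> 'a set \<Rightarrow>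
     ('g set \<Rightarrow> nat \<Rightarrow> 'g) \<Rightarrow> ('g \<Rightarrow> 'a \<Rightarrow> 'a) \<Rightarrow> ('g set \<Rightarrow> 'a \<Rightarrow> 'k::chilbert) \<Rightarrow> bool" where
  "virtual_completion G \<Gamma> \<pi> L s \<rho> V \<longleftrightarrow>
     (\<forall>\<Gamma>\<^sub>0\<in>subgroup_family G \<Gamma>.
        \<forall>h\<^sub>1\<in>sum_domain G \<Gamma> \<pi> L s \<rho> \<Gamma>\<^sub>0. \<forall>h\<^sub>2\<in>sum_domain G \<Gamma> \<pi> L s \<rho> \<Gamma>\<^sub>0.
          cinner (V \<Gamma>\<^sub>0 h\<^sub>1) (V \<Gamma>\<^sub>0 h\<^sub>2) =
            cinner (virtual_coeff G \<Gamma> \<pi> L s \<rho> \<Gamma>\<^sub>0 h\<^sub>1) (virtual_coeff G \<Gamma> \<pi> L s \<rho> \<Gamma>\<^sub>0 h\<^sub>2) / of_nat (index G \<Gamma> \<Gamma>\<^sub>0)) \<and>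
     (\<forall>\<Gamma>\<^sub>0\<in>subgroup_family G \<Gamma>. \<forall>h\<in>sum_domain G \<Gamma> \<pi> L s \<rho> \<Gamma>\<^sub>0.
          V \<Gamma>\<^sub>0 h = V \<Gamma>\<^sub>0 (virtual_coeff G \<Gamma> \<pi> L s \<rho> \<Gamma>\<^sub>0 h)) \<and>
     (\<forall>\<Gamma>\<^sub>0\<in>subgroup_family G \<Gamma>. \<forall>\<Gamma>\<^sub>1\<in>subgroup_family G \<Gamma>. \<forall>R.
        \<Gamma>\<^sub>1 \<subseteq> \<Gamma>\<^sub>0 \<and> right_transversal G \<Gamma>\<^sub>0 \<Gamma>\<^sub>1 R \<longrightarrow>
          (\<forall>h\<in>sum_domain G \<Gamma> \<pi> L s \<rho> \<Gamma>\<^sub>0. V \<Gamma>\<^sub>0 h = V \<Gamma>\<^sub>1 (\<Sum>r\<in>R. \<pi> r h))) \<and>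
     closure (cspan (\<Union>\<Gamma>\<^sub>0\<in>subgroup_family G \<Gamma>. V \<Gamma>\<^sub>0 ` sum_domain G \<Gamma> \<pi> L s \<rho> \<Gamma>\<^sub>0)) = UNIV"

text \<open>The level spaces \<open>H\<^sub>0\<^bsup>\<Gamma>\<^sub>0\<^esup>\<close> (for \<open>\<rho> = \<pi>\<^sub>0\<close>) and \<open>H\<^bsup>\<Gamma>\<^sub>0\<^esup>\<close> (for \<open>\<rho> = \<pi>\<close>).\<close>

definition virtual_level ::
    "('g, 'm) monoid_scheme \<Rightarrow> 'g set \<Rightarrow> ('g \<Rightarrow> 'a::chilbert \<Rightarrow> 'a) \<Rightarrow> 'a set \<Rightarrow>
     ('g set \<Rightarrow> nat \<Rightarrow> 'g) \<Rightarrow> ('g \<Rightarrow> 'a \<Rightarrow> 'a) \<Rightarrow> ('g set \<Rightarrow> 'a \<Rightarrow> 'k::chilbert) \<Rightarrow> 'g set \<Rightarrow> 'k set" where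
  "virtual_level G \<Gamma> \<pi> L s \<rho> V \<Gamma>\<^sub>0 = V \<Gamma>\<^sub>0 ` sum_domain G \<Gamma> \<pi> L s \<rho> \<Gamma>\<^sub>0"

text \<open>The unitary representation \<open>\<Phi>\<close> of the Schlichting completion on the space of virtual vectors.
  The representative \<open>h\<close> of a vector of level \<open>\<Gamma>\<^sub>0\<close> has to be such that \<open>\<pi>(g)h\<close> again defines a formal
  sum; vectors \<open>h = P\<^sub>0l\<close> are of this kind, and suffice to determine \<open>\<Phi>\<close>.\<close>

definition virtual_rep ::
    "('g, 'm) monoid_scheme \<Rightarrow> 'g set \<Rightarrow> ('g \<Rightarrow> 'a::chilbert \<Rightarrow> 'a) \<Rightarrow> 'a set \<Rightarrow>
     ('g set \<Rightarrow> nat \<Rightarrow> 'g) \<Rightarrow> ('g \<Rightarrow> 'a \<Rightarrow> 'a) \<Rightarrow> ('g set \<Rightarrow> 'a \<Rightarrow> 'k::chilbert) \<Rightarrow>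
     ('c, 'n) monoid_scheme \<Rightarrow> 'c topology \<Rightarrow> ('g \<Rightarrow> 'c) \<Rightarrow> ('c \<Rightarrow> 'k \<Rightarrow> 'k) \<Rightarrow> bool" where
  "virtual_rep G \<Gamma> \<pi> L s \<rho> V C T \<iota> \<Phi> \<longleftrightarrow>
     unitary_rep C UNIV \<Phi> \<and> (\<forall>v. continuous_map T euclidean (\<lambda>x. \<Phi> x v)) \<and>
     (\<forall>g\<in>carrier G. \<forall>\<Gamma>\<^sub>0\<in>subgroup_family G \<Gamma>.
        (let \<Gamma>\<^sub>1 = conj_meet G \<Gamma>\<^sub>0 (inv\<^bsub>G\<^esub> g) in
        \<forall>h\<in>sum_domain G \<Gamma> \<pi> L s \<rho> \<Gamma>\<^sub>1.
          V \<Gamma>\<^sub>1 h \<in> virtual_level G \<Gamma> \<pi> L s \<rho> V \<Gamma>\<^sub>0 \<and>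
          \<pi> g h \<in> sum_domain G \<Gamma> \<pi> L s \<rho> (conj_subgroup G g \<Gamma>\<^sub>1) \<longrightarrow>
            \<Phi> (\<iota> g) (V \<Gamma>\<^sub>1 h) = V (conj_subgroup G g \<Gamma>\<^sub>1) (\<pi> g h)))"


section \<open>Hecke operators\<close>

definition hecke_operator ::
    "('g, 'm) monoid_scheme \<Rightarrow> ('g \<Rightarrow> 'c) \<Rightarrow> ('c \<Rightarrow> 'k::chilbert \<Rightarrow> 'k) \<Rightarrow> 'k set \<Rightarrow> 'g set \<Rightarrow> 'g \<Rightarrow>
     'k \<Rightarrow> 'k" where
  "hecke_operator G \<iota> \<Phi> M \<Gamma>\<^sub>0 \<sigma> v =
     scaleC (of_nat (index G \<Gamma>\<^sub>0 (conj_meet G \<Gamma>\<^sub>0 \<sigma>))) (proj M (\<Phi> (\<iota> \<sigma>) (proj M v)))"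

text \<open>The embedding \<open>\<Sum>\<^bsub>\<gamma>\<in>\<Gamma>\<^sub>0\<^esub> \<pi>\<^sub>0(\<gamma>)h \<mapsto> \<Sum>\<^bsub>\<gamma>\<in>\<Gamma>\<^sub>0\<^esub> \<pi>(\<gamma>)P\<^sub>0h\<close>; \<open>D\<close> is the set of admissible \<open>h\<close>.\<close>

definition level_embedding ::
    "('a::chilbert \<Rightarrow> 'k::chilbert) \<Rightarrow> ('a \<Rightarrow> 'l::chilbert) \<Rightarrow> 'a set \<Rightarrow> 'a set \<Rightarrow> 'k \<Rightarrow> 'l" where
  "level_embedding V\<^sub>0 V D H\<^sub>0 v = (THE w. \<exists>h\<in>D. v = V\<^sub>0 h \<and> w = V (proj H\<^sub>0 h))"

text \<open>The operator on the target space of the isometric embedding \<open>J\<close> of \<open>M\<close> which is \<open>T\<close> on \<open>M\<close> and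
  \<open>0\<close> on the orthogonal complement of \<open>M\<close>.\<close>

definition extend_by_zero ::
    "('k::chilbert \<Rightarrow> 'l::chilbert) \<Rightarrow> 'k set \<Rightarrow> ('k \<Rightarrow> 'k) \<Rightarrow> 'l \<Rightarrow> 'l" where
  "extend_by_zero J M T w = J (T (inv_into M J (proj (J ` M) w)))"

end

theory Submission
  imports Defs
begin

text \<open>On the level space \<open>L\<^bsup>\<Delta>\<^esup>\<close> of \<open>\<Delta>\<close> the formal sum \<open>\<Sum>\<^bsub>\<gamma>\<in>\<Delta>\<^esub> \<pi>(\<gamma>)x\<close> has the
  coefficient \<open>x\<close> itself, because the translates of \<open>L\<close> by \<open>\<Gamma>\<close> are orthogonal; so \<open>H\<^bsup>\<Delta>\<^esup>\<close> is \<open>L\<^bsup>\<Delta>\<^esup>\<close> with a rescaled scalar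
  product, and \<open>x \<mapsto> \<Sum>\<^bsub>\<gamma>\<in>\<Delta>\<^esub> P \<pi>\<^sub>0(\<gamma>)x\<close> is the orthogonal projection of \<open>L\<^bsup>\<Delta>\<^esup>\<close> onto \<open>H\<^sub>0\<^bsup>\<Delta>\<^esup>\<close>. The scalar product of
  two virtual vectors of level \<open>\<Delta>\<close> is, up to the factor \<open>[\<Gamma>:\<Delta>]\<close>, the sum of the matrix coefficients
  \<open>\<langle>\<pi>\<^sub>0(\<gamma>)h, k\<rangle>\<close> over \<open>\<gamma> \<in> \<Delta>\<close>. Hence projecting the sum over a subgroup \<open>\<Delta>' \<subseteq> \<Delta>\<close> to level \<open>\<Delta>\<close> gives the sum
  over \<open>\<Delta>\<close> divided by \<open>[\<Delta>:\<Delta>']\<close>, and the Hecke operator sends the sum of \<open>x\<close> over \<open>\<Delta>\<close> to the sum of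
  \<open>\<pi>\<^sub>0(\<theta>)x\<close> over \<open>\<theta> \<in> \<Delta>\<sigma>\<Delta> = \<Squnion>\<^sub>r \<Delta>\<sigma>r\<close>. Its matrix entries are read off after sandwiching between the
  projections onto \<open>\<pi>(s\<^sub>i)L\<close> and \<open>\<pi>(s\<^sub>j)L\<close>.\<close>

section \<open>Complex Hilbert spaces\<close>

\<comment> \<open>Two obstacles shape the argument. The vectors \<open>h\<close> with convergent
  sums are stable under \<open>\<pi> \<gamma>\<close> for \<open>\<gamma>\<close> in \<Gamma>, but
  no such stability is at hand for a general \<sigma> in G, while the action of \<sigma> on a
  virtual vector is prescribed only through representatives \<open>h\<close> for which
  \<open>\<pi> \<sigma> h\<close> is again admissible. Therefore each virtual vector of level
  \<Delta> is represented by \<open>P\<^sub>0\<close> of a combination of \<Gamma>-translates of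
  \<open>L\<close>; for these the Hilbert-Schmidt clause of \<open>technical_condition\<close>
  supplies the convergence. Secondly, that clause speaks of cosets of members of the family, and the
  index set of a matrix entry is not given as one, so it is first cut into finitely many such
  cosets.

  As for constants: the factor \<open>[\<Delta>:\<Delta>\<^sub>\<sigma>]\<close> in the Hecke
  operator cancels the denominator produced by projecting from level
  \<open>\<Delta>\<^sub>\<sigma>\<close> back to \<Delta>, so the matrix carries no constant. The
  unitary onto the tensor product divides by the square root of \<open>[\<Gamma>:\<Delta>]\<close>,
  which turns the averaged scalar product of virtual vectors into the plain one.\<close>
subclass (in chilbert) banach ..

lemma scaleC_zero_left [simp]: "scaleC 0 (x::'a::chilbert) = 0"
  using scaleC_of_real[of 0 x] by simp

lemma scaleC_one [simp]: "scaleC 1 (x::'a::chilbert) = x"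
  using scaleC_of_real[of 1 x] by simp

lemma scaleC_zero_right [simp]: "scaleC a (0::'a::chilbert) = 0"
  using scaleC_add_right[of a "0::'a" 0] by simp

lemma scaleC_minus_right [simp]: "scaleC a (- x::'a::chilbert) = - scaleC a x"
  using scaleC_add_right[of a x "- x"] by (simp add: eq_neg_iff_add_eq_0 add.commute)

lemma scaleC_sum_right: "scaleC a (sum f A) = (\<Sum>i\<in>A. scaleC a (f i::'a::chilbert))"
  by (induction A rule: infinite_finite_induct) (simp_all add: scaleC_add_right)

lemma cinner_add_right: "cinner x (y + z::'a::chilbert) = cinner x y + cinner x z"
  by (metis cinner_add_left cinner_commute complex_cnj_add)

lemma cinner_scaleC_right: "cinner x (scaleC a (y::'a::chilbert)) = cnj a * cinner x y"
  by (metis cinner_commute cinner_scaleC_left complex_cnj_mult)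

lemma cinner_scaleR_left: "cinner (r *\<^sub>R x) (y::'a::chilbert) = of_real r * cinner x y"
  by (metis cinner_scaleC_left scaleC_of_real)

lemma cinner_scaleR_right: "cinner x (r *\<^sub>R (y::'a::chilbert)) = of_real r * cinner x y"
  by (metis cinner_scaleC_right scaleC_of_real complex_cnj_complex_of_real)

lemma cinner_zero_left [simp]: "cinner 0 (x::'a::chilbert) = 0"
  using cinner_scaleR_left[of 0 0 x] by simp

lemma cinner_zero_right [simp]: "cinner (x::'a::chilbert) 0 = 0"
  using cinner_scaleR_right[of x 0 0] by simp

lemma cinner_minus_left: "cinner (- x) (y::'a::chilbert) = - cinner x y"
  using cinner_scaleR_left[of "-1" x y] by simp

lemma cinner_minus_right: "cinner x (- y::'a::chilbert) = - cinner x y"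
  using cinner_scaleR_right[of x "-1" y] by simp

lemma cinner_diff_left: "cinner (x - y) (z::'a::chilbert) = cinner x z - cinner y z"
  using cinner_add_left[of x "- y" z] by (simp add: cinner_minus_left)

lemma cinner_diff_right: "cinner x (y - z::'a::chilbert) = cinner x y - cinner x z"
  using cinner_add_right[of x y "- z"] by (simp add: cinner_minus_right)

lemma cinner_sum_left: "cinner (sum f A) (y::'a::chilbert) = (\<Sum>i\<in>A. cinner (f i) y)"
  by (induction A rule: infinite_finite_induct) (simp_all add: cinner_add_left)

lemma cinner_sum_right: "cinner x (sum f A) = (\<Sum>i\<in>A. cinner x (f i::'a::chilbert))"
  by (induction A rule: infinite_finite_induct) (simp_all add: cinner_add_right)

lemma cinner_self: "cinner x (x::'a::chilbert) = of_real ((norm x)\<^sup>2)"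
proof -
  have "Im (cinner x x) = 0"
    using cinner_commute[of x x] by (metis complex_cnj_cancel_iff Im_complex_of_real Reals_cnj_iff complex_is_Real_iff)
  then show ?thesis
    by (simp add: complex_eq_iff flip: inner_eq_Re_cinner power2_norm_eq_inner)
qed

lemma norm_scaleC: "norm (scaleC a (x::'a::chilbert)) = cmod a * norm x"
proof -
  have "complex_of_real ((norm (scaleC a x))\<^sup>2) = (a * cnj a) * cinner x x"
    unfolding cinner_self[symmetric] cinner_scaleC_left cinner_scaleC_right by simp
  also have "\<dots> = of_real ((cmod a * norm x)\<^sup>2)"
    unfolding cinner_self complex_norm_square[symmetric] by (simp add: power_mult_distrib)
  finally have "complex_of_real ((norm (scaleC a x))\<^sup>2) = of_real ((cmod a * norm x)\<^sup>2)" .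
  then have "(norm (scaleC a x))\<^sup>2 = (cmod a * norm x)\<^sup>2"
    using of_real_eq_iff by blast
  then show ?thesis by simp
qed

lemma cmod_cinner_le: "cmod (cinner x (y::'a::chilbert)) \<le> norm x * norm y"
proof (cases "cinner x y = 0")
  case False
  define a where "a = cnj (cinner x y) / cmod (cinner x y)"
  have a: "cmod a = 1" "a * cinner x y = cmod (cinner x y)"
    using False by (auto simp: a_def norm_divide field_simps power2_eq_square simp flip: complex_norm_square)
  have "cmod (cinner x y) = inner (scaleC a x) y"
    by (simp add: inner_eq_Re_cinner cinner_scaleC_left a)
  also have "\<dots> \<le> norm (scaleC a x) * norm y" by (rule norm_cauchy_schwarz)
  finally show ?thesis by (simp add: norm_scaleC a)
qed simp

lemma bounded_linear_cinner_left: "bounded_linear (\<lambda>x::'a::chilbert. cinner x y)"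
  by (rule bounded_linear_intro[where K = "norm y"])
     (simp_all add: cinner_add_left cinner_scaleR_left scaleR_conv_of_real cmod_cinner_le)

lemma bounded_linear_scaleC: "bounded_linear (scaleC a :: 'a::chilbert \<Rightarrow> 'a)"
proof (rule bounded_linear_intro[where K = "cmod a"])
  show "scaleC a (r *\<^sub>R x) = r *\<^sub>R scaleC a (x::'a)" for r x
    by (simp add: scaleC_scaleC mult.commute flip: scaleC_of_real)
qed (simp_all add: scaleC_add_right norm_scaleC mult.commute)

lemma clinear_on_scaleR: "clinear_on M T \<Longrightarrow> x \<in> M \<Longrightarrow> T (r *\<^sub>R x) = r *\<^sub>R T x"
  unfolding clinear_on_def by (metis scaleC_of_real)

lemma bounded_clinear_imp_bounded_linear: "bounded_clinear T \<Longrightarrow> bounded_linear T"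
proof -
  assume T: "bounded_clinear T"
  then obtain C where "\<And>x. norm (T x) \<le> C * norm x" by (auto simp: bounded_clinear_def)
  with T show ?thesis
    by (intro bounded_linear_intro[where K = C])
       (auto simp: bounded_clinear_def clinear_on_scaleR mult.commute, simp add: clinear_on_def)
qed

section \<open>Complex subspaces\<close>

lemma csubspace_zero: "csubspace M \<Longrightarrow> 0 \<in> M"
  and csubspace_add: "csubspace M \<Longrightarrow> x \<in> M \<Longrightarrow> y \<in> M \<Longrightarrow> x + y \<in> M"
  and csubspace_scaleC: "csubspace M \<Longrightarrow> x \<in> M \<Longrightarrow> scaleC a x \<in> M"
  by (simp_all add: csubspace_def)

lemma csubspace_scaleR: "csubspace M \<Longrightarrow> x \<in> M \<Longrightarrow> r *\<^sub>R x \<in> M"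
  using csubspace_scaleC[of M x "of_real r"] by (simp add: scaleC_of_real)

lemma csubspace_diff: "csubspace M \<Longrightarrow> x \<in> M \<Longrightarrow> y \<in> M \<Longrightarrow> x - y \<in> M"
  using csubspace_add[of M x "(-1) *\<^sub>R y"] csubspace_scaleR[of M y "-1"] by simp

lemma csubspace_sum: "csubspace M \<Longrightarrow> (\<And>i. i \<in> A \<Longrightarrow> f i \<in> M) \<Longrightarrow> sum f A \<in> M"
  by (induction A rule: infinite_finite_induct) (simp_all add: csubspace_zero csubspace_add)

text \<open>The imaginary part of \<open>cinner x z\<close> is the real part of
  \<open>cinner x (scaleC \<i> z)\<close>, and a complex subspace contains
  \<open>scaleC \<i> z\<close>. This lets the minimisation below work with the real scalar
  product.\<close>

lemma csubspace_orthogonal: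
  assumes "csubspace M" "\<And>z. z \<in> M \<Longrightarrow> inner (x::'a::chilbert) z = 0" "z \<in> M"
  shows "cinner x z = 0"
proof -
  have "Re (cinner x (scaleC \<i> z)) = 0" "Re (cinner x z) = 0"
    using assms csubspace_scaleC[OF assms(1,3)] by (simp_all flip: inner_eq_Re_cinner)
  then show ?thesis by (simp add: cinner_scaleC_right complex_eq_iff)
qed

section \<open>Orthogonal projections\<close>

lemma nearest_point_exists:
  fixes M :: "'a::chilbert set"
  assumes "csubspace M" "closed M"
  shows "\<exists>y\<in>M. \<forall>z\<in>M. norm (x - y) \<le> norm (x - z)"
proof -
  define d where "d = (INF z\<in>M. (norm (x - z))\<^sup>2)"
  have ne: "M \<noteq> {}" using csubspace_zero[OF assms(1)] by auto
  have bdd: "bdd_below ((\<lambda>z. (norm (x - z))\<^sup>2) ` M)" by (rule bdd_belowI2[of _ 0]) simp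
  have d_le: "d \<le> (norm (x - z))\<^sup>2" if "z \<in> M" for z
    unfolding d_def using bdd that by (rule cINF_lower)
  have "\<exists>z\<in>M. (norm (x - z))\<^sup>2 < d + inverse (real (Suc n))" for n
    using cINF_less_iff[OF ne bdd, of "d + inverse (real (Suc n))"]
    unfolding d_def by simp
  then obtain f where f: "\<And>n. f n \<in> M" "\<And>n. (norm (x - f n))\<^sup>2 < d + inverse (real (Suc n))"
    by metis
  have par: "(norm (f m - f n))\<^sup>2 \<le> 2 * inverse (real (Suc m)) + 2 * inverse (real (Suc n))" for m n
  proof -
    \<comment> \<open>Parallelogram law: the midpoint \<open>z\<close> lies in \<open>M\<close>, so
      its squared distance from \<open>x\<close> is at least \<open>d\<close>, which forces nearly
      minimising points to be close together.\<close>
    define z where "z = (1/2) *\<^sub>R (f m + f n)"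
    have "z \<in> M" unfolding z_def by (intro csubspace_scaleR csubspace_add assms f)
    moreover have "(norm (f m - f n))\<^sup>2 = 2 * (norm (x - f m))\<^sup>2 + 2 * (norm (x - f n))\<^sup>2 - 4 * (norm (x - z))\<^sup>2"
      by (simp add: power2_norm_eq_inner z_def inner_diff_left inner_diff_right inner_add_left
            inner_add_right inner_commute algebra_simps)
    ultimately show ?thesis using f(2)[of m] f(2)[of n] d_le[of z] by linarith
  qed
  have "Cauchy f"
  proof (rule metric_CauchyI)
    fix e :: real assume "0 < e"
    then obtain k where k: "inverse (real (Suc k)) < e\<^sup>2 / 4"
      using reals_Archimedean[of "e\<^sup>2 / 4"] by auto
    have "dist (f m) (f n) < e" if "m \<ge> k" "n \<ge> k" for m n
    proof -
      have "inverse (real (Suc m)) \<le> inverse (real (Suc k))" "inverse (real (Suc n)) \<le> inverse (real (Suc k))"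
        using that by (simp_all add: field_simps)
      with par[of m n] k have "(norm (f m - f n))\<^sup>2 < e\<^sup>2" by linarith
      then show ?thesis using \<open>0 < e\<close> by (metis dist_norm power_less_imp_less_base less_imp_le)
    qed
    then show "\<exists>k. \<forall>m\<ge>k. \<forall>n\<ge>k. dist (f m) (f n) < e" by blast
  qed
  then obtain y where y: "f \<longlonglongrightarrow> y" using Cauchy_convergent_iff convergent_def by blast
  have "(norm (x - y))\<^sup>2 \<le> d"
  proof (rule LIMSEQ_le)
    show "(\<lambda>n. (norm (x - f n))\<^sup>2) \<longlonglongrightarrow> (norm (x - y))\<^sup>2" by (intro tendsto_intros y)
    show "(\<lambda>n. d + inverse (real (Suc n))) \<longlonglongrightarrow> d"
      using tendsto_add[OF tendsto_const LIMSEQ_inverse_real_of_nat, of d] by simp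
  qed (use f(2) less_imp_le in blast)
  then have "norm (x - y) \<le> norm (x - z)" if "z \<in> M" for z
    by (meson order_trans power2_le_imp_le norm_ge_zero d_le that)
  moreover have "y \<in> M" using closed_sequentially[OF assms(2) f(1) y] by simp
  ultimately show ?thesis by blast
qed

lemma orthogonal_decomposition:
  fixes M :: "'a::chilbert set"
  assumes "closed_csubspace M"
  shows "\<exists>y\<in>M. \<forall>z\<in>M. cinner (x - y) z = 0"
proof -
  have M: "csubspace M" "closed M" using assms by (simp_all add: closed_csubspace_def)
  obtain y where y: "y \<in> M" "\<And>z. z \<in> M \<Longrightarrow> norm (x - y) \<le> norm (x - z)"
    using nearest_point_exists[OF M, of x] by blast
  have "inner (x - y) z = 0" if "z \<in> M" for z
  proof (rule ccontr)
    assume nz: "inner (x - y) z \<noteq> 0"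
    then have z: "inner z z > 0" by (metis inner_gt_zero_iff inner_zero_right)
    \<comment> \<open>This \<open>t\<close> minimises the norm of
      \<open>x - y - t *\<^sub>R z\<close>; if the scalar product did not vanish,
      \<open>y + t *\<^sub>R z\<close> would be strictly nearer to \<open>x\<close> than
      \<open>y\<close>.\<close>
    define t where "t = inner (x - y) z / inner z z"
    have "(norm (x - y))\<^sup>2 \<le> (norm (x - (y + t *\<^sub>R z)))\<^sup>2"
      by (intro power_mono y csubspace_add csubspace_scaleR M that norm_ge_zero)
    also have "\<dots> = (norm (x - y))\<^sup>2 - 2 * t * inner (x - y) z + t * (t * inner z z)"
      unfolding diff_diff_eq[symmetric] power2_norm_eq_inner[of "x - y"] power2_norm_eq_inner[of "x - y - _"]
      by (simp add: inner_diff_left[of "x - y"] inner_diff_right[of _ "x - y"] inner_commute[of z "x - y"] right_diff_distrib)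
    also have "\<dots> = (norm (x - y))\<^sup>2 - (inner (x - y) z)\<^sup>2 / inner z z"
      using z by (simp add: t_def field_simps power2_eq_square)
    finally have "(inner (x - y) z)\<^sup>2 / inner z z \<le> 0" by simp
    moreover have "0 < (inner (x - y) z)\<^sup>2 / inner z z" using nz z by (intro divide_pos_pos) auto
    ultimately show False by simp
  qed
  then show ?thesis using y(1) csubspace_orthogonal[OF M(1)] by blast
qed

text \<open>Exhibiting a candidate settles existence in the definite description
  \<open>proj\<close>, and the difference of two candidates is orthogonal to itself. Projections
  onto level spaces are evaluated in this form, from explicit candidates.\<close>

lemma proj_eqI:
  fixes x :: "'a::chilbert"
  assumes "csubspace M" "y \<in> M" "\<And>z. z \<in> M \<Longrightarrow> cinner (x - y) z = 0"
  shows "proj M x = y"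
  unfolding proj_def
proof (rule the_equality)
  fix y' assume y': "y' \<in> M \<and> (\<forall>z\<in>M. cinner (x - y') z = 0)"
  have "y' - y \<in> M" using assms y' by (simp add: csubspace_diff)
  then have "cinner (x - y) (y' - y) = 0" "cinner (x - y') (y' - y) = 0" using assms y' by auto
  then have "cinner (y' - y) (y' - y) = 0" by (simp add: cinner_diff_left)
  then show "y' = y" by (simp add: cinner_self)
qed (use assms in auto)

context
  fixes M :: "'a::chilbert set"
  assumes M: "closed_csubspace M"
begin

lemma closed_csubspace_imp_csubspace: "csubspace M"
  using M by (simp add: closed_csubspace_def)

lemma proj_characterization: "proj M x \<in> M \<and> (\<forall>z\<in>M. cinner (x - proj M x) z = 0)"
proof -
  obtain y where y: "y \<in> M" "\<forall>z\<in>M. cinner (x - y) z = 0"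
    using orthogonal_decomposition[OF M, of x] by (elim bexE)
  have "proj M x = y"
    by (rule proj_eqI[OF closed_csubspace_imp_csubspace y(1)]) (rule bspec[OF y(2)])
  with y show ?thesis by metis
qed

lemma proj_in: "proj M x \<in> M"
  using proj_characterization[of x] by (rule conjunct1)

lemma proj_orthogonal: "z \<in> M \<Longrightarrow> cinner (x - proj M x) z = 0"
  using proj_characterization[of x] by (rule bspec[OF conjunct2])

lemma proj_ident: "x \<in> M \<Longrightarrow> proj M x = x"
  by (rule proj_eqI[OF closed_csubspace_imp_csubspace]) simp_all

lemma cinner_proj_left: "z \<in> M \<Longrightarrow> cinner (proj M x) z = cinner x z"
  using proj_orthogonal[of z x] by (metis cinner_diff_left right_minus_eq)

lemma cinner_proj_commute: "cinner (proj M x) y = cinner x (proj M y)"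
proof -
  have "cinner (proj M x) y = cnj (cinner y (proj M x))" by (rule cinner_commute)
  also have "\<dots> = cnj (cinner (proj M y) (proj M x))" by (simp only: cinner_proj_left[OF proj_in])
  also have "\<dots> = cinner (proj M x) (proj M y)" by (rule cinner_commute[symmetric])
  also have "\<dots> = cinner x (proj M y)" by (rule cinner_proj_left[OF proj_in])
  finally show ?thesis .
qed

lemma proj_add: "proj M (x + y) = proj M x + proj M y"
  by (rule proj_eqI[OF closed_csubspace_imp_csubspace])
     (simp_all add: proj_in csubspace_add closed_csubspace_imp_csubspace cinner_diff_left cinner_add_left
       cinner_proj_left)

lemma proj_scaleC: "proj M (scaleC a x) = scaleC a (proj M x)"
  by (rule proj_eqI[OF closed_csubspace_imp_csubspace])
     (simp_all add: proj_in csubspace_scaleC closed_csubspace_imp_csubspace cinner_diff_left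
       cinner_scaleC_left cinner_proj_left)

lemma norm_proj_le: "norm (proj M x) \<le> norm x"
proof -
  have "(norm (proj M x))\<^sup>2 = Re (cinner x (proj M x))"
    using cinner_proj_left[OF proj_in, of x x] unfolding cinner_self by (metis Re_complex_of_real)
  also have "\<dots> \<le> norm x * norm (proj M x)"
    unfolding inner_eq_Re_cinner[symmetric] by (rule norm_cauchy_schwarz)
  finally show ?thesis by (cases "norm (proj M x) = 0") (auto simp: power2_eq_square)
qed

lemma bounded_clinear_proj: "bounded_clinear (proj M)"
  unfolding bounded_clinear_def clinear_on_def
  by (auto simp: proj_add proj_scaleC intro!: exI[of _ 1] norm_proj_le)

lemma bounded_linear_proj: "bounded_linear (proj M)"
  by (rule bounded_clinear_imp_bounded_linear[OF bounded_clinear_proj])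

lemma proj_sum: "proj M (sum f A) = (\<Sum>i\<in>A. proj M (f i))"
  by (rule linear_sum[OF bounded_linear.linear[OF bounded_linear_proj]])

end

section \<open>Orthonormal bases and Hilbert--Schmidt norms\<close>

lemma csubspace_cspan: "csubspace (cspan (X::'a::chilbert set))"
  unfolding cspan_def by (rule hull_in) (auto simp: csubspace_def)

lemma csubspace_closure: "csubspace M \<Longrightarrow> csubspace (closure (M::'a::chilbert set))"
  unfolding csubspace_def
proof (intro conjI ballI allI)
  assume *: "0 \<in> M \<and> (\<forall>x\<in>M. \<forall>y\<in>M. x + y \<in> M) \<and> (\<forall>a. \<forall>x\<in>M. scaleC a x \<in> M)"
  then show "0 \<in> closure M" using closure_subset by blast
  fix x assume "x \<in> closure M"
  then obtain f where f: "\<And>n. f n \<in> M" "f \<longlonglongrightarrow> x" by (auto simp: closure_sequential)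
  show "scaleC a x \<in> closure M" for a
    unfolding closure_sequential using f * bounded_linear.tendsto[OF bounded_linear_scaleC f(2)]
    by (intro exI[of _ "\<lambda>n. scaleC a (f n)"]) auto
  fix y assume "y \<in> closure M"
  then obtain g where g: "\<And>n. g n \<in> M" "g \<longlonglongrightarrow> y" by (auto simp: closure_sequential)
  show "x + y \<in> closure M"
    unfolding closure_sequential using f g *
    by (intro exI[of _ "\<lambda>n. f n + g n"]) (auto intro: tendsto_add)
qed

text \<open>\<open>some_onb\<close> is a choice, so \<open>hs_norm\<close> has its meaning only once
  a basis exists. A maximal orthonormal set is one: otherwise the normalised component of some
  \<open>x\<close> orthogonal to its closed span could be added.\<close>

lemma onb_exists: "\<exists>B. is_onb (UNIV::'a::chilbert set) B"
proof -
  define Os where "Os = {B::'a set. (\<forall>b\<in>B. norm b = 1) \<and> (\<forall>b\<in>B. \<forall>c\<in>B. b \<noteq> c \<longrightarrow> cinner b c = 0)}"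
  have "\<exists>U\<in>Os. \<forall>X\<in>K. X \<subseteq> U" if K: "K \<in> chains Os" for K
  proof (intro bexI[of _ "\<Union>K"] ballI)
    have "cinner b c = 0" if bc: "X \<in> K" "b \<in> X" "Y \<in> K" "c \<in> Y" "b \<noteq> c" for X Y b c
    proof -
      have "X \<subseteq> Y \<or> Y \<subseteq> X" "X \<in> Os" "Y \<in> Os" using K bc by (auto simp: chains_def chain_subset_def)
      then show ?thesis using bc unfolding Os_def by blast
    qed
    moreover have "norm b = 1" if "X \<in> K" "b \<in> X" for X b
      using K that by (auto simp: chains_def Os_def)
    ultimately show "\<Union>K \<in> Os" unfolding Os_def by blast
  qed auto
  then have "\<exists>B\<in>Os. \<forall>X\<in>Os. B \<subseteq> X \<longrightarrow> X = B" by (intro Zorn_Lemma2 ballI)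
  then obtain B where B: "B \<in> Os" "\<And>X. X \<in> Os \<Longrightarrow> B \<subseteq> X \<Longrightarrow> X = B" by metis
  let ?M = "closure (cspan B)"
  have M: "closed_csubspace ?M"
    by (simp add: closed_csubspace_def csubspace_closure csubspace_cspan)
  have BM: "B \<subseteq> ?M" unfolding cspan_def by (meson closure_subset hull_subset subset_trans)
  have "x \<in> ?M" for x
  proof (rule ccontr)
    assume x: "x \<notin> ?M"
    define y where "y = x - proj ?M x"
    have "y \<noteq> 0" using x proj_in[OF M, of x] by (auto simp: y_def)
    define b where "b = (1 / norm y) *\<^sub>R y"
    have b: "norm b = 1" using \<open>y \<noteq> 0\<close> by (simp add: b_def)
    have orth: "cinner b c = 0" if "c \<in> ?M" for c
      using proj_orthogonal[OF M that, of x] by (simp add: b_def y_def cinner_scaleR_left)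
    then have orth': "cinner c b = 0" if "c \<in> B" for c
      using BM that cinner_commute[of c b] by auto
    have "insert b B \<in> Os" using B(1) b orth orth' BM unfolding Os_def by auto
    then have "b \<in> B" using B(2)[of "insert b B"] by auto
    then have "cinner b b = 0" using orth BM by blast
    then show False using b by (simp add: cinner_self)
  qed
  then show ?thesis using B(1) unfolding is_onb_def Os_def by auto
qed

lemma is_onb_some_onb: "is_onb UNIV (some_onb (UNIV::'a::chilbert set))"
  unfolding some_onb_def using onb_exists by (rule someI_ex)

text \<open>\<open>cspan\<close> is defined as a hull; the finite combinations form a complex
  subspace containing \<open>B\<close>, hence contain the hull.\<close>

lemma cspan_finite_combination:
  assumes "x \<in> cspan (B::'a::chilbert set)"
  shows "\<exists>F a. finite F \<and> F \<subseteq> B \<and> x = (\<Sum>b\<in>F. scaleC (a b) b)"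
proof -
  define S where "S = {\<Sum>b\<in>F. scaleC (a b) b | F a. finite F \<and> F \<subseteq> B}"
  have "csubspace S"
    unfolding csubspace_def
  proof (intro conjI ballI allI)
    show "0 \<in> S" unfolding S_def by (auto intro!: exI[of _ "{}"])
    fix x assume "x \<in> S"
    then obtain F a where x: "x = (\<Sum>b\<in>F. scaleC (a b) b)" "finite F" "F \<subseteq> B" by (auto simp: S_def)
    show "scaleC c x \<in> S" for c
      unfolding S_def using x
      by (auto intro!: exI[of _ F] exI[of _ "\<lambda>b. c * a b"] simp: scaleC_sum_right scaleC_scaleC)
    fix y assume "y \<in> S"
    then obtain F' a' where y: "y = (\<Sum>b\<in>F'. scaleC (a' b) b)" "finite F'" "F' \<subseteq> B" by (auto simp: S_def)
    have "x = (\<Sum>b\<in>F \<union> F'. scaleC (if b \<in> F then a b else 0) b)"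
      unfolding x(1) using x(2) y(2) by (intro sum.mono_neutral_cong_left) auto
    moreover have "y = (\<Sum>b\<in>F \<union> F'. scaleC (if b \<in> F' then a' b else 0) b)"
      unfolding y(1) using x(2) y(2) by (intro sum.mono_neutral_cong_left) auto
    ultimately have "x + y = (\<Sum>b\<in>F \<union> F'. scaleC ((if b \<in> F then a b else 0) + (if b \<in> F' then a' b else 0)) b)"
      by (simp add: sum.distrib scaleC_add_left)
    then show "x + y \<in> S" unfolding S_def using x(2,3) y(2,3)
      by (auto intro!: exI[of _ "F \<union> F'"] exI[of _ "\<lambda>b. (if b \<in> F then a b else 0) + (if b \<in> F' then a' b else 0)"])
  qed
  moreover have "B \<subseteq> S"
  proof
    fix b assume "b \<in> B"
    then show "b \<in> S" unfolding S_def by (auto intro!: exI[of _ "{b}"] exI[of _ "\<lambda>_. 1"])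
  qed
  ultimately have "cspan B \<subseteq> S" unfolding cspan_def by (intro hull_minimal)
  then show ?thesis using assms unfolding S_def by blast
qed

text \<open>On finite combinations of basis vectors this is the Cauchy-Schwarz inequality for the
  coefficients against the norms of the images; both sides are continuous and such combinations are
  dense. It turns Hilbert-Schmidt convergence into convergence at each vector.\<close>

lemma norm_le_hs_norm:
  fixes T :: "'a::chilbert \<Rightarrow> 'a"
  assumes "hilbert_schmidt T"
  shows "norm (T x) \<le> hs_norm T * norm x"
proof -
  let ?B = "some_onb (UNIV :: 'a set)"
  have B: "\<And>b. b \<in> ?B \<Longrightarrow> norm b = 1" "\<And>b c. b \<in> ?B \<Longrightarrow> c \<in> ?B \<Longrightarrow> b \<noteq> c \<Longrightarrow> cinner b c = 0"
    "closure (cspan ?B) = UNIV"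
    using is_onb_some_onb[where 'a='a] by (auto simp: is_onb_def)
  have T: "bounded_clinear T" "(\<lambda>b. (norm (T b))\<^sup>2) summable_on ?B"
    using assms by (auto simp: hilbert_schmidt_def)
  interpret T: bounded_linear T by (rule bounded_clinear_imp_bounded_linear[OF T(1)])
  have TC: "T (scaleC a y) = scaleC a (T y)" for a y
    using T(1) by (auto simp: bounded_clinear_def clinear_on_def)
  have *: "norm (T x) \<le> hs_norm T * norm x" if x: "x \<in> cspan ?B" for x
  proof -
    obtain F a where F: "finite F" "F \<subseteq> ?B" "x = (\<Sum>b\<in>F. scaleC (a b) b)"
      using cspan_finite_combination[OF x] by blast
    have "cinner x x = (\<Sum>b\<in>F. cinner (scaleC (a b) b) x)"
      by (subst (1) F(3)) (simp add: cinner_sum_left)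
    also have "\<dots> = (\<Sum>b\<in>F. \<Sum>c\<in>F. a b * (cnj (a c) * cinner b c))"
      unfolding F(3) by (simp only: cinner_sum_right cinner_scaleC_left cinner_scaleC_right mult.left_commute)
    also have "\<dots> = (\<Sum>b\<in>F. \<Sum>c\<in>F. if b = c then of_real ((cmod (a b))\<^sup>2) else 0)"
    proof (intro sum.cong refl)
      fix b c assume "b \<in> F" "c \<in> F"
      then have "b \<in> ?B" "c \<in> ?B" using F(2) by auto
      then show "a b * (cnj (a c) * cinner b c) = (if b = c then of_real ((cmod (a b))\<^sup>2) else 0)"
        using B(1)[of b] B(2)[of b c] cinner_self[of b] unfolding complex_norm_square by auto
    qed
    also have "\<dots> = of_real (\<Sum>b\<in>F. (cmod (a b))\<^sup>2)" using F(1) by simp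
    finally have nx: "(norm x)\<^sup>2 = (\<Sum>b\<in>F. (cmod (a b))\<^sup>2)"
      unfolding cinner_self of_real_eq_iff .
    have "norm (T x) \<le> (\<Sum>b\<in>F. \<bar>cmod (a b)\<bar> * \<bar>norm (T b)\<bar>)"
      unfolding F(3) T.sum TC by (rule order_trans[OF norm_sum]) (simp add: norm_scaleC)
    also have "\<dots> \<le> L2_set (\<lambda>b. cmod (a b)) F * L2_set (\<lambda>b. norm (T b)) F"
      by (rule L2_set_mult_ineq)
    also have "\<dots> \<le> norm x * hs_norm T"
    proof (intro mult_mono)
      show "L2_set (\<lambda>b. cmod (a b)) F \<le> norm x" unfolding L2_set_def nx[symmetric] by simp
      show "L2_set (\<lambda>b. norm (T b)) F \<le> hs_norm T"
        unfolding L2_set_def hs_norm_def by (intro real_sqrt_le_mono finite_sum_le_infsum T F) auto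
    qed (simp_all add: L2_set_nonneg)
    finally show ?thesis by (simp add: mult.commute)
  qed
  have "closed {x. norm (T x) \<le> hs_norm T * norm x}"
    by (intro closed_Collect_le continuous_intros T.continuous_on)
  then have "closure (cspan ?B) \<subseteq> {x. norm (T x) \<le> hs_norm T * norm x}"
    using * by (intro closure_minimal) auto
  then show ?thesis using B(3) by auto
qed

section \<open>Hilbert-Schmidt operators and their unconditional sums\<close>

lemma bounded_clinear_add:
  assumes "bounded_clinear S" "bounded_clinear T"
  shows "bounded_clinear (\<lambda>x. S x + T x)"
proof -
  obtain C D where "\<And>x. norm (S x) \<le> C * norm x" "\<And>x. norm (T x) \<le> D * norm x"
    using assms by (auto simp: bounded_clinear_def)
  then have "norm (S x + T x) \<le> (C + D) * norm x" for x
    by (metis add_mono distrib_right norm_triangle_le)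
  moreover have "clinear_on UNIV (\<lambda>x. S x + T x)"
    using assms by (auto simp: bounded_clinear_def clinear_on_def scaleC_add_right)
  ultimately show ?thesis unfolding bounded_clinear_def by blast
qed

text \<open>The bound by twice the squares follows termwise and replaces the triangle inequality of
  \<open>hs_norm\<close>; it is sharp enough for limits equal to 0.\<close>

lemma hilbert_schmidt_add:
  assumes "hilbert_schmidt S" "hilbert_schmidt T"
  shows "hilbert_schmidt (\<lambda>x. S x + T x)"
    and hs_norm_add_sq: "(hs_norm (\<lambda>x. S x + T x))\<^sup>2 \<le> 2 * (hs_norm S)\<^sup>2 + 2 * (hs_norm T)\<^sup>2"
proof -
  let ?B = "some_onb UNIV"
  have s: "(\<lambda>b. 2 * (norm (S b))\<^sup>2 + 2 * (norm (T b))\<^sup>2) summable_on ?B"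
    using assms by (intro summable_on_add summable_on_cmult_right) (auto simp: hilbert_schmidt_def)
  have le: "(norm (S b + T b))\<^sup>2 \<le> 2 * (norm (S b))\<^sup>2 + 2 * (norm (T b))\<^sup>2" for b
  proof -
    have "(norm (S b + T b))\<^sup>2 \<le> (norm (S b) + norm (T b))\<^sup>2"
      by (intro power_mono norm_triangle_ineq) auto
    also have "\<dots> \<le> 2 * (norm (S b))\<^sup>2 + 2 * (norm (T b))\<^sup>2"
      using zero_le_power2[of "norm (S b) - norm (T b)"] by (simp add: power2_eq_square algebra_simps)
    finally show ?thesis .
  qed
  have s': "(\<lambda>b. (norm (S b + T b))\<^sup>2) summable_on ?B"
    by (rule summable_on_comparison_test[OF s]) (use le in auto)
  show "hilbert_schmidt (\<lambda>x. S x + T x)"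
    using assms s' by (auto simp: hilbert_schmidt_def bounded_clinear_add)
  have "(\<Sum>\<^sub>\<infinity>b\<in>?B. (norm (S b + T b))\<^sup>2) \<le> (\<Sum>\<^sub>\<infinity>b\<in>?B. 2 * (norm (S b))\<^sup>2 + 2 * (norm (T b))\<^sup>2)"
    by (intro infsum_mono s s' le)
  also have "\<dots> = 2 * (\<Sum>\<^sub>\<infinity>b\<in>?B. (norm (S b))\<^sup>2) + 2 * (\<Sum>\<^sub>\<infinity>b\<in>?B. (norm (T b))\<^sup>2)"
    using assms
    by (subst infsum_add) (auto intro: summable_on_cmult_right simp: infsum_cmult_right' hilbert_schmidt_def)
  finally show "(hs_norm (\<lambda>x. S x + T x))\<^sup>2 \<le> 2 * (hs_norm S)\<^sup>2 + 2 * (hs_norm T)\<^sup>2"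
    by (simp add: hs_norm_def infsum_nonneg)
qed

lemma hilbert_schmidt_uminus: "hilbert_schmidt T \<Longrightarrow> hilbert_schmidt (\<lambda>x. - T x)"
  by (auto simp: hilbert_schmidt_def bounded_clinear_def clinear_on_def)

lemma hilbert_schmidt_zero: "hilbert_schmidt (\<lambda>x. 0)"
  by (auto simp: hilbert_schmidt_def bounded_clinear_def clinear_on_def intro!: exI[of _ 0])

lemma hilbert_schmidt_sum:
  "(\<And>i. i \<in> F \<Longrightarrow> hilbert_schmidt (A i)) \<Longrightarrow> hilbert_schmidt (\<lambda>x. \<Sum>i\<in>F. A i x)"
  by (induction F rule: infinite_finite_induct) (simp_all add: hilbert_schmidt_zero hilbert_schmidt_add)

lemma hilbert_schmidt_sum_diff:
  assumes "\<And>i. i \<in> F \<Longrightarrow> hilbert_schmidt (A i)" "hilbert_schmidt T"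
  shows "hilbert_schmidt (\<lambda>x. (\<Sum>i\<in>F. A i x) - T x)"
  using hilbert_schmidt_add(1)[OF hilbert_schmidt_sum[OF assms(1)] hilbert_schmidt_uminus[OF assms(2)]]
  by simp

lemma hs_has_sum_has_sum:
  assumes "hs_has_sum A X T"
  shows "((\<lambda>i. A i x) has_sum T x) X"
proof -
  let ?F = "finite_subsets_at_top X"
  have "\<forall>\<^sub>F F in ?F. norm ((\<Sum>i\<in>F. A i x) - T x) \<le> hs_norm (\<lambda>x. (\<Sum>i\<in>F. A i x) - T x) * norm x"
    using assms by (intro eventually_finite_subsets_at_top_weakI norm_le_hs_norm hilbert_schmidt_sum_diff)
      (auto simp: hs_has_sum_def)
  moreover have "((\<lambda>F. hs_norm (\<lambda>x. (\<Sum>i\<in>F. A i x) - T x) * norm x) \<longlongrightarrow> 0) ?F"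
    using assms tendsto_mult_left_zero unfolding hs_has_sum_def by blast
  ultimately have "((\<lambda>F. (\<Sum>i\<in>F. A i x) - T x) \<longlongrightarrow> 0) ?F"
    by (rule Lim_null_comparison)
  then show ?thesis unfolding has_sum_def by (simp add: LIM_zero_iff)
qed

lemma hs_has_sum_Un_disjoint:
  fixes A :: "'i \<Rightarrow> 'a::chilbert \<Rightarrow> 'a"
  assumes X: "hs_has_sum A X S" and Y: "hs_has_sum A Y T" and disj: "X \<inter> Y = {}"
  shows "hs_has_sum A (X \<union> Y) (\<lambda>x. S x + T x)"
  unfolding hs_has_sum_def
proof (intro conjI ballI)
  have hs: "\<And>i. i \<in> X \<Longrightarrow> hilbert_schmidt (A i)" "\<And>i. i \<in> Y \<Longrightarrow> hilbert_schmidt (A i)"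
    "hilbert_schmidt S" "hilbert_schmidt T" using X Y by (auto simp: hs_has_sum_def)
  show "hilbert_schmidt (A i)" if "i \<in> X \<union> Y" for i using that hs by auto
  show "hilbert_schmidt (\<lambda>x. S x + T x)" by (intro hilbert_schmidt_add hs)
  define n where "n Z R F = hs_norm (\<lambda>x. (\<Sum>i\<in>F \<inter> Z. A i x) - R x)" for Z R F
  have lim: "((\<lambda>F. n Z R F) \<longlongrightarrow> 0) (finite_subsets_at_top (X \<union> Y))"
    if "hs_has_sum A Z R" "Z \<subseteq> X \<union> Y" for Z R
  proof -
    \<comment> \<open>A finite subset of \<open>X \<union> Y\<close> that contains a given finite
      subset of \<open>Z\<close> still contains it after intersection with \<open>Z\<close>, so the
      partial sums over \<open>F \<inter> Z\<close> run through the net for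
      \<open>Z\<close>.\<close>
    have "filterlim (\<lambda>F. F \<inter> Z) (finite_subsets_at_top Z) (finite_subsets_at_top (X \<union> Y))"
      unfolding filterlim_finite_subsets_at_top eventually_finite_subsets_at_top
      using that(2) by blast
    then show ?thesis
      using that(1) filterlim_compose unfolding n_def hs_has_sum_def by blast
  qed
  \<comment> \<open>The estimate is made for squares, where \<open>hs_norm_add_sq\<close> applies;
    the square root is taken at the end.\<close>
  have "\<forall>\<^sub>F F in finite_subsets_at_top (X \<union> Y).
      norm ((hs_norm (\<lambda>x. (\<Sum>i\<in>F. A i x) - (S x + T x)))\<^sup>2) \<le> 2 * (n X S F)\<^sup>2 + 2 * (n Y T F)\<^sup>2"
  proof (rule eventually_finite_subsets_at_top_weakI)
    fix F assume F: "finite F" "F \<subseteq> X \<union> Y"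
    have "(\<lambda>x. (\<Sum>i\<in>F. A i x) - (S x + T x)) =
        (\<lambda>x. ((\<Sum>i\<in>F \<inter> X. A i x) - S x) + ((\<Sum>i\<in>F \<inter> Y. A i x) - T x))"
    proof
      fix x
      have "(\<Sum>i\<in>F. A i x) = (\<Sum>i\<in>(F \<inter> X) \<union> (F \<inter> Y). A i x)"
        using F by (intro sum.cong) auto
      also have "\<dots> = (\<Sum>i\<in>F \<inter> X. A i x) + (\<Sum>i\<in>F \<inter> Y. A i x)"
        using F disj by (intro sum.union_disjoint) auto
      finally show "(\<Sum>i\<in>F. A i x) - (S x + T x) =
        ((\<Sum>i\<in>F \<inter> X. A i x) - S x) + ((\<Sum>i\<in>F \<inter> Y. A i x) - T x)" by simp
    qed
    then show "norm ((hs_norm (\<lambda>x. (\<Sum>i\<in>F. A i x) - (S x + T x)))\<^sup>2) \<le> 2 * (n X S F)\<^sup>2 + 2 * (n Y T F)\<^sup>2"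
      unfolding n_def using hs by (simp only: real_norm_def abs_power2) (intro hs_norm_add_sq hilbert_schmidt_sum_diff, auto)
  qed
  moreover have "((\<lambda>F. 2 * (n X S F)\<^sup>2 + 2 * (n Y T F)\<^sup>2) \<longlongrightarrow> 0) (finite_subsets_at_top (X \<union> Y))"
    by (rule tendsto_eq_intros lim X Y Un_upper1 Un_upper2 | simp)+
  ultimately have "((\<lambda>F. (hs_norm (\<lambda>x. (\<Sum>i\<in>F. A i x) - (S x + T x)))\<^sup>2) \<longlongrightarrow> 0) (finite_subsets_at_top (X \<union> Y))"
    by (rule Lim_null_comparison)
  then have "((\<lambda>F. sqrt ((hs_norm (\<lambda>x. (\<Sum>i\<in>F. A i x) - (S x + T x)))\<^sup>2)) \<longlongrightarrow> sqrt 0) (finite_subsets_at_top (X \<union> Y))"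
    by (rule tendsto_real_sqrt)
  then show "((\<lambda>F. hs_norm (\<lambda>x. (\<Sum>i\<in>F. A i x) - (S x + T x))) \<longlongrightarrow> 0) (finite_subsets_at_top (X \<union> Y))"
    by (simp only: real_sqrt_abs real_sqrt_zero tendsto_rabs_zero_iff)
qed

lemma hs_has_sum_finite_Union:
  assumes "finite K" "\<And>X. X \<in> K \<Longrightarrow> \<exists>T. hs_has_sum A X T" "disjoint K"
  shows "\<exists>T. hs_has_sum A (\<Union>K) T"
  using assms
proof (induction K)
  case empty
  have "hs_has_sum A {} (\<lambda>x. 0)" by (simp add: hs_has_sum_def hilbert_schmidt_zero hs_norm_def tendsto_eventually eventually_finite_subsets_at_top)
  then show ?case by auto
next
  case (insert X K)
  then obtain T where "hs_has_sum A (\<Union>K) T" by (auto simp: pairwise_insert)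
  moreover obtain S where "hs_has_sum A X S" using insert.prems(1)[of X] by blast
  moreover have "X \<inter> \<Union>K = {}"
    using insert.hyps(2) insert.prems(2) unfolding pairwise_insert disjnt_def by blast
  ultimately show ?case unfolding Union_insert by (blast intro: hs_has_sum_Un_disjoint)
qed

section \<open>Transversals and double cosets\<close>

lemma rcosets_restrict: "rcosets\<^bsub>G\<lparr>carrier := K\<rparr>\<^esub> H = (\<lambda>k. H #>\<^bsub>G\<^esub> k) ` K"
  by (auto simp: RCOSETS_def r_coset_def)

context group
begin

lemma mult_inv_cancel:
  assumes "x \<in> carrier G" "y \<in> carrier G"
  shows "inv x \<otimes> (x \<otimes> y) = y" "x \<otimes> (inv x \<otimes> y) = y"
  using assms by (simp_all add: m_assoc[symmetric])

lemma coset_absorb: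
  assumes "subgroup H G" "h \<in> H" "x \<in> carrier G"
  shows "H #> (h \<otimes> x) = H #> x"
  using assms subgroup.mem_carrier[OF assms(1,2)] subgroup.subset[OF assms(1)]
  by (simp add: coset_mult_assoc[symmetric] coset_join2)

lemma mem_conj_subgroup_iff:
  assumes "H \<subseteq> carrier G" "\<sigma> \<in> carrier G"
  shows "x \<in> conj_subgroup G \<sigma> H \<longleftrightarrow> x \<in> carrier G \<and> inv \<sigma> \<otimes> x \<otimes> \<sigma> \<in> H"
proof
  assume "x \<in> conj_subgroup G \<sigma> H"
  then obtain h where h: "h \<in> H" "x = \<sigma> \<otimes> h \<otimes> inv \<sigma>"
    by (auto simp: conj_subgroup_def l_coset_def r_coset_def)
  then have "inv \<sigma> \<otimes> x \<otimes> \<sigma> = h" using assms by (auto simp: m_assoc subset_iff mult_inv_cancel)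
  then show "x \<in> carrier G \<and> inv \<sigma> \<otimes> x \<otimes> \<sigma> \<in> H" using h assms by auto
next
  assume x: "x \<in> carrier G \<and> inv \<sigma> \<otimes> x \<otimes> \<sigma> \<in> H"
  then have "x = \<sigma> \<otimes> (inv \<sigma> \<otimes> x \<otimes> \<sigma>) \<otimes> inv \<sigma>" using assms by (simp add: m_assoc mult_inv_cancel)
  then show "x \<in> conj_subgroup G \<sigma> H" using x
    unfolding conj_subgroup_def l_coset_def r_coset_def by blast
qed

lemma mem_conj_meet_iff:
  assumes "subgroup H G" "\<sigma> \<in> carrier G"
  shows "x \<in> conj_meet G H \<sigma> \<longleftrightarrow> x \<in> H \<and> inv \<sigma> \<otimes> x \<otimes> \<sigma> \<in> H"
  using assms by (auto simp: conj_meet_def mem_conj_subgroup_iff subgroup.subset dest: subgroup.mem_carrier)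

lemma subgroup_conj_meet:
  assumes H: "subgroup H G" and \<sigma>: "\<sigma> \<in> carrier G"
  shows "subgroup (conj_meet G H \<sigma>) G"
proof (rule subgroupI)
  interpret H: subgroup H G by fact
  show "conj_meet G H \<sigma> \<subseteq> carrier G" using assms by (auto simp: mem_conj_meet_iff)
  show "conj_meet G H \<sigma> \<noteq> {}"
    using mem_conj_meet_iff[OF assms, of \<one>] \<sigma> by auto
  fix a assume a: "a \<in> conj_meet G H \<sigma>"
  then have a': "a \<in> H" "inv \<sigma> \<otimes> a \<otimes> \<sigma> \<in> H" using assms by (auto simp: mem_conj_meet_iff)
  have "inv (inv \<sigma> \<otimes> a \<otimes> \<sigma>) = inv \<sigma> \<otimes> inv a \<otimes> \<sigma>"
    using a' \<sigma> by (simp add: inv_mult_group m_assoc)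
  then show "inv a \<in> conj_meet G H \<sigma>"
    using a' assms by (metis H.m_inv_closed mem_conj_meet_iff)
  fix b assume "b \<in> conj_meet G H \<sigma>"
  then have b': "b \<in> H" "inv \<sigma> \<otimes> b \<otimes> \<sigma> \<in> H" using assms by (auto simp: mem_conj_meet_iff)
  have "(inv \<sigma> \<otimes> a \<otimes> \<sigma>) \<otimes> (inv \<sigma> \<otimes> b \<otimes> \<sigma>) = inv \<sigma> \<otimes> (a \<otimes> b) \<otimes> \<sigma>"
    using a' b' \<sigma> by (simp add: m_assoc mult_inv_cancel)
  then show "a \<otimes> b \<in> conj_meet G H \<sigma>"
    using a' b' assms by (metis H.m_closed mem_conj_meet_iff)
qed

text \<open>Conjugating \<open>H \<inter> \<sigma>\<^sup>-\<^sup>1H\<sigma>\<close> by \<sigma>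
  exchanges the roles of the two groups. Thus the group at which \<sigma> places the image of a
  virtual vector belongs to the family again.\<close>

lemma conj_subgroup_conj_meet_inv:
  assumes H: "subgroup H G" and \<sigma>: "\<sigma> \<in> carrier G"
  shows "conj_subgroup G \<sigma> (conj_meet G H (inv \<sigma>)) = conj_meet G H \<sigma>"
proof -
  interpret H: subgroup H G by fact
  have "conj_meet G H (inv \<sigma>) \<subseteq> carrier G"
    using subgroup.subset[OF subgroup_conj_meet] assms by auto
  moreover have "\<sigma> \<otimes> (inv \<sigma> \<otimes> x \<otimes> \<sigma>) \<otimes> inv \<sigma> = x" if "x \<in> carrier G" for x
    using that \<sigma> by (simp add: m_assoc mult_inv_cancel)
  ultimately show ?thesis
    using assms by (auto simp: mem_conj_subgroup_iff mem_conj_meet_iff)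
qed

lemma subgroup_family_subgroup:
  assumes "\<Delta> \<in> subgroup_family G \<Gamma>" "subgroup \<Gamma> G"
  shows "subgroup \<Delta> G \<and> \<Delta> \<subseteq> \<Gamma>"
  using assms(1)
proof induction
  case (inter A B)
  then show ?case by (auto intro: subgroups_Inter_pair)
next
  case (conj A \<sigma>)
  then show ?case using subgroup_conj_meet[of A \<sigma>] by (auto simp: conj_meet_def)
qed (use assms in auto)

text \<open>Representatives are specified through cosets, whereas the reindexing of sums needs the
  unique factorisation of an element of \<open>K\<close> into an element of \<open>H\<close> and a
  representative. This is the bridge between the two.\<close>

lemma bij_betw_transversal_iff:
  assumes H: "subgroup H G" and HK: "H \<subseteq> K" and K: "subgroup K G" and t: "t ` I \<subseteq> K"
  shows "bij_betw (\<lambda>i. H #> t i) I (rcosets\<^bsub>G\<lparr>carrier := K\<rparr>\<^esub> H) \<longleftrightarrow>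
    bij_betw (\<lambda>(h, i). h \<otimes> t i) (H \<times> I) K" (is "?L \<longleftrightarrow> ?R")
proof -
  interpret H: subgroup H G by fact
  interpret K: subgroup K G by fact
  have tc: "t i \<in> carrier G" if "i \<in> I" for i using t that by auto
  have tK: "t i \<in> K" if "i \<in> I" for i using t that by auto
  have coset_eq: "H #> t i = H #> t j" if "h \<otimes> t i = h' \<otimes> t j" "h \<in> H" "h' \<in> H" "i \<in> I" "j \<in> I" for h h' i j
    using that tc by (metis coset_absorb[OF H])
  show ?thesis
  proof
    assume L: ?L
    have "inj_on (\<lambda>(h, i). h \<otimes> t i) (H \<times> I)"
    proof (rule inj_onI, clarsimp)
      fix h i h' j assume *: "h \<in> H" "i \<in> I" "h' \<in> H" "j \<in> I" "h \<otimes> t i = h' \<otimes> t j"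
      then have "i = j" using coset_eq[of h i h' j] L by (auto simp: bij_betw_def inj_on_def)
      then show "h = h' \<and> i = j" using * tc by auto
    qed
    moreover have "(\<lambda>(h, i). h \<otimes> t i) ` (H \<times> I) = K"
    proof (intro equalityI subsetI)
      fix x assume "x \<in> K"
      then have "H #> x \<in> (\<lambda>i. H #> t i) ` I" using L by (auto simp: bij_betw_def rcosets_restrict)
      then obtain i where i: "i \<in> I" "H #> x = H #> t i" by auto
      have "x \<in> H #> x" using \<open>x \<in> K\<close> rcos_self[OF _ H] by auto
      then obtain h where "h \<in> H" "x = h \<otimes> t i" unfolding i(2) by (auto simp: r_coset_def)
      then show "x \<in> (\<lambda>(h, i). h \<otimes> t i) ` (H \<times> I)"
        using i(1) by (intro image_eqI[of _ _ "(h, i)"]) auto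
    qed (use HK tK in auto)
    ultimately show ?R by (simp add: bij_betw_def)
  next
    assume R: ?R
    have "inj_on (\<lambda>i. H #> t i) I"
    proof (rule inj_onI)
      fix i j assume ij: "i \<in> I" "j \<in> I" "H #> t i = H #> t j"
      have "t i \<in> H #> t j" using rcos_self[OF tc[OF ij(1)] H] ij(3) by simp
      then obtain h where h: "h \<in> H" "t i = h \<otimes> t j" by (auto simp: r_coset_def)
      \<comment> \<open>The element \<open>t i\<close> has the factorisations
        \<open>(\<one>, i)\<close> and \<open>(h, j)\<close>; uniqueness identifies them.\<close>
      then have "(\<lambda>(h, i). h \<otimes> t i) (\<one>, i) = (\<lambda>(h, i). h \<otimes> t i) (h, j)" using tc ij by simp
      then have "(\<one>, i) = (h, j)" using R ij h by (intro inj_onD[OF bij_betw_imp_inj_on[OF R]]) auto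
      then show "i = j" by simp
    qed
    moreover have "H #> x \<in> (\<lambda>i. H #> t i) ` I" if x: "x \<in> K" for x
    proof -
      have "x \<in> (\<lambda>(h, i). h \<otimes> t i) ` (H \<times> I)" using R x by (simp add: bij_betw_def)
      then obtain h i where hi: "h \<in> H" "i \<in> I" "x = h \<otimes> t i" by auto
      then have "H #> x = H #> t i" using tc by (simp add: coset_absorb[OF H])
      then show ?thesis using hi by auto
    qed
    ultimately show ?L using t by (auto simp: bij_betw_def rcosets_restrict)
  qed
qed

lemma right_transversal_exists: "\<exists>R. right_transversal G K H R"
proof -
  have "\<exists>R\<subseteq>K. inj_on (\<lambda>r. H #> r) R \<and> (\<lambda>r. H #> r) ` K = (\<lambda>r. H #> r) ` R"
    using subset_image_inj[of "(\<lambda>r. H #> r) ` K" "\<lambda>r. H #> r" K] by simp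
  then show ?thesis unfolding right_transversal_def rcosets_restrict bij_betw_def by metis
qed

lemma finite_right_transversal:
  assumes "right_transversal G K H R" "finite (rcosets\<^bsub>G\<lparr>carrier := \<Gamma>\<rparr>\<^esub> H)" "K \<subseteq> \<Gamma>"
  shows "finite R"
proof -
  have "finite (rcosets\<^bsub>G\<lparr>carrier := K\<rparr>\<^esub> H)"
    using assms(2) finite_subset[OF image_mono[OF assms(3)]] by (auto simp: rcosets_restrict)
  then show ?thesis using assms(1) bij_betw_finite by (auto simp: right_transversal_def)
qed

context
  fixes H K R
  assumes H: "subgroup H G" and K: "subgroup K G" and HK: "H \<subseteq> K"
    and R: "right_transversal G K H R"
begin

lemma right_transversal_bij: "bij_betw (\<lambda>(h, r). h \<otimes> r) (H \<times> R) K"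
  using bij_betw_transversal_iff[OF H HK K, of "\<lambda>r. r" R] R by (auto simp: right_transversal_def)

text \<open>Inverting the factorisation \<open>h \<otimes> r\<close> puts the representative on the
  left. In a matrix coefficient the left factor \<open>inv r\<close> can then be carried over to the
  second argument.\<close>

lemma right_transversal_bij_inv: "bij_betw (\<lambda>(r, h). inv r \<otimes> h) (R \<times> H) K"
proof -
  interpret H: subgroup H G by fact
  interpret K: subgroup K G by fact
  have invK: "bij_betw (m_inv G) K K"
    by (rule bij_betw_byWitness[where f' = "m_inv G"]) auto
  have swap: "bij_betw (\<lambda>(r, h). (inv h, r)) (R \<times> H) (H \<times> R)"
    by (rule bij_betw_byWitness[where f' = "\<lambda>(h, r). (r, inv h)"]) auto
  have "bij_betw (m_inv G \<circ> ((\<lambda>(h, r). h \<otimes> r) \<circ> (\<lambda>(r, h). (inv h, r)))) (R \<times> H) K"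
    by (intro bij_betw_trans[OF _ invK] bij_betw_trans[OF swap] right_transversal_bij)
  then show ?thesis
  proof (rule bij_betw_cong[THEN iffD1, rotated])
    fix x assume "x \<in> R \<times> H"
    then obtain r h where x: "x = (r, h)" "r \<in> K" "h \<in> H" using R by (auto simp: right_transversal_def)
    then show "(m_inv G \<circ> ((\<lambda>(h, r). h \<otimes> r) \<circ> (\<lambda>(r, h). (inv h, r)))) x = (case x of (r, h) \<Rightarrow> inv r \<otimes> h)"
      by (simp add: inv_mult_group)
  qed
qed

lemma index_eq_card: "index G K H = card R"
  using R unfolding right_transversal_def index_def by (metis bij_betw_same_card)

lemma index_mult:
  assumes \<Gamma>: "subgroup \<Gamma> G" and K\<Gamma>: "K \<subseteq> \<Gamma>" and s: "coset_reps G \<Gamma> K s"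
  shows "index G \<Gamma> H = index G \<Gamma> K * index G K H"
proof -
  interpret H: subgroup H G by fact
  interpret K: subgroup K G by fact
  let ?I = "{1..index G \<Gamma> K}"
  have sI: "s ` ?I \<subseteq> \<Gamma>" "bij_betw (\<lambda>(k, i). k \<otimes> s i) (K \<times> ?I) \<Gamma>"
    using s bij_betw_transversal_iff[OF K K\<Gamma> \<Gamma>, of s ?I] by (auto simp: coset_reps_def)
  have RK: "R \<subseteq> K" using R by (simp add: right_transversal_def)
  \<comment> \<open>Tower law: the products of representatives of \<open>H\<close> in
    \<open>K\<close> with those of \<open>K\<close> in \<Gamma> represent \<open>H\<close> in
    \<Gamma>.\<close>
  define t where "t = (\<lambda>(r, i). r \<otimes> s i)"
  have t: "t ` (R \<times> ?I) \<subseteq> \<Gamma>"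
    unfolding t_def using RK K\<Gamma> sI(1) by (auto intro!: subgroup.m_closed[OF \<Gamma>])
  have b1: "bij_betw (\<lambda>(h, (r, i)). (h \<otimes> r, i)) (H \<times> (R \<times> ?I)) (K \<times> ?I)"
  proof -
    have "bij_betw (map_prod (\<lambda>(h, r). h \<otimes> r) id) ((H \<times> R) \<times> ?I) (K \<times> ?I)"
      by (intro bij_betw_map_prod right_transversal_bij bij_betw_id)
    moreover have "bij_betw (\<lambda>(h, (r, i)). ((h, r), i)) (H \<times> (R \<times> ?I)) ((H \<times> R) \<times> ?I)"
      by (rule bij_betw_byWitness[where f' = "\<lambda>((h, r), i). (h, (r, i))"]) auto
    ultimately have "bij_betw (map_prod (\<lambda>(h, r). h \<otimes> r) id \<circ> (\<lambda>(h, (r, i)). ((h, r), i))) (H \<times> (R \<times> ?I)) (K \<times> ?I)"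
      by (rule bij_betw_trans[rotated])
    then show ?thesis by (rule bij_betw_cong[THEN iffD1, rotated]) auto
  qed
  have "bij_betw ((\<lambda>(k, i). k \<otimes> s i) \<circ> (\<lambda>(h, (r, i)). (h \<otimes> r, i))) (H \<times> (R \<times> ?I)) \<Gamma>"
    by (rule bij_betw_trans[OF b1 sI(2)])
  then have "bij_betw (\<lambda>(h, x). h \<otimes> t x) (H \<times> (R \<times> ?I)) \<Gamma>"
  proof (rule bij_betw_cong[THEN iffD1, rotated])
    fix x assume "x \<in> H \<times> (R \<times> ?I)"
    then obtain h r i where x: "x = (h, (r, i))" "h \<in> H" "r \<in> K" "i \<in> ?I" using RK by auto
    moreover from this have "s i \<in> carrier G" using sI(1) subgroup.mem_carrier[OF \<Gamma>] by blast
    ultimately show "((\<lambda>(k, i). k \<otimes> s i) \<circ> (\<lambda>(h, (r, i)). (h \<otimes> r, i))) x = (case x of (h, x) \<Rightarrow> h \<otimes> t x)"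
      by (simp add: t_def m_assoc)
  qed
  then have "bij_betw (\<lambda>x. H #> t x) (R \<times> ?I) (rcosets\<^bsub>G\<lparr>carrier := \<Gamma>\<rparr>\<^esub> H)"
    using bij_betw_transversal_iff[OF H _ \<Gamma> t] HK K\<Gamma> by auto
  then have "card (R \<times> ?I) = index G \<Gamma> H"
    unfolding index_def[of G \<Gamma> H] by (rule bij_betw_same_card)
  then show ?thesis by (simp add: index_eq_card card_cartesian_product mult.commute)
qed

end

section \<open>Double cosets\<close>

context
  fixes H R \<sigma>
  assumes H: "subgroup H G" and \<sigma>: "\<sigma> \<in> carrier G"
    and R: "right_transversal G H (conj_meet G H (inv \<sigma>)) R"
begin

text \<open>The cosets \<open>H\<sigma>r\<close> and \<open>H\<sigma>r'\<close> agree exactly when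
  \<open>r \<otimes> inv r'\<close> lies in \<open>\<sigma>\<^sup>-\<^sup>1H\<sigma>\<close>; this
  is why \<open>R\<close> represents \<open>conj_meet G H (inv \<sigma>)\<close> rather than
  \<open>conj_meet G H \<sigma>\<close>.\<close>

lemma double_coset_bij:
  "bij_betw (\<lambda>(h, r). h \<otimes> \<sigma> \<otimes> r) (H \<times> R) ((H #> \<sigma>) <#> H)"
proof -
  interpret H: subgroup H G by fact
  let ?J = "conj_meet G H (inv \<sigma>)"
  have J: "subgroup ?J G" "?J \<subseteq> H" using H \<sigma> by (simp add: subgroup_conj_meet) (simp add: conj_meet_def)
  have memJ: "x \<in> ?J \<longleftrightarrow> x \<in> H \<and> \<sigma> \<otimes> x \<otimes> inv \<sigma> \<in> H" for x
    using H \<sigma> by (simp add: mem_conj_meet_iff)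
  have bij: "bij_betw (\<lambda>(j, r). j \<otimes> r) (?J \<times> R) H" by (rule right_transversal_bij[OF J(1) H J(2) R])
  have RH: "R \<subseteq> H" using R by (simp add: right_transversal_def)
  have "inj_on (\<lambda>(h, r). h \<otimes> \<sigma> \<otimes> r) (H \<times> R)"
  proof (rule inj_onI, clarsimp)
    fix h r h' r' assume *: "h \<in> H" "r \<in> R" "h' \<in> H" "r' \<in> R" "h \<otimes> \<sigma> \<otimes> r = h' \<otimes> \<sigma> \<otimes> r'"
    have c: "h \<in> carrier G" "h' \<in> carrier G" "r \<in> H" "r' \<in> H" "r \<in> carrier G" "r' \<in> carrier G"
      using * RH by auto
    define j where "j = r \<otimes> inv r'"
    have jr: "j \<otimes> r' = r" using c by (simp add: j_def m_assoc)
    \<comment> \<open>Solving the assumed equality for \<open>j\<close> conjugated by \<sigma> gives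
      \<open>inv h \<otimes> h'\<close>, an element of \<open>H\<close>. So \<open>j\<close> is in
      the smaller group, and \<open>j \<otimes> r' = \<one> \<otimes> r\<close> gives
      \<open>r' = r\<close>.\<close>
    have "\<sigma> \<otimes> j \<otimes> inv \<sigma> = inv h \<otimes> (h \<otimes> \<sigma> \<otimes> r) \<otimes> inv r' \<otimes> inv \<sigma>"
      using c \<sigma> by (simp add: j_def m_assoc mult_inv_cancel)
    also have "\<dots> = inv h \<otimes> h'"
      unfolding *(5) using c \<sigma> by (simp add: m_assoc)
    finally have "j \<in> ?J" using * c by (simp add: memJ) (simp add: j_def)
    then have "(j, r') = (\<one>, r)"
      using * jr c by (intro inj_onD[OF bij_betw_imp_inj_on[OF bij]]) (auto intro: subgroup.one_closed[OF J(1)])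
    then have "r' = r" by simp
    then show "h = h' \<and> r = r'" using * c \<sigma> by simp
  qed
  moreover have "(\<lambda>(h, r). h \<otimes> \<sigma> \<otimes> r) ` (H \<times> R) = (H #> \<sigma>) <#> H"
  proof (intro equalityI subsetI)
    fix x assume "x \<in> (H #> \<sigma>) <#> H"
    then obtain h k where x: "h \<in> H" "k \<in> H" "x = h \<otimes> \<sigma> \<otimes> k"
      by (auto simp: set_mult_def r_coset_def)
    have "k \<in> (\<lambda>(j, r). j \<otimes> r) ` (?J \<times> R)" using bij x(2) by (simp add: bij_betw_def)
    then obtain j r where jr: "j \<in> ?J" "r \<in> R" "k = j \<otimes> r" by auto
    have j: "j \<in> H" "\<sigma> \<otimes> j \<otimes> inv \<sigma> \<in> H" "r \<in> H" using jr memJ RH by auto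
    \<comment> \<open>The factor \<open>j\<close> passes to the left of \<sigma> as its conjugate,
      which is in \<open>H\<close> and is absorbed by \<open>h\<close>.\<close>
    have "x = (h \<otimes> (\<sigma> \<otimes> j \<otimes> inv \<sigma>)) \<otimes> \<sigma> \<otimes> r"
      using x jr j \<sigma> by (simp add: m_assoc mult_inv_cancel)
    then show "x \<in> (\<lambda>(h, r). h \<otimes> \<sigma> \<otimes> r) ` (H \<times> R)"
      using x j jr by (intro image_eqI[of _ _ "(h \<otimes> (\<sigma> \<otimes> j \<otimes> inv \<sigma>), r)"]) auto
  qed (use RH in \<open>auto simp: set_mult_def r_coset_def\<close>)
  ultimately show ?thesis by (simp add: bij_betw_def)
qed

text \<open>Two-sided translation is injective and transports the parametrisation. With
  representatives for \<open>a\<close> and \<open>b\<close> this is the index set of a matrix entry;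
  \<open>h\<close> becomes the group element of the virtual sum and \<open>r\<close> the finite
  index.\<close>

lemma shifted_double_coset_bij:
  assumes a: "a \<in> carrier G" and b: "b \<in> carrier G"
  shows "bij_betw (\<lambda>(h, r). inv a \<otimes> h \<otimes> (\<sigma> \<otimes> r \<otimes> b)) (H \<times> R)
    ((inv a <# ((H #> \<sigma>) <#> H)) #> b)"
proof -
  interpret H: subgroup H G by fact
  let ?D = "(H #> \<sigma>) <#> H"
  have D: "?D \<subseteq> carrier G" using \<sigma> by (auto simp: set_mult_def r_coset_def)
  have RH: "R \<subseteq> H" using R by (simp add: right_transversal_def)
  have "inj_on (\<lambda>x. inv a \<otimes> x \<otimes> b) ?D"
  proof (rule inj_onI)
    fix x y assume "x \<in> ?D" "y \<in> ?D" "inv a \<otimes> x \<otimes> b = inv a \<otimes> y \<otimes> b"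
    then show "x = y" using a b subsetD[OF D] by simp
  qed
  then have "bij_betw (\<lambda>x. inv a \<otimes> x \<otimes> b) ?D ((inv a <# ?D) #> b)"
    by (auto simp: bij_betw_def l_coset_def r_coset_def)
  then have "bij_betw ((\<lambda>x. inv a \<otimes> x \<otimes> b) \<circ> (\<lambda>(h, r). h \<otimes> \<sigma> \<otimes> r)) (H \<times> R) ((inv a <# ?D) #> b)"
    by (rule bij_betw_trans[OF double_coset_bij])
  then show ?thesis
  proof (rule bij_betw_cong[THEN iffD1, rotated])
    fix x assume "x \<in> H \<times> R"
    then obtain h r where "x = (h, r)" "h \<in> H" "r \<in> H" using RH by auto
    then show "((\<lambda>x. inv a \<otimes> x \<otimes> b) \<circ> (\<lambda>(h, r). h \<otimes> \<sigma> \<otimes> r)) x = (case x of (h, r) \<Rightarrow> inv a \<otimes> h \<otimes> (\<sigma> \<otimes> r \<otimes> b))"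
      using a b \<sigma> by (simp add: m_assoc)
  qed
qed

text \<open>The translate \<open>a\<^sup>-\<^sup>1H\<sigma>Hb\<close> is invariant under left multiplication by \<open>a\<^sup>-\<^sup>1Ha\<close>, which need not
  belong to the family of subgroups; its subgroup \<open>H \<inter> a\<^sup>-\<^sup>1Ha\<close> does.\<close>

lemma shifted_double_coset_partition:
  assumes \<Gamma>: "subgroup \<Gamma> G" and H\<Gamma>: "H \<subseteq> \<Gamma>" and a: "a \<in> \<Gamma>" and b: "b \<in> carrier G"
    and fin: "finite (rcosets\<^bsub>G\<lparr>carrier := \<Gamma>\<rparr>\<^esub> (conj_meet G H (inv a)))" and finR: "finite R"
  shows "\<exists>K. finite K \<and> disjoint K \<and> \<Union>K = (inv a <# ((H #> \<sigma>) <#> H)) #> b \<and>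
    (\<forall>Y\<in>K. \<exists>g\<in>carrier G. Y = conj_meet G H (inv a) #> g)"
proof -
  interpret H: subgroup H G by fact
  interpret \<Gamma>: subgroup \<Gamma> G by fact
  let ?X = "(inv a <# ((H #> \<sigma>) <#> H)) #> b" and ?J = "conj_meet G H (inv a)"
  have ac: "a \<in> carrier G" using a by simp
  have J: "subgroup ?J G" using H ac by (simp add: subgroup_conj_meet)
  interpret J: subgroup ?J G by fact
  have RH: "R \<subseteq> H" using R by (simp add: right_transversal_def)
  have X: "?X = (\<lambda>(h, r). inv a \<otimes> h \<otimes> (\<sigma> \<otimes> r \<otimes> b)) ` (H \<times> R)"
    using shifted_double_coset_bij[OF ac b] by (simp add: bij_betw_def)
  have Xc: "?X \<subseteq> carrier G" unfolding X using ac b \<sigma> RH by auto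
  define K where "K = (\<lambda>x. ?J #> x) ` ?X"
  \<comment> \<open>The coset of an element depends only on the coset of
    \<open>inv a \<otimes> h\<close> in \<Gamma> and on \<open>r\<close>, and both have finitely
    many values.\<close>
  have "K \<subseteq> (\<lambda>(c, r). c #> (\<sigma> \<otimes> r \<otimes> b)) ` ((rcosets\<^bsub>G\<lparr>carrier := \<Gamma>\<rparr>\<^esub> ?J) \<times> R)"
  proof
    fix Y assume "Y \<in> K"
    then obtain h r where Y: "Y = ?J #> (inv a \<otimes> h \<otimes> (\<sigma> \<otimes> r \<otimes> b))" "h \<in> H" "r \<in> R"
      unfolding K_def X by auto
    have r: "r \<in> carrier G" using Y RH by auto
    have "Y = (?J #> (inv a \<otimes> h)) #> (\<sigma> \<otimes> r \<otimes> b)"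
      unfolding Y(1) using J.subset Y(2) r ac b \<sigma> by (subst coset_mult_assoc) auto
    moreover have "inv a \<otimes> h \<in> \<Gamma>" using a Y H\<Gamma> by auto
    ultimately show "Y \<in> (\<lambda>(c, r). c #> (\<sigma> \<otimes> r \<otimes> b)) ` ((rcosets\<^bsub>G\<lparr>carrier := \<Gamma>\<rparr>\<^esub> ?J) \<times> R)"
      using Y(3) by (intro image_eqI[of _ _ "(?J #> (inv a \<otimes> h), r)"]) (auto simp: rcosets_restrict)
  qed
  then have "finite K" by (rule finite_subset) (use fin finR in auto)
  moreover have "disjoint K"
  proof (rule pairwise_subset[OF rcos_disjoint[OF J]])
    show "K \<subseteq> rcosets ?J" using Xc by (auto simp: K_def RCOSETS_def)
  qed
  moreover have "\<Union>K = ?X"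
  proof (intro equalityI subsetI)
    fix x assume "x \<in> \<Union>K"
    then obtain y j where y: "y \<in> ?X" "j \<in> ?J" "x = j \<otimes> y"
      unfolding K_def r_coset_def[of G ?J] by blast
    then obtain h r where hr: "h \<in> H" "r \<in> R" "y = inv a \<otimes> h \<otimes> (\<sigma> \<otimes> r \<otimes> b)"
      unfolding X by auto
    have j: "j \<in> H" "a \<otimes> j \<otimes> inv a \<in> H" using y(2) ac unfolding mem_conj_meet_iff[OF H inv_closed[OF ac]] by simp_all
    have r: "r \<in> carrier G" using hr(2) RH by auto
    \<comment> \<open>The factor \<open>j\<close> passes to the right of \<open>inv a\<close> as
      \<open>a \<otimes> j \<otimes> inv a\<close>, which is in \<open>H\<close>; so the translate
      is a union of full cosets.\<close>
    have "x = inv a \<otimes> ((a \<otimes> j \<otimes> inv a) \<otimes> h) \<otimes> (\<sigma> \<otimes> r \<otimes> b)"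
      unfolding y(3) hr(3) using hr(1) j r ac b \<sigma> by (simp add: m_assoc mult_inv_cancel)
    then show "x \<in> ?X"
      unfolding X using hr j by (intro image_eqI[of _ _ "((a \<otimes> j \<otimes> inv a) \<otimes> h, r)"]) auto
  next
    fix x assume "x \<in> ?X"
    then show "x \<in> \<Union>K" using rcos_self[OF _ J] Xc by (auto simp: K_def)
  qed
  moreover have "\<forall>Y\<in>K. \<exists>g\<in>carrier G. Y = ?J #> g" using Xc by (auto simp: K_def)
  ultimately show ?thesis by blast
qed

end

end

section \<open>Virtual coefficients\<close>

lemma has_sum_finite_sum:
  fixes f :: "'i \<Rightarrow> 'j \<Rightarrow> 'b::topological_comm_monoid_add"
  assumes "\<And>i. i \<in> I \<Longrightarrow> (f i has_sum l i) X"
  shows "((\<lambda>x. \<Sum>i\<in>I. f i x) has_sum (\<Sum>i\<in>I. l i)) X"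
  using assms by (induction I rule: infinite_finite_induct) (simp_all add: has_sum_add)

text \<open>\<open>index\<close> is a \<open>card\<close> and would be 0 for infinitely many cosets;
  a bijection from the finite range of indices excludes this.\<close>

lemma finite_index_of_coset_reps:
  assumes "coset_reps G K H s"
  shows "finite (rcosets\<^bsub>G\<lparr>carrier := K\<rparr>\<^esub> H)"
  using assms bij_betw_finite[of _ "{1..index G K H}"] unfolding coset_reps_def by blast

lemma right_transversal_of_coset_reps:
  assumes "coset_reps G K H s"
  shows "right_transversal G K H (s ` {1..index G K H})"
proof -
  let ?I = "{1..index G K H}"
  have s: "s ` ?I \<subseteq> K" and bij: "bij_betw (\<lambda>i. H #>\<^bsub>G\<^esub> s i) ?I (rcosets\<^bsub>G\<lparr>carrier := K\<rparr>\<^esub> H)"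
    using assms by (auto simp only: coset_reps_def)
  have inj: "inj_on ((\<lambda>r. H #>\<^bsub>G\<^esub> r) \<circ> s) ?I"
    using bij by (simp add: bij_betw_def o_def)
  have "inj_on (\<lambda>r. H #>\<^bsub>G\<^esub> r) (s ` ?I)" using inj by (rule inj_on_imageI)
  then show "right_transversal G K H (s ` ?I)"
    using s bij by (simp add: right_transversal_def bij_betw_def image_image)
qed

section \<open>The representation and its wandering subspace\<close>

locale hecke_setting =
  fixes G :: "('g, 'm) monoid_scheme" (structure) and \<Gamma> :: "'g set"
    and \<pi>\<^sub>0 :: "'g \<Rightarrow> 'a::chilbert \<Rightarrow> 'a" and H\<^sub>0 :: "'a set"
    and \<pi> :: "'g \<Rightarrow> 'a \<Rightarrow> 'a" and L :: "'a set" and s :: "'g set \<Rightarrow> nat \<Rightarrow> 'g"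
  assumes pair: "hecke_pair G \<Gamma>"
    and TC: "technical_condition G \<Gamma> \<pi>\<^sub>0 H\<^sub>0 \<pi> L"
    and reps: "\<forall>\<Delta>\<in>subgroup_family G \<Gamma>. coset_reps G \<Gamma> \<Delta> (s \<Delta>)"

sublocale hecke_setting \<subseteq> group G
  using pair by (simp add: hecke_pair_def)

context hecke_setting
begin

abbreviation S where "S \<equiv> subgroup_family G \<Gamma>"
abbreviation P where "P \<equiv> proj L"
abbreviation P\<^sub>0 where "P\<^sub>0 \<equiv> proj H\<^sub>0"
abbreviation idx where "idx \<Delta> \<equiv> index G \<Gamma> \<Delta>"
abbreviation conv where "conv \<equiv> conv_domain G \<Gamma> \<pi> L"
abbreviation level where "level \<equiv> level_space G \<Gamma> \<pi> L s"
abbreviation coeff where "coeff \<equiv> virtual_coeff G \<Gamma> \<pi> L s \<pi>"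

lemma \<Gamma>_subgroup: "subgroup \<Gamma> G"
  using pair by (simp add: hecke_pair_def)

lemma \<Gamma>_in_S: "\<Gamma> \<in> S"
  by (rule subgroup_family.base)

lemma S_subgroup: "\<Delta> \<in> S \<Longrightarrow> subgroup \<Delta> G"
  and S_subset: "\<Delta> \<in> S \<Longrightarrow> \<Delta> \<subseteq> \<Gamma>"
  using subgroup_family_subgroup[OF _ \<Gamma>_subgroup] by simp_all

lemma \<Gamma>_carrier: "g \<in> \<Gamma> \<Longrightarrow> g \<in> carrier G"
  using subgroup.mem_carrier[OF \<Gamma>_subgroup] .

lemma S_carrier: "\<Delta> \<in> S \<Longrightarrow> g \<in> \<Delta> \<Longrightarrow> g \<in> carrier G"
  using subgroup.mem_carrier[OF S_subgroup] .

lemma S_conj_meet: "\<Delta> \<in> S \<Longrightarrow> g \<in> carrier G \<Longrightarrow> conj_meet G \<Delta> g \<in> S"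
  by (rule subgroup_family.conj)

lemma S_finite_index: "\<Delta> \<in> S \<Longrightarrow> finite (rcosets\<^bsub>G\<lparr>carrier := \<Gamma>\<rparr>\<^esub> \<Delta>)"
  using reps finite_index_of_coset_reps by blast

lemma idx_pos: "\<Delta> \<in> S \<Longrightarrow> 0 < idx \<Delta>"
  unfolding index_def using S_finite_index[of \<Delta>] subgroup.one_closed[OF \<Gamma>_subgroup]
  by (auto simp: card_gt_0_iff rcosets_restrict)

lemma rep_in_\<Gamma>: "\<Delta> \<in> S \<Longrightarrow> i \<in> {1..idx \<Delta>} \<Longrightarrow> s \<Delta> i \<in> \<Gamma>"
  using reps unfolding coset_reps_def by blast

lemma rep_carrier: "\<Delta> \<in> S \<Longrightarrow> i \<in> {1..idx \<Delta>} \<Longrightarrow> s \<Delta> i \<in> carrier G"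
  using rep_in_\<Gamma> \<Gamma>_carrier by blast

lemma rep_bij: "\<Delta> \<in> S \<Longrightarrow> bij_betw (\<lambda>(h, i). h \<otimes> s \<Delta> i) (\<Delta> \<times> {1..idx \<Delta>}) \<Gamma>"
  using bij_betw_transversal_iff[OF S_subgroup S_subset \<Gamma>_subgroup, of \<Delta> "s \<Delta>" "{1..idx \<Delta>}"] reps
  unfolding coset_reps_def by blast

lemma rep_decompose:
  assumes "\<Delta> \<in> S" "g \<in> \<Gamma>"
  obtains h i where "h \<in> \<Delta>" "i \<in> {1..idx \<Delta>}" "g = h \<otimes> s \<Delta> i"
proof -
  have "g \<in> (\<lambda>(h, i). h \<otimes> s \<Delta> i) ` (\<Delta> \<times> {1..idx \<Delta>})"
    using rep_bij[OF assms(1)] assms(2) by (simp add: bij_betw_def)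
  then show thesis using that by auto
qed

lemma rep_unique:
  assumes "\<Delta> \<in> S" "h \<in> \<Delta>" "i \<in> {1..idx \<Delta>}" "j \<in> {1..idx \<Delta>}" "h \<otimes> s \<Delta> i = s \<Delta> j"
  shows "h = \<one> \<and> i = j"
proof -
  have "(h, i) = (\<one>, j)"
    using assms rep_carrier[OF assms(1,4)] subgroup.one_closed[OF S_subgroup[OF assms(1)]]
    by (intro inj_onD[OF bij_betw_imp_inj_on[OF rep_bij[OF assms(1)]]]) auto
  then show ?thesis by simp
qed

lemma L_closed: "closed_csubspace L" and H\<^sub>0_closed: "closed_csubspace H\<^sub>0"
  using TC by (simp_all add: technical_condition_def)

lemmas L_csubspace = closed_csubspace_imp_csubspace[OF L_closed]

lemmas P_linear = bounded_linear_proj[OF L_closed]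

lemma P\<^sub>0_idem: "P\<^sub>0 (P\<^sub>0 x) = P\<^sub>0 x"
  by (rule proj_ident[OF H\<^sub>0_closed proj_in[OF H\<^sub>0_closed]])

lemma \<pi>_unitary: "unitary_rep G UNIV \<pi>"
  using TC by (simp add: technical_condition_def)

lemma \<pi>_add: "g \<in> carrier G \<Longrightarrow> \<pi> g (x + y) = \<pi> g x + \<pi> g y"
  and \<pi>_scaleC: "g \<in> carrier G \<Longrightarrow> \<pi> g (scaleC a x) = scaleC a (\<pi> g x)"
  and \<pi>_mult: "g \<in> carrier G \<Longrightarrow> h \<in> carrier G \<Longrightarrow> \<pi> (g \<otimes> h) x = \<pi> g (\<pi> h x)"
  and \<pi>_cinner: "g \<in> carrier G \<Longrightarrow> cinner (\<pi> g x) (\<pi> g y) = cinner x y"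
  using \<pi>_unitary by (simp_all add: unitary_rep_def clinear_on_def)

text \<open>\<open>unitary_rep\<close> states multiplicativity and bijectivity only; an injective
  idempotent map is the identity.\<close>

lemma \<pi>_one: "\<pi> \<one> x = x"
proof -
  have "\<pi> \<one> (\<pi> \<one> x) = \<pi> \<one> x" using \<pi>_mult[of \<one> \<one> x] by simp
  moreover have "inj (\<pi> \<one>)" using \<pi>_unitary by (simp add: unitary_rep_def bij_betw_def)
  ultimately show ?thesis by (simp add: inj_eq)
qed

lemma \<pi>_inv_cancel: "g \<in> carrier G \<Longrightarrow> \<pi> g (\<pi> (inv g) x) = x" "g \<in> carrier G \<Longrightarrow> \<pi> (inv g) (\<pi> g x) = x"
  by (simp_all add: \<pi>_mult[symmetric] \<pi>_one)

lemma \<pi>_adjoint: "g \<in> carrier G \<Longrightarrow> cinner (\<pi> g x) y = cinner x (\<pi> (inv g) y)"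
  by (metis \<pi>_cinner \<pi>_inv_cancel(1))

lemma norm_\<pi>: "g \<in> carrier G \<Longrightarrow> norm (\<pi> g x) = norm x"
  by (simp add: norm_eq_sqrt_inner inner_eq_Re_cinner \<pi>_cinner)

lemma \<pi>_linear: "g \<in> carrier G \<Longrightarrow> bounded_linear (\<pi> g)"
  by (rule bounded_linear_intro[where K = 1])
     (simp_all add: \<pi>_add norm_\<pi> scaleC_of_real[symmetric] \<pi>_scaleC)

lemma \<pi>_sum: "g \<in> carrier G \<Longrightarrow> \<pi> g (sum f A) = (\<Sum>i\<in>A. \<pi> g (f i))"
  by (rule linear_sum[OF bounded_linear.linear[OF \<pi>_linear]])

lemma P\<pi>_linear: "g \<in> carrier G \<Longrightarrow> bounded_linear (\<lambda>x. P (\<pi> g x))"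
  by (rule bounded_linear_compose[OF P_linear \<pi>_linear])

text \<open>Invariance of \<open>H\<^sub>0\<close> under the inverse of \<open>g\<close> as well
  makes \<open>\<pi> g\<close> preserve the orthogonal complement.\<close>

lemma P\<^sub>0_\<pi>:
  assumes "g \<in> carrier G"
  shows "P\<^sub>0 (\<pi> g x) = \<pi> g (P\<^sub>0 x)"
proof (rule proj_eqI[OF closed_csubspace_imp_csubspace[OF H\<^sub>0_closed]])
  have inv: "\<pi> h z \<in> H\<^sub>0" if "h \<in> carrier G" "z \<in> H\<^sub>0" for h z
    using TC that unfolding technical_condition_def by blast
  show "\<pi> g (P\<^sub>0 x) \<in> H\<^sub>0" by (rule inv[OF assms proj_in[OF H\<^sub>0_closed]])
  fix z assume z: "z \<in> H\<^sub>0"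
  have "\<pi> g x - \<pi> g (P\<^sub>0 x) = \<pi> g (x - P\<^sub>0 x)"
    by (rule linear_diff[OF bounded_linear.linear[OF \<pi>_linear[OF assms]], symmetric])
  then have "cinner (\<pi> g x - \<pi> g (P\<^sub>0 x)) z = cinner (x - P\<^sub>0 x) (\<pi> (inv g) z)"
    by (simp add: \<pi>_adjoint assms)
  also have "\<dots> = 0"
    by (rule proj_orthogonal[OF H\<^sub>0_closed inv[OF inv_closed[OF assms] z]])
  finally show "cinner (\<pi> g x - \<pi> g (P\<^sub>0 x)) z = 0" .
qed

lemma \<pi>\<^sub>0_eq: "g \<in> carrier G \<Longrightarrow> \<pi>\<^sub>0 g x = \<pi> g (P\<^sub>0 x)"
proof -
  assume g: "g \<in> carrier G"
  have "\<pi>\<^sub>0 g = compress P\<^sub>0 (\<pi> g)" using TC g unfolding technical_condition_def by blast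
  then show ?thesis by (simp add: compress_def P\<^sub>0_\<pi> P\<^sub>0_idem g)
qed

text \<open>In the regular model the two vectors are families supported at \<gamma> and at
  \<one>.\<close>

lemma wandering:
  assumes "\<gamma> \<in> \<Gamma>" "l \<in> L" "l' \<in> L" "\<gamma> \<noteq> \<one>"
  shows "cinner (\<pi> \<gamma> l) l' = 0"
proof -
  have "regular_multiple G \<Gamma> \<pi> L" using TC by (simp add: technical_condition_def)
  then obtain W where "l2_unitary UNIV \<Gamma> L W \<and>
      (\<forall>\<gamma>\<in>\<Gamma>. \<forall>x. W (\<pi> \<gamma> x) = left_regular G \<Gamma> \<gamma> (W x)) \<and> (\<forall>l\<in>L. W l = delta_tensor \<one> l)"
    unfolding regular_multiple_def by (elim exE)
  then have W: "l2_unitary UNIV \<Gamma> L W"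
      "\<And>\<gamma> x. \<gamma> \<in> \<Gamma> \<Longrightarrow> W (\<pi> \<gamma> x) = left_regular G \<Gamma> \<gamma> (W x)"
      "\<And>l. l \<in> L \<Longrightarrow> W l = delta_tensor \<one> l" by simp_all
  have \<gamma>: "\<gamma> \<in> carrier G" using assms \<Gamma>_carrier by simp
  have "cinner (\<pi> \<gamma> l) l' = l2_inner \<Gamma> (W (\<pi> \<gamma> l)) (W l')"
    using W(1) by (simp add: l2_unitary_def l2_isometry_def)
  also have "\<dots> = (\<Sum>\<^sub>\<infinity>k\<in>\<Gamma>. 0)"
    unfolding l2_inner_def W(2)[OF assms(1)] W(3)[OF assms(2)] W(3)[OF assms(3)]
  proof (rule infsum_cong)
    fix k assume k: "k \<in> \<Gamma>"
    \<comment> \<open>At each \<open>k\<close> at least one of the two families vanishes.\<close>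
    then have "inv \<gamma> \<otimes> k \<noteq> \<one> \<or> k \<noteq> \<one>" using \<gamma> assms(4) by (auto simp: inv_eq_1_iff)
    then show "cinner (left_regular G \<Gamma> \<gamma> (delta_tensor \<one> l) k) (delta_tensor \<one> l' k) = 0"
      using k by (auto simp: left_regular_def delta_tensor_def)
  qed
  finally show ?thesis by simp
qed

lemma P_\<pi>_L:
  assumes "\<gamma> \<in> \<Gamma>" "l \<in> L"
  shows "P (\<pi> \<gamma> l) = (if \<gamma> = \<one> then l else 0)"
proof (cases "\<gamma> = \<one>")
  case True
  then show ?thesis using proj_ident[OF L_closed assms(2)] by (simp add: \<pi>_one)
next
  case False
  have "P (\<pi> \<gamma> l) = 0"
    by (rule proj_eqI[OF L_csubspace csubspace_zero[OF L_csubspace]])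
       (simp add: wandering[OF assms _ False])
  then show ?thesis using False by simp
qed

text \<open>By unique factorisation the group element is trivial only if
  \<open>\<gamma> \<otimes> s \<Delta> j\<close> is \<open>s \<Delta> i\<close> with the trivial
  factorisation.\<close>

lemma P_rep_L:
  assumes "\<Delta> \<in> S" "i \<in> {1..idx \<Delta>}" "j \<in> {1..idx \<Delta>}" "\<gamma> \<in> \<Delta>" "l \<in> L"
  shows "P (\<pi> (inv (s \<Delta> i) \<otimes> \<gamma> \<otimes> s \<Delta> j) l) = (if i = j \<and> \<gamma> = \<one> then l else 0)"
proof -
  have si: "s \<Delta> i \<in> \<Gamma>" "s \<Delta> j \<in> \<Gamma>" "\<gamma> \<in> \<Gamma>" using assms rep_in_\<Gamma> S_subset by blast+
  then have c: "s \<Delta> i \<in> carrier G" "s \<Delta> j \<in> carrier G" "\<gamma> \<in> carrier G" using \<Gamma>_carrier by blast+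
  have "inv (s \<Delta> i) \<otimes> \<gamma> \<otimes> s \<Delta> j \<in> \<Gamma>"
    using si by (intro subgroup.m_closed[OF \<Gamma>_subgroup] subgroup.m_inv_closed[OF \<Gamma>_subgroup])
  moreover have "inv (s \<Delta> i) \<otimes> \<gamma> \<otimes> s \<Delta> j = \<one> \<longleftrightarrow> i = j \<and> \<gamma> = \<one>"
  proof
    assume "inv (s \<Delta> i) \<otimes> \<gamma> \<otimes> s \<Delta> j = \<one>"
    then have "s \<Delta> i \<otimes> (inv (s \<Delta> i) \<otimes> (\<gamma> \<otimes> s \<Delta> j)) = s \<Delta> i" using c by (simp add: m_assoc)
    then have "\<gamma> \<otimes> s \<Delta> j = s \<Delta> i" using c by (simp add: mult_inv_cancel)
    then show "i = j \<and> \<gamma> = \<one>" using rep_unique[OF assms(1,4,3,2)] by blast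
  qed (use c in simp)
  ultimately show ?thesis using P_\<pi>_L assms(5) by simp
qed

lemma coset_rep_L:
  assumes "\<Delta> \<in> S" "i \<in> {1..idx \<Delta>}" "j \<in> {1..idx \<Delta>}" "l \<in> L"
  shows "P (\<pi> (inv (s \<Delta> i)) (\<pi> (s \<Delta> j) l)) = (if i = j then l else 0)"
  using P_rep_L[OF assms(1-3) subgroup.one_closed[OF S_subgroup[OF assms(1)]] assms(4)] assms
  by (simp add: rep_carrier \<pi>_mult[symmetric])

subsection \<open>The level spaces\<close>

text \<open>The adjoint of the embedding of \<open>L\<close> as the \<open>i\<close>-th summand of
  the level space; on the level space itself it is the \<open>i\<close>-th coordinate, and
  \<open>assemble\<close> is inverse to the family of coordinates.\<close>

definition entry :: "'g set \<Rightarrow> nat \<Rightarrow> 'a \<Rightarrow> 'a" where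
  "entry \<Delta> i x = P (\<pi> (inv (s \<Delta> i)) x)"

definition assemble :: "'g set \<Rightarrow> (nat \<Rightarrow> 'a) \<Rightarrow> 'a" where
  "assemble \<Delta> l = (\<Sum>i=1..idx \<Delta>. \<pi> (s \<Delta> i) (l i))"

lemma entry_linear: "\<Delta> \<in> S \<Longrightarrow> i \<in> {1..idx \<Delta>} \<Longrightarrow> bounded_linear (entry \<Delta> i)"
  unfolding entry_def by (intro P\<pi>_linear inv_closed rep_carrier)

lemma entry_add: "\<Delta> \<in> S \<Longrightarrow> i \<in> {1..idx \<Delta>} \<Longrightarrow> entry \<Delta> i (x + y) = entry \<Delta> i x + entry \<Delta> i y"
  by (rule linear_add[OF bounded_linear.linear[OF entry_linear]])

lemma entry_sum: "\<Delta> \<in> S \<Longrightarrow> i \<in> {1..idx \<Delta>} \<Longrightarrow> entry \<Delta> i (sum f A) = (\<Sum>j\<in>A. entry \<Delta> i (f j))"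
  by (rule linear_sum[OF bounded_linear.linear[OF entry_linear]])

lemma entry_scaleC: "\<Delta> \<in> S \<Longrightarrow> i \<in> {1..idx \<Delta>} \<Longrightarrow> entry \<Delta> i (scaleC a x) = scaleC a (entry \<Delta> i x)"
  by (simp add: entry_def \<pi>_scaleC rep_carrier proj_scaleC[OF L_closed])

lemma entry_in_L: "entry \<Delta> i x \<in> L"
  unfolding entry_def by (rule proj_in[OF L_closed])

lemma level_eq: "level \<Delta> = {assemble \<Delta> l | l. \<forall>i. l i \<in> L}"
  by (simp add: level_space_def assemble_def)

lemma assemble_in_level: "(\<And>i. l i \<in> L) \<Longrightarrow> assemble \<Delta> l \<in> level \<Delta>"
  unfolding level_eq by blast

lemma entry_assemble:
  assumes "\<Delta> \<in> S" "i \<in> {1..idx \<Delta>}" "\<And>j. l j \<in> L"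
  shows "entry \<Delta> i (assemble \<Delta> l) = l i"
proof -
  have "entry \<Delta> i (assemble \<Delta> l) = (\<Sum>j=1..idx \<Delta>. if j = i then l j else 0)"
    unfolding assemble_def entry_sum[OF assms(1,2)]
    using assms by (intro sum.cong refl) (auto simp add: entry_def coset_rep_L simp del: atLeastAtMost_iff)
  then show ?thesis using assms(2) by simp
qed

lemma assemble_entry:
  assumes "\<Delta> \<in> S" "x \<in> level \<Delta>"
  shows "assemble \<Delta> (\<lambda>i. entry \<Delta> i x) = x"
proof -
  obtain l where l: "x = assemble \<Delta> l" "\<And>i. l i \<in> L" using assms(2) unfolding level_eq by blast
  show ?thesis
    unfolding l(1) assemble_def[of _ "\<lambda>i. entry _ i _"]
    using entry_assemble[where l = l, OF assms(1) _ l(2)] by (simp add: assemble_def)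
qed

lemma csubspace_level: "\<Delta> \<in> S \<Longrightarrow> csubspace (level \<Delta>)"
  unfolding csubspace_def
proof (intro conjI ballI allI)
  assume \<Delta>: "\<Delta> \<in> S"
  have "assemble \<Delta> (\<lambda>_. 0) \<in> level \<Delta>" by (intro assemble_in_level csubspace_zero L_csubspace)
  \<comment> \<open>Scaling 0 by 0 yields \<open>\<pi> g 0 = 0\<close>.\<close>
  then show "0 \<in> level \<Delta>" using rep_carrier[OF \<Delta>] \<pi>_scaleC[of _ 0 0] by (simp add: assemble_def)
  fix x assume x: "x \<in> level \<Delta>"
  have "scaleC a x = assemble \<Delta> (\<lambda>i. scaleC a (entry \<Delta> i x))" for a
    by (subst assemble_entry[OF \<Delta> x, symmetric])
       (simp add: assemble_def scaleC_sum_right \<pi>_scaleC rep_carrier[OF \<Delta>])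
  then show "scaleC a x \<in> level \<Delta>" for a
    by (simp add: assemble_in_level csubspace_scaleC L_csubspace entry_in_L)
  fix y assume y: "y \<in> level \<Delta>"
  have "x + y = assemble \<Delta> (\<lambda>i. entry \<Delta> i x) + assemble \<Delta> (\<lambda>i. entry \<Delta> i y)"
    by (simp add: assemble_entry \<Delta> x y)
  also have "\<dots> = assemble \<Delta> (\<lambda>i. entry \<Delta> i x + entry \<Delta> i y)"
    by (simp add: assemble_def sum.distrib \<pi>_add rep_carrier[OF \<Delta>])
  finally show "x + y \<in> level \<Delta>"
    by (simp add: assemble_in_level csubspace_add L_csubspace entry_in_L)
qed

lemma cinner_assemble:
  assumes "\<Delta> \<in> S" "\<And>i. l i \<in> L"
  shows "cinner x (assemble \<Delta> l) = (\<Sum>i=1..idx \<Delta>. cinner (entry \<Delta> i x) (l i))"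
  unfolding assemble_def cinner_sum_right
proof (intro sum.cong refl)
  fix i assume i: "i \<in> {1..idx \<Delta>}"
  have "cinner (entry \<Delta> i x) (l i) = cinner (\<pi> (inv (s \<Delta> i)) x) (l i)"
    unfolding entry_def by (rule cinner_proj_left[OF L_closed assms(2)])
  also have "\<dots> = cinner x (\<pi> (s \<Delta> i) (l i))"
    using rep_carrier[OF assms(1) i] by (simp add: \<pi>_adjoint)
  finally show "cinner x (\<pi> (s \<Delta> i) (l i)) = cinner (entry \<Delta> i x) (l i)" ..
qed

lemma cinner_level:
  assumes "\<Delta> \<in> S" "y \<in> level \<Delta>"
  shows "cinner x y = (\<Sum>i=1..idx \<Delta>. cinner (entry \<Delta> i x) (entry \<Delta> i y))"
  using cinner_assemble[OF assms(1), of "\<lambda>i. entry \<Delta> i y" x] by (simp add: assemble_entry assms entry_in_L)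

text \<open>Pairing with a level vector sees \<open>x\<close> only through its entries
  (\<open>cinner_level\<close>), and the candidate has the same entries as \<open>x\<close>.\<close>

lemma proj_level:
  assumes "\<Delta> \<in> S"
  shows "proj (level \<Delta>) x = assemble \<Delta> (\<lambda>i. entry \<Delta> i x)"
proof (rule proj_eqI[OF csubspace_level[OF assms]])
  show "assemble \<Delta> (\<lambda>i. entry \<Delta> i x) \<in> level \<Delta>" by (intro assemble_in_level entry_in_L)
  fix z assume z: "z \<in> level \<Delta>"
  have "cinner x z = cinner (assemble \<Delta> (\<lambda>i. entry \<Delta> i x)) z"
    unfolding cinner_level[OF assms z] by (intro sum.cong refl) (simp add: entry_assemble assms entry_in_L)
  then show "cinner (x - assemble \<Delta> (\<lambda>i. entry \<Delta> i x)) z = 0"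
    by (simp add: cinner_diff_left)
qed

lemma entry_proj_level: "\<Delta> \<in> S \<Longrightarrow> i \<in> {1..idx \<Delta>} \<Longrightarrow> entry \<Delta> i (proj (level \<Delta>) x) = entry \<Delta> i x"
  by (simp add: proj_level entry_assemble entry_in_L)

lemma cinner_proj_level: "\<Delta> \<in> S \<Longrightarrow> y \<in> level \<Delta> \<Longrightarrow> cinner (proj (level \<Delta>) x) y = cinner x y"
  by (simp add: cinner_level entry_proj_level)

lemma assemble_has_sum:
  assumes "\<Delta> \<in> S" "\<And>i. i \<in> {1..idx \<Delta>} \<Longrightarrow> (f i has_sum l i) X"
  shows "((\<lambda>x. assemble \<Delta> (\<lambda>i. f i x)) has_sum assemble \<Delta> l) X"
  unfolding assemble_def
proof (rule has_sum_finite_sum)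
  fix i assume "i \<in> {1..idx \<Delta>}"
  then show "((\<lambda>x. \<pi> (s \<Delta> i) (f i x)) has_sum \<pi> (s \<Delta> i) (l i)) X"
    by (intro has_sum_bounded_linear[OF \<pi>_linear] rep_carrier assms)
qed


subsection \<open>Convergence of virtual sums\<close>

lemma mult_bij_left: "a \<in> \<Delta> \<Longrightarrow> subgroup \<Delta> G \<Longrightarrow> bij_betw (\<lambda>\<gamma>. a \<otimes> \<gamma>) \<Delta> \<Delta>"
  by (rule bij_betw_byWitness[where f' = "\<lambda>\<gamma>. inv a \<otimes> \<gamma>"])
     (auto simp: subgroup.mem_carrier mult_inv_cancel subgroup.m_closed subgroup.m_inv_closed)

lemma mult_bij_right:
  assumes "a \<in> \<Delta>" "subgroup \<Delta> G"
  shows "bij_betw (\<lambda>\<gamma>. \<gamma> \<otimes> a) \<Delta> \<Delta>"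
proof -
  interpret D: subgroup \<Delta> G by fact
  show ?thesis
    by (rule bij_betw_byWitness[where f' = "\<lambda>\<gamma>. \<gamma> \<otimes> inv a"]) (auto simp: m_assoc assms)
qed

text \<open>All members of the family lie in \<Gamma>, and in a Banach space an unconditionally
  summable family is summable over every subset.\<close>

lemma conv_iff: "h \<in> conv \<longleftrightarrow> (\<lambda>\<gamma>. P (\<pi> \<gamma> h)) summable_on \<Gamma>"
proof
  assume "h \<in> conv"
  then show "(\<lambda>\<gamma>. P (\<pi> \<gamma> h)) summable_on \<Gamma>" using \<Gamma>_in_S by (simp add: conv_domain_def)
next
  assume "(\<lambda>\<gamma>. P (\<pi> \<gamma> h)) summable_on \<Gamma>"
  then have "(\<lambda>\<gamma>. P (\<pi> \<gamma> h)) summable_on \<Delta>" if "\<Delta> \<in> S" for \<Delta>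
    using S_subset[OF that] by (rule summable_on_subset_banach)
  then show "h \<in> conv" by (simp add: conv_domain_def)
qed

lemma csubspace_conv: "csubspace conv"
  unfolding csubspace_def
proof (intro conjI ballI allI)
  have eq: "(\<lambda>\<gamma>. P (\<pi> \<gamma> (f h))) summable_on \<Gamma> \<longleftrightarrow> (\<lambda>\<gamma>. g \<gamma>) summable_on \<Gamma>"
    if "\<And>\<gamma>. \<gamma> \<in> carrier G \<Longrightarrow> P (\<pi> \<gamma> (f h)) = g \<gamma>" for f :: "'a \<Rightarrow> 'a" and h g
    using that \<Gamma>_carrier by (intro summable_on_cong) auto
  show "0 \<in> conv" unfolding conv_iff
    by (subst eq[of "\<lambda>_. 0" _ "\<lambda>_. 0"]) (simp_all add: linear_0[OF bounded_linear.linear[OF P\<pi>_linear]])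
  fix x assume x: "x \<in> conv"
  show "scaleC a x \<in> conv" for a unfolding conv_iff
    by (subst eq[of "\<lambda>x. scaleC a x" _ "\<lambda>\<gamma>. scaleC a (P (\<pi> \<gamma> x))"])
       (use x in \<open>simp_all add: conv_iff \<pi>_scaleC proj_scaleC[OF L_closed] summable_on_bounded_linear[OF bounded_linear_scaleC]\<close>)
  fix y assume y: "y \<in> conv"
  show "x + y \<in> conv" unfolding conv_iff
    by (subst eq[of "\<lambda>x. x + y" _ "\<lambda>\<gamma>. P (\<pi> \<gamma> x) + P (\<pi> \<gamma> y)"])
       (use x y in \<open>simp_all add: conv_iff \<pi>_add proj_add[OF L_closed] summable_on_add\<close>)
qed

lemma conv_translate:
  assumes "h \<in> conv" "a \<in> \<Gamma>"
  shows "\<pi> a h \<in> conv"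
proof -
  have "(\<lambda>\<gamma>. P (\<pi> (\<gamma> \<otimes> a) h)) summable_on \<Gamma>"
    using summable_on_reindex_bij_betw[OF mult_bij_right[OF assms(2) \<Gamma>_subgroup], of "\<lambda>\<gamma>. P (\<pi> \<gamma> h)"]
      assms(1) by (simp add: conv_iff)
  then show ?thesis
    unfolding conv_iff using assms(2) \<Gamma>_carrier by (subst summable_on_cong) (auto simp: \<pi>_mult)
qed

text \<open>Up to left translation by \<open>inv (s \<Delta> i)\<close> this is a subfamily of the
  sum over \<Gamma> that defines \<open>conv\<close>.\<close>

lemma entry_summable:
  assumes "h \<in> conv" "\<Delta> \<in> S" "i \<in> {1..idx \<Delta>}"
  shows "(\<lambda>\<gamma>. entry \<Delta> i (\<pi> \<gamma> h)) summable_on \<Delta>"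
proof -
  have si: "inv (s \<Delta> i) \<in> \<Gamma>"
    using rep_in_\<Gamma>[OF assms(2,3)] by (rule subgroup.m_inv_closed[OF \<Gamma>_subgroup])
  have "(\<lambda>\<gamma>. P (\<pi> (inv (s \<Delta> i) \<otimes> \<gamma>) h)) summable_on \<Gamma>"
    using summable_on_reindex_bij_betw[OF mult_bij_left[OF si \<Gamma>_subgroup], of "\<lambda>\<gamma>. P (\<pi> \<gamma> h)"]
      assms(1) by (simp add: conv_iff)
  then have "(\<lambda>\<gamma>. P (\<pi> (inv (s \<Delta> i) \<otimes> \<gamma>) h)) summable_on \<Delta>"
    using S_subset[OF assms(2)] by (rule summable_on_subset_banach)
  then show ?thesis
    by (rule summable_on_cong[THEN iffD1, rotated])
       (use \<Gamma>_carrier[OF si] S_carrier[OF assms(2)] in \<open>simp add: entry_def \<pi>_mult\<close>)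
qed

lemma coeff_eq: "coeff \<Delta> h = (\<Sum>\<^sub>\<infinity>\<gamma>\<in>\<Delta>. proj (level \<Delta>) (\<pi> \<gamma> h))"
  by (simp add: virtual_coeff_def)

lemma coeff_has_sum_assemble:
  assumes "h \<in> conv" "\<Delta> \<in> S"
  shows "((\<lambda>\<gamma>. proj (level \<Delta>) (\<pi> \<gamma> h)) has_sum
    assemble \<Delta> (\<lambda>i. \<Sum>\<^sub>\<infinity>\<gamma>\<in>\<Delta>. entry \<Delta> i (\<pi> \<gamma> h))) \<Delta>"
  unfolding proj_level[OF assms(2)]
  by (intro assemble_has_sum assms has_sum_infsum entry_summable)

lemma coeff_has_sum:
  assumes "h \<in> conv" "\<Delta> \<in> S"
  shows "((\<lambda>\<gamma>. proj (level \<Delta>) (\<pi> \<gamma> h)) has_sum coeff \<Delta> h) \<Delta>"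
  using coeff_has_sum_assemble[OF assms] unfolding coeff_eq
  by (metis has_sum_infsum has_sum_imp_summable)

lemma coeff_in_level:
  assumes "h \<in> conv" "\<Delta> \<in> S"
  shows "coeff \<Delta> h \<in> level \<Delta>"
proof -
  \<comment> \<open>\<open>level_space\<close> asks for values in \<open>L\<close> at every natural
    number, hence the default 0 outside the range of indices.\<close>
  define l where "l = (\<lambda>i. if i \<in> {1..idx \<Delta>} then \<Sum>\<^sub>\<infinity>\<gamma>\<in>\<Delta>. entry \<Delta> i (\<pi> \<gamma> h) else 0)"
  have "l i \<in> L" for i
  proof (cases "i \<in> {1..idx \<Delta>}")
    case True
    have li: "l i = (\<Sum>\<^sub>\<infinity>\<gamma>\<in>\<Delta>. entry \<Delta> i (\<pi> \<gamma> h))" using True by (simp only: l_def if_True)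
    \<comment> \<open>\<open>P\<close> fixes every term and is continuous, so it fixes the sum; this
      places the limit in \<open>L\<close>.\<close>
    have "((\<lambda>\<gamma>. P (entry \<Delta> i (\<pi> \<gamma> h))) has_sum P (l i)) \<Delta>"
      unfolding li by (intro has_sum_bounded_linear[OF P_linear] has_sum_infsum entry_summable assms True)
    then have "((\<lambda>\<gamma>. entry \<Delta> i (\<pi> \<gamma> h)) has_sum P (l i)) \<Delta>"
      by (simp add: proj_ident[OF L_closed entry_in_L])
    then have "P (l i) = l i" unfolding li by (rule infsumI[symmetric])
    then show ?thesis using proj_in[OF L_closed] by metis
  qed (auto simp: l_def csubspace_zero L_csubspace)
  moreover have "coeff \<Delta> h = assemble \<Delta> l"
    using has_sum_unique[OF coeff_has_sum[OF assms] coeff_has_sum_assemble[OF assms]]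
    by (simp add: assemble_def l_def)
  ultimately show ?thesis by (simp add: assemble_in_level)
qed

lemma entry_coeff:
  assumes "h \<in> conv" "\<Delta> \<in> S" "i \<in> {1..idx \<Delta>}"
  shows "((\<lambda>\<gamma>. entry \<Delta> i (\<pi> \<gamma> h)) has_sum entry \<Delta> i (coeff \<Delta> h)) \<Delta>"
  using has_sum_bounded_linear[OF entry_linear[OF assms(2,3)] coeff_has_sum[OF assms(1,2)]]
  by (simp only: entry_proj_level[OF assms(2,3)])

lemma coeff_cinner:
  assumes "h \<in> conv" "\<Delta> \<in> S" "y \<in> level \<Delta>"
  shows "((\<lambda>\<gamma>. cinner (\<pi> \<gamma> h) y) has_sum cinner (coeff \<Delta> h) y) \<Delta>"
  using has_sum_bounded_linear[OF bounded_linear_cinner_left coeff_has_sum[OF assms(1,2)], of y]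
  by (simp add: cinner_proj_level assms)

text \<open>The group \<Gamma> is the disjoint union of the finitely many sets
  \<open>inv (s \<Delta> i)\<close> times \<Delta>, and the \<open>i\<close>-th entries of the
  summands over \<Delta> are the terms of the sum over the \<open>i\<close>-th set. Thus convergence
  at one level implies convergence at all levels.\<close>

lemma conv_of_level_summable:
  assumes \<Delta>: "\<Delta> \<in> S" and sum: "(\<lambda>\<gamma>. proj (level \<Delta>) (\<pi> \<gamma> h)) summable_on \<Delta>"
  shows "h \<in> conv"
proof -
  let ?I = "{1..idx \<Delta>}" and ?B = "\<lambda>r. (\<lambda>\<gamma>. inv r \<otimes> \<gamma>) ` \<Delta>"
  have rep: "coset_reps G \<Gamma> \<Delta> (s \<Delta>)" using reps \<Delta> by blast
  have bij: "bij_betw (\<lambda>(r, \<gamma>). inv r \<otimes> \<gamma>) (s \<Delta> ` ?I \<times> \<Delta>) \<Gamma>"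
    by (rule right_transversal_bij_inv[OF S_subgroup[OF \<Delta>] \<Gamma>_subgroup S_subset[OF \<Delta>]
          right_transversal_of_coset_reps[OF rep]])
  have "(\<lambda>\<gamma>. P (\<pi> \<gamma> h)) summable_on (\<Union>r\<in>s \<Delta> ` ?I. ?B r)"
  proof (rule summable_on_finite_union_disjoint)
    fix r assume "r \<in> s \<Delta> ` ?I"
    then obtain i where i: "i \<in> ?I" "r = s \<Delta> i" by blast
    have r: "r \<in> carrier G" using rep_carrier[OF \<Delta> i(1)] i(2) by simp
    have "(\<lambda>\<gamma>. entry \<Delta> i (\<pi> \<gamma> h)) summable_on \<Delta>"
      using summable_on_bounded_linear[OF entry_linear[OF \<Delta> i(1)] sum]
      by (simp only: entry_proj_level[OF \<Delta> i(1)])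
    then have "(\<lambda>\<gamma>. P (\<pi> (inv r \<otimes> \<gamma>) h)) summable_on \<Delta>"
      by (rule summable_on_cong[THEN iffD1, rotated])
         (use r S_carrier[OF \<Delta>] in \<open>simp add: entry_def \<pi>_mult i(2)\<close>)
    moreover have "inj_on (\<lambda>\<gamma>. inv r \<otimes> \<gamma>) \<Delta>"
      using r S_carrier[OF \<Delta>] by (auto intro!: inj_onI)
    ultimately show "(\<lambda>\<gamma>. P (\<pi> \<gamma> h)) summable_on ?B r"
      by (simp add: summable_on_reindex o_def)
  next
    fix r r' assume *: "r \<in> s \<Delta> ` ?I" "r' \<in> s \<Delta> ` ?I" "r \<noteq> r'"
    show "?B r \<inter> ?B r' = {}"
    proof (rule ccontr)
      assume "?B r \<inter> ?B r' \<noteq> {}"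
      then obtain \<gamma> \<gamma>' where g: "\<gamma> \<in> \<Delta>" "\<gamma>' \<in> \<Delta>" "inv r \<otimes> \<gamma> = inv r' \<otimes> \<gamma>'" by blast
      have "(r, \<gamma>) = (r', \<gamma>')"
        using * g by (intro inj_onD[OF bij_betw_imp_inj_on[OF bij]]) auto
      then show False using * by simp
    qed
  qed simp
  moreover have "(\<Union>r\<in>A. ?B r) = (\<lambda>(r, \<gamma>). inv r \<otimes> \<gamma>) ` (A \<times> \<Delta>)" for A by auto
  then have "(\<Union>r\<in>s \<Delta> ` ?I. ?B r) = \<Gamma>" using bij_betw_imp_surj_on[OF bij] by (simp only:)
  ultimately show ?thesis by (simp add: conv_iff)
qed

lemma coeff_add:
  assumes "\<Delta> \<in> S" "h \<in> conv" "k \<in> conv"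
  shows "coeff \<Delta> (h + k) = coeff \<Delta> h + coeff \<Delta> k"
proof (rule has_sum_unique)
  show "((\<lambda>\<gamma>. proj (level \<Delta>) (\<pi> \<gamma> (h + k))) has_sum coeff \<Delta> (h + k)) \<Delta>"
    by (intro coeff_has_sum csubspace_add csubspace_conv assms)
  have "((\<lambda>\<gamma>. proj (level \<Delta>) (\<pi> \<gamma> h) + proj (level \<Delta>) (\<pi> \<gamma> k)) has_sum (coeff \<Delta> h + coeff \<Delta> k)) \<Delta>"
    by (intro has_sum_add coeff_has_sum assms)
  then show "((\<lambda>\<gamma>. proj (level \<Delta>) (\<pi> \<gamma> (h + k))) has_sum (coeff \<Delta> h + coeff \<Delta> k)) \<Delta>"
  proof (rule has_sum_cong[THEN iffD1, rotated])
    fix \<gamma> assume "\<gamma> \<in> \<Delta>"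
    then have "\<gamma> \<in> carrier G" using S_carrier assms by blast
    then show "proj (level \<Delta>) (\<pi> \<gamma> h) + proj (level \<Delta>) (\<pi> \<gamma> k) = proj (level \<Delta>) (\<pi> \<gamma> (h + k))"
      by (simp add: proj_level assms assemble_def \<pi>_add entry_add sum.distrib rep_carrier)
  qed
qed

lemma coeff_scaleC:
  assumes "\<Delta> \<in> S" "h \<in> conv"
  shows "coeff \<Delta> (scaleC a h) = scaleC a (coeff \<Delta> h)"
proof (rule has_sum_unique)
  show "((\<lambda>\<gamma>. proj (level \<Delta>) (\<pi> \<gamma> (scaleC a h))) has_sum coeff \<Delta> (scaleC a h)) \<Delta>"
    by (intro coeff_has_sum csubspace_scaleC csubspace_conv assms)
  have "((\<lambda>\<gamma>. scaleC a (proj (level \<Delta>) (\<pi> \<gamma> h))) has_sum scaleC a (coeff \<Delta> h)) \<Delta>"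
    by (intro has_sum_bounded_linear[OF bounded_linear_scaleC] coeff_has_sum assms)
  then show "((\<lambda>\<gamma>. proj (level \<Delta>) (\<pi> \<gamma> (scaleC a h))) has_sum scaleC a (coeff \<Delta> h)) \<Delta>"
  proof (rule has_sum_cong[THEN iffD1, rotated])
    fix \<gamma> assume "\<gamma> \<in> \<Delta>"
    then have "\<gamma> \<in> carrier G" using S_carrier assms by blast
    then show "scaleC a (proj (level \<Delta>) (\<pi> \<gamma> h)) = proj (level \<Delta>) (\<pi> \<gamma> (scaleC a h))"
      by (simp add: proj_level assms assemble_def \<pi>_scaleC entry_scaleC scaleC_sum_right rep_carrier)
  qed
qed

lemma coeff_translate:
  assumes "\<Delta> \<in> S" "\<delta> \<in> \<Delta>"
  shows "coeff \<Delta> (\<pi> \<delta> h) = coeff \<Delta> h"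
proof -
  have "coeff \<Delta> (\<pi> \<delta> h) = (\<Sum>\<^sub>\<infinity>\<gamma>\<in>\<Delta>. proj (level \<Delta>) (\<pi> (\<gamma> \<otimes> \<delta>) h))"
    unfolding coeff_eq using S_carrier[OF assms(1)] assms(2) by (intro infsum_cong) (simp add: \<pi>_mult)
  also have "\<dots> = coeff \<Delta> h"
    unfolding coeff_eq
    by (rule infsum_reindex_bij_betw[OF mult_bij_right[OF assms(2) S_subgroup[OF assms(1)]]])
  finally show ?thesis .
qed

lemma L_subset_conv: "l \<in> L \<Longrightarrow> l \<in> conv"
proof -
  assume l: "l \<in> L"
  have "(\<lambda>\<gamma>. if \<gamma> = \<one> then l else 0) summable_on \<Gamma>"
    by (rule finite_nonzero_values_imp_summable_on) (rule finite_subset[of _ "{\<one>}"], auto)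
  then show ?thesis
    unfolding conv_iff by (rule summable_on_cong[THEN iffD1, rotated]) (simp add: P_\<pi>_L l)
qed

lemma level_subset_conv:
  assumes "\<Delta> \<in> S" "x \<in> level \<Delta>"
  shows "x \<in> conv"
  by (subst assemble_entry[OF assms, symmetric], unfold assemble_def)
     (intro csubspace_sum csubspace_conv conv_translate L_subset_conv entry_in_L rep_in_\<Gamma>[OF assms(1)])

lemma coeff_level:
  assumes \<Delta>: "\<Delta> \<in> S" and x: "x \<in> level \<Delta>"
  shows "coeff \<Delta> x = x"
proof -
  have entry: "entry \<Delta> i (\<pi> \<gamma> x) = (if \<gamma> = \<one> then entry \<Delta> i x else 0)"
    if i: "i \<in> {1..idx \<Delta>}" and \<gamma>: "\<gamma> \<in> \<Delta>" for i \<gamma>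
  proof -
    have "\<pi> (inv (s \<Delta> i)) (\<pi> \<gamma> x) = (\<Sum>j=1..idx \<Delta>. \<pi> (inv (s \<Delta> i) \<otimes> \<gamma> \<otimes> s \<Delta> j) (entry \<Delta> j x))"
      using rep_carrier[OF \<Delta> i] S_carrier[OF \<Delta> \<gamma>] rep_carrier[OF \<Delta>]
      by (subst assemble_entry[OF \<Delta> x, symmetric]) (simp add: assemble_def \<pi>_sum \<pi>_mult m_assoc)
    then have "entry \<Delta> i (\<pi> \<gamma> x) = (\<Sum>j=1..idx \<Delta>. if i = j \<and> \<gamma> = \<one> then entry \<Delta> j x else 0)"
      unfolding entry_def[of \<Delta> i "\<pi> \<gamma> x"]
      using P_rep_L[OF \<Delta> i _ \<gamma> entry_in_L] by (simp add: proj_sum[OF L_closed])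
    also have "\<dots> = (if \<gamma> = \<one> then entry \<Delta> i x else 0)" using i by auto
    finally show ?thesis .
  qed
  have "proj (level \<Delta>) (\<pi> \<gamma> x) = (if \<gamma> = \<one> then x else 0)" if "\<gamma> \<in> \<Delta>" for \<gamma>
  proof (cases "\<gamma> = \<one>")
    case True
    then show ?thesis by (simp add: proj_level[OF \<Delta>] \<pi>_one assemble_entry \<Delta> x)
  next
    case False
    then show ?thesis
      using entry[OF _ that] \<pi>_scaleC[of _ 0 0] rep_carrier[OF \<Delta>]
      by (simp add: proj_level[OF \<Delta>] assemble_def)
  qed
  then have "coeff \<Delta> x = (\<Sum>\<^sub>\<infinity>\<gamma>\<in>\<Delta>. if \<gamma> = \<one> then x else 0)"
    unfolding coeff_eq by (intro infsum_cong)
  also have "\<dots> = (\<Sum>\<^sub>\<infinity>\<gamma>\<in>{\<one>}. x)"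
    using subgroup.one_closed[OF S_subgroup[OF \<Delta>]] by (intro infsum_cong_neutral) auto
  finally show ?thesis by simp
qed

subsection \<open>Consequences of the technical condition\<close>

lemma TC_hs_sum:
  assumes "g \<in> carrier G" "\<Delta> \<in> S"
  shows "\<exists>T. hs_has_sum (\<lambda>\<theta>. compress P (\<pi>\<^sub>0 \<theta>)) (\<Delta> #> g) T"
proof -
  have "\<forall>g\<in>carrier G. \<forall>\<Delta>\<in>S. \<exists>T. hs_has_sum (\<lambda>\<theta>. compress P (\<pi>\<^sub>0 \<theta>)) (\<Delta> #> g) T \<and>
        (\<lambda>\<theta>. cmod (op_trace (compress P (\<pi>\<^sub>0 \<theta>)))) summable_on (\<Delta> #> g) \<and> trace_class T \<and>
        op_trace T = (\<Sum>\<^sub>\<infinity>\<theta>\<in>\<Delta> #> g. op_trace (compress P (\<pi>\<^sub>0 \<theta>)))"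
    using TC unfolding technical_condition_def by (elim conjE)
  then show ?thesis using assms by blast
qed

lemma compress_\<pi>\<^sub>0: "\<theta> \<in> carrier G \<Longrightarrow> l \<in> L \<Longrightarrow> compress P (\<pi>\<^sub>0 \<theta>) l = P (\<pi> \<theta> (P\<^sub>0 l))"
  by (simp add: compress_def proj_ident[OF L_closed] \<pi>\<^sub>0_eq)

text \<open>For the coset of \<open>g\<close> under \<Gamma>, the Hilbert-Schmidt sum of
  \<open>technical_condition\<close> evaluated at \<open>l\<close> is, term by term, the series that
  decides membership of \<open>\<pi> g (P\<^sub>0 l)\<close> in \<open>conv\<close>. Here
  \<open>g\<close> need not be in \<Gamma>, in contrast to \<open>conv_translate\<close>.\<close>

lemma translate_P\<^sub>0_L_conv:
  assumes g: "g \<in> carrier G" and l: "l \<in> L"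
  shows "\<pi> g (P\<^sub>0 l) \<in> conv"
proof -
  obtain T where "hs_has_sum (\<lambda>\<theta>. compress P (\<pi>\<^sub>0 \<theta>)) (\<Gamma> #> g) T"
    using TC_hs_sum[OF g \<Gamma>_in_S] by blast
  then have "(\<lambda>\<theta>. compress P (\<pi>\<^sub>0 \<theta>) l) summable_on (\<Gamma> #> g)"
    using hs_has_sum_has_sum has_sum_imp_summable by blast
  moreover have "bij_betw (\<lambda>\<gamma>. \<gamma> \<otimes> g) \<Gamma> (\<Gamma> #> g)"
    using g \<Gamma>_carrier by (auto simp: bij_betw_def r_coset_def intro!: inj_onI)
  ultimately have "(\<lambda>\<gamma>. compress P (\<pi>\<^sub>0 (\<gamma> \<otimes> g)) l) summable_on \<Gamma>"
    using summable_on_reindex_bij_betw[of "\<lambda>\<gamma>. \<gamma> \<otimes> g" \<Gamma> _ "\<lambda>\<theta>. compress P (\<pi>\<^sub>0 \<theta>) l"] by blast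
  then show ?thesis
    unfolding conv_iff
    by (rule summable_on_cong[THEN iffD1, rotated])
       (use g l \<Gamma>_carrier in \<open>simp add: compress_\<pi>\<^sub>0 \<pi>_mult\<close>)
qed

text \<open>The representatives \<open>s \<Delta> i\<close> are absorbed into \<open>g\<close>,
  since the case of \<open>L\<close> covers all of G.\<close>

lemma translate_P\<^sub>0_level_conv:
  assumes "g \<in> carrier G" "\<Delta> \<in> S" "x \<in> level \<Delta>"
  shows "\<pi> g (P\<^sub>0 x) \<in> conv"
proof -
  have "\<pi> g (P\<^sub>0 x) = (\<Sum>i=1..idx \<Delta>. \<pi> (g \<otimes> s \<Delta> i) (P\<^sub>0 (entry \<Delta> i x)))"
    using assms(1) rep_carrier[OF assms(2)]
    by (subst assemble_entry[OF assms(2,3), symmetric])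
       (simp add: assemble_def proj_sum[OF H\<^sub>0_closed] P\<^sub>0_\<pi> \<pi>_sum \<pi>_mult)
  also have "\<dots> \<in> conv"
    by (intro csubspace_sum csubspace_conv translate_P\<^sub>0_L_conv m_closed entry_in_L assms(1) rep_carrier[OF assms(2)])
  finally show ?thesis .
qed

text \<open>The admissible vectors for \<open>\<pi>\<^sub>0\<close>: the coefficient of
  \<open>h\<close> under \<open>\<pi>\<^sub>0\<close> is that of \<open>P\<^sub>0 h\<close> under
  \<pi>, so both vectors need convergent sums.\<close>

definition conv\<^sub>0 :: "'a set" where
  "conv\<^sub>0 = {h \<in> conv. P\<^sub>0 h \<in> conv}"

lemma sum_domain_\<pi>: "\<Delta> \<in> S \<Longrightarrow> sum_domain G \<Gamma> \<pi> L s \<pi> \<Delta> = conv"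
  unfolding sum_domain_def using coeff_has_sum[THEN has_sum_imp_summable] by blast

text \<open>The domain of formal sums turns out to be the same at every level, because
  \<open>conv_of_level_summable\<close> recovers convergence over \<Gamma> from a single level.
  Vectors can therefore change level without further checks.\<close>

lemma sum_domain_\<pi>\<^sub>0:
  assumes "\<Delta> \<in> S"
  shows "sum_domain G \<Gamma> \<pi> L s \<pi>\<^sub>0 \<Delta> = conv\<^sub>0"
proof -
  have "(\<lambda>\<gamma>. proj (level \<Delta>) (\<pi>\<^sub>0 \<gamma> h)) summable_on \<Delta> \<longleftrightarrow>
      (\<lambda>\<gamma>. proj (level \<Delta>) (\<pi> \<gamma> (P\<^sub>0 h))) summable_on \<Delta>" for h
    using S_carrier[OF assms] by (intro summable_on_cong) (simp add: \<pi>\<^sub>0_eq)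
  then show ?thesis
    unfolding sum_domain_def conv\<^sub>0_def
    using conv_of_level_summable[OF assms] coeff_has_sum[OF _ assms, THEN has_sum_imp_summable] by blast
qed

lemma virtual_coeff_\<pi>\<^sub>0:
  assumes "\<Delta> \<in> S"
  shows "virtual_coeff G \<Gamma> \<pi> L s \<pi>\<^sub>0 \<Delta> h = coeff \<Delta> (P\<^sub>0 h)"
  unfolding virtual_coeff_def
  using S_carrier[OF assms] by (intro infsum_cong) (simp add: \<pi>\<^sub>0_eq)

lemma csubspace_conv\<^sub>0: "csubspace conv\<^sub>0"
  unfolding csubspace_def conv\<^sub>0_def
  using csubspace_conv closed_csubspace_imp_csubspace[OF H\<^sub>0_closed] proj_ident[OF H\<^sub>0_closed, of 0]
  by (auto simp: proj_add[OF H\<^sub>0_closed] proj_scaleC[OF H\<^sub>0_closed] csubspace_add csubspace_scaleC csubspace_zero)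

lemma level_subset_conv\<^sub>0: "\<Delta> \<in> S \<Longrightarrow> x \<in> level \<Delta> \<Longrightarrow> x \<in> conv\<^sub>0"
  using level_subset_conv translate_P\<^sub>0_level_conv[of \<one>] by (simp add: conv\<^sub>0_def \<pi>_one)

lemma translate_P\<^sub>0_level_conv\<^sub>0: "g \<in> carrier G \<Longrightarrow> \<Delta> \<in> S \<Longrightarrow> x \<in> level \<Delta> \<Longrightarrow> \<pi> g (P\<^sub>0 x) \<in> conv\<^sub>0"
  by (simp add: conv\<^sub>0_def P\<^sub>0_\<pi> P\<^sub>0_idem translate_P\<^sub>0_level_conv)

lemma conv\<^sub>0_translate: "h \<in> conv\<^sub>0 \<Longrightarrow> a \<in> \<Gamma> \<Longrightarrow> \<pi> a h \<in> conv\<^sub>0"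
  by (simp add: conv\<^sub>0_def conv_translate P\<^sub>0_\<pi> \<Gamma>_carrier)

text \<open>The term for \<gamma> on the left is the term for \<open>inv \<gamma>\<close> on the
  right, and inversion permutes \<Delta>.\<close>

lemma coeff_P\<^sub>0_selfadjoint:
  assumes \<Delta>: "\<Delta> \<in> S" and x: "x \<in> level \<Delta>" and y: "y \<in> level \<Delta>"
  shows "cinner (coeff \<Delta> (P\<^sub>0 x)) y = cinner x (coeff \<Delta> (P\<^sub>0 y))"
proof (rule has_sum_unique)
  have conv: "P\<^sub>0 x \<in> conv" "P\<^sub>0 y \<in> conv"
    using level_subset_conv\<^sub>0[OF \<Delta>] x y by (auto simp: conv\<^sub>0_def)
  show "((\<lambda>\<gamma>. cinner (\<pi> \<gamma> (P\<^sub>0 x)) y) has_sum cinner (coeff \<Delta> (P\<^sub>0 x)) y) \<Delta>"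
    by (rule coeff_cinner[OF conv(1) \<Delta> y])
  have inv: "bij_betw (m_inv G) \<Delta> \<Delta>"
    by (rule bij_betw_byWitness[where f' = "m_inv G"])
       (use S_carrier[OF \<Delta>] in \<open>auto simp: subgroup.m_inv_closed[OF S_subgroup[OF \<Delta>]]\<close>)
  have "((\<lambda>\<gamma>. cinner (\<pi> \<gamma> (P\<^sub>0 y)) x) has_sum cinner (coeff \<Delta> (P\<^sub>0 y)) x) \<Delta>"
    by (rule coeff_cinner[OF conv(2) \<Delta> x])
  then have "((\<lambda>\<gamma>. cinner (\<pi> (inv \<gamma>) (P\<^sub>0 y)) x) has_sum cinner (coeff \<Delta> (P\<^sub>0 y)) x) \<Delta>"
    using has_sum_reindex_bij_betw[OF inv, of "\<lambda>\<gamma>. cinner (\<pi> \<gamma> (P\<^sub>0 y)) x"] by blast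
  then have "((\<lambda>\<gamma>. cnj (cinner (\<pi> (inv \<gamma>) (P\<^sub>0 y)) x)) has_sum cnj (cinner (coeff \<Delta> (P\<^sub>0 y)) x)) \<Delta>"
    by simp
  then show "((\<lambda>\<gamma>. cinner (\<pi> \<gamma> (P\<^sub>0 x)) y) has_sum cinner x (coeff \<Delta> (P\<^sub>0 y))) \<Delta>"
    unfolding cinner_commute[of x, symmetric]
  proof (rule has_sum_cong[THEN iffD1, rotated])
    fix \<gamma> assume "\<gamma> \<in> \<Delta>"
    then have \<gamma>: "\<gamma> \<in> carrier G" using S_carrier \<Delta> by blast
    have "cinner (\<pi> \<gamma> (P\<^sub>0 x)) y = cinner (P\<^sub>0 x) (\<pi> (inv \<gamma>) y)" by (rule \<pi>_adjoint[OF \<gamma>])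
    also have "\<dots> = cinner x (\<pi> (inv \<gamma>) (P\<^sub>0 y))"
      using \<gamma> by (simp add: cinner_proj_commute[OF H\<^sub>0_closed] P\<^sub>0_\<pi>)
    finally show "cinner x (\<pi> (inv \<gamma>) (P\<^sub>0 y)) = cinner (\<pi> \<gamma> (P\<^sub>0 x)) y" ..
  qed
qed

end

section \<open>Hecke operators on virtual vectors\<close>

lemma cinner_self_eq_0: "cinner x x = 0 \<longleftrightarrow> (x::'a::chilbert) = 0"
  by (simp add: cinner_self)

context
  fixes V :: "'a::chilbert \<Rightarrow> 'b::chilbert" and f :: "'a \<Rightarrow> 'a" and n :: nat and D :: "'a set"
  assumes D: "csubspace D" and n: "0 < n"
    and f_add: "\<And>x y. x \<in> D \<Longrightarrow> y \<in> D \<Longrightarrow> f (x + y) = f x + f y"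
    and f_scaleC: "\<And>a x. x \<in> D \<Longrightarrow> f (scaleC a x) = scaleC a (f x)"
    and V_cinner: "\<And>x y. x \<in> D \<Longrightarrow> y \<in> D \<Longrightarrow> cinner (V x) (V y) = cinner (f x) (f y) / of_nat n"
begin

text \<open>\<open>virtual_completion\<close> describes \<open>V\<close> and
  \<open>V\<^sub>0\<close> through scalar products and identifications, not as linear maps.
  Linearity follows because the squared norm of the defect expands into scalar products of values of
  the linear map \<open>f\<close> that cancel. In the applications \<open>f\<close> is
  \<open>coeff \<Delta>\<close>, possibly after \<open>P\<^sub>0\<close>, and \<open>n\<close> is
  \<open>idx \<Delta>\<close>.\<close>

lemma scaled_isometry_add:
  assumes "x \<in> D" "y \<in> D"
  shows "V (x + y) = V x + V y"
proof -
  have "x + y \<in> D" using D assms by (rule csubspace_add)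
  then have "cinner (V (x + y) - (V x + V y)) (V (x + y) - (V x + V y)) = 0"
    using assms
    by (simp add: cinner_diff_left cinner_diff_right cinner_add_left cinner_add_right V_cinner f_add
        add_divide_distrib)
  then show ?thesis by (simp add: cinner_self_eq_0)
qed

lemma scaled_isometry_scaleC:
  assumes "x \<in> D"
  shows "V (scaleC a x) = scaleC a (V x)"
proof -
  have "scaleC a x \<in> D" using D assms by (rule csubspace_scaleC)
  then have "cinner (V (scaleC a x) - scaleC a (V x)) (V (scaleC a x) - scaleC a (V x)) = 0"
    using assms
    by (simp add: cinner_diff_left cinner_diff_right cinner_scaleC_left cinner_scaleC_right V_cinner f_scaleC)
  then show ?thesis by (simp add: cinner_self_eq_0)
qed

lemma scaled_isometry_eq_iff:
  assumes "x \<in> D" "y \<in> D"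
  shows "V x = V y \<longleftrightarrow> f x = f y"
proof -
  have "cinner (V x - V y) (V x - V y) = cinner (f x - f y) (f x - f y) / of_nat n"
    using assms by (simp add: cinner_diff_left cinner_diff_right V_cinner diff_divide_distrib)
  then have "V x - V y = 0 \<longleftrightarrow> f x - f y = 0"
    unfolding cinner_self_eq_0[symmetric] using n by simp
  then show ?thesis by simp
qed

lemma scaled_isometry_sum:
  assumes "\<And>i. i \<in> I \<Longrightarrow> x i \<in> D"
  shows "V (sum x I) = (\<Sum>i\<in>I. V (x i))"
  using assms
proof (induction I rule: infinite_finite_induct)
  case (insert i I)
  then have "sum x I \<in> D" by (intro csubspace_sum[OF D]) simp
  then show ?case using insert by (simp add: scaled_isometry_add)
next
  have "V 0 = 0"
    using scaled_isometry_scaleC[OF csubspace_zero[OF D], of 0] by simp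
  then show "V (sum x {}) = (\<Sum>i\<in>{}. V (x i))" "\<And>A. infinite A \<Longrightarrow> V (sum x A) = (\<Sum>i\<in>A. V (x i))"
    by simp_all
qed

lemma csubspace_scaled_isometry_image: "csubspace (V ` D)"
  unfolding csubspace_def
proof (intro conjI ballI allI)
  show "0 \<in> V ` D"
    using scaled_isometry_scaleC[OF csubspace_zero[OF D], of 0] csubspace_zero[OF D]
    by (metis image_eqI scaleC_zero_left)
  fix u assume "u \<in> V ` D"
  then obtain x where x: "u = V x" "x \<in> D" by blast
  show "scaleC a u \<in> V ` D" for a
    unfolding x(1) scaled_isometry_scaleC[OF x(2), symmetric] by (intro imageI csubspace_scaleC D x)
  fix v assume "v \<in> V ` D"
  then obtain y where y: "v = V y" "y \<in> D" by blast
  show "u + v \<in> V ` D"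
    unfolding x(1) y(1) scaled_isometry_add[OF x(2) y(2), symmetric] by (intro imageI csubspace_add D x y)
qed

end

section \<open>Virtual vectors as scaled coefficients\<close>

locale virtual_setting = hecke_setting G \<Gamma> \<pi>\<^sub>0 H\<^sub>0 \<pi> L s
  for G :: "('g, 'm) monoid_scheme" (structure) and \<Gamma> :: "'g set"
    and \<pi>\<^sub>0 :: "'g \<Rightarrow> 'a::chilbert \<Rightarrow> 'a" and H\<^sub>0 :: "'a set"
    and \<pi> :: "'g \<Rightarrow> 'a \<Rightarrow> 'a" and L :: "'a set" and s :: "'g set \<Rightarrow> nat \<Rightarrow> 'g" +
  fixes V\<^sub>0 :: "'g set \<Rightarrow> 'a \<Rightarrow> 'k::chilbert" and V :: "'g set \<Rightarrow> 'a \<Rightarrow> 'l::chilbert"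
    and C :: "('c, 'n) monoid_scheme" and T :: "'c topology" and \<iota> :: "'g \<Rightarrow> 'c"
    and \<Phi>\<^sub>0 :: "'c \<Rightarrow> 'k \<Rightarrow> 'k"
  assumes virtual\<^sub>0: "virtual_completion G \<Gamma> \<pi> L s \<pi>\<^sub>0 V\<^sub>0"
    and rep\<^sub>0: "virtual_rep G \<Gamma> \<pi> L s \<pi>\<^sub>0 V\<^sub>0 C T \<iota> \<Phi>\<^sub>0"
    and virtual: "virtual_completion G \<Gamma> \<pi> L s \<pi> V"
begin

lemma V\<^sub>0_cinner:
  assumes "\<Delta> \<in> S" "h \<in> conv\<^sub>0" "k \<in> conv\<^sub>0"
  shows "cinner (V\<^sub>0 \<Delta> h) (V\<^sub>0 \<Delta> k) = cinner (coeff \<Delta> (P\<^sub>0 h)) (coeff \<Delta> (P\<^sub>0 k)) / of_nat (idx \<Delta>)"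
proof -
  have "\<forall>\<Delta>\<in>S. \<forall>h\<in>sum_domain G \<Gamma> \<pi> L s \<pi>\<^sub>0 \<Delta>. \<forall>k\<in>sum_domain G \<Gamma> \<pi> L s \<pi>\<^sub>0 \<Delta>.
      cinner (V\<^sub>0 \<Delta> h) (V\<^sub>0 \<Delta> k) = cinner (virtual_coeff G \<Gamma> \<pi> L s \<pi>\<^sub>0 \<Delta> h)
        (virtual_coeff G \<Gamma> \<pi> L s \<pi>\<^sub>0 \<Delta> k) / of_nat (idx \<Delta>)"
    using virtual\<^sub>0 unfolding virtual_completion_def by (elim conjE)
  then show ?thesis
    using assms unfolding virtual_coeff_\<pi>\<^sub>0[OF assms(1), symmetric] sum_domain_\<pi>\<^sub>0[OF assms(1), symmetric]
    by blast
qed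

lemma V\<^sub>0_coeff:
  assumes "\<Delta> \<in> S" "h \<in> conv\<^sub>0"
  shows "V\<^sub>0 \<Delta> h = V\<^sub>0 \<Delta> (coeff \<Delta> (P\<^sub>0 h))"
proof -
  have "\<forall>\<Delta>\<in>S. \<forall>h\<in>sum_domain G \<Gamma> \<pi> L s \<pi>\<^sub>0 \<Delta>. V\<^sub>0 \<Delta> h = V\<^sub>0 \<Delta> (virtual_coeff G \<Gamma> \<pi> L s \<pi>\<^sub>0 \<Delta> h)"
    using virtual\<^sub>0 unfolding virtual_completion_def by (elim conjE)
  then show ?thesis
    using assms unfolding virtual_coeff_\<pi>\<^sub>0[OF assms(1), symmetric] sum_domain_\<pi>\<^sub>0[OF assms(1), symmetric]
    by blast
qed

lemma V\<^sub>0_refine: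
  assumes "\<Delta> \<in> S" "\<Delta>' \<in> S" "\<Delta>' \<subseteq> \<Delta>" "right_transversal G \<Delta> \<Delta>' R" "h \<in> conv\<^sub>0"
  shows "V\<^sub>0 \<Delta> h = V\<^sub>0 \<Delta>' (\<Sum>r\<in>R. \<pi> r h)"
proof -
  have "\<forall>\<Delta>\<in>S. \<forall>\<Delta>'\<in>S. \<forall>R. \<Delta>' \<subseteq> \<Delta> \<and> right_transversal G \<Delta> \<Delta>' R \<longrightarrow>
      (\<forall>h\<in>sum_domain G \<Gamma> \<pi> L s \<pi>\<^sub>0 \<Delta>. V\<^sub>0 \<Delta> h = V\<^sub>0 \<Delta>' (\<Sum>r\<in>R. \<pi> r h))"
    using virtual\<^sub>0 unfolding virtual_completion_def by (elim conjE)
  then show ?thesis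
    using assms unfolding sum_domain_\<pi>\<^sub>0[OF assms(1), symmetric] by blast
qed

lemma V_cinner:
  assumes "\<Delta> \<in> S" "h \<in> conv" "k \<in> conv"
  shows "cinner (V \<Delta> h) (V \<Delta> k) = cinner (coeff \<Delta> h) (coeff \<Delta> k) / of_nat (idx \<Delta>)"
proof -
  have "\<forall>\<Delta>\<in>S. \<forall>h\<in>sum_domain G \<Gamma> \<pi> L s \<pi> \<Delta>. \<forall>k\<in>sum_domain G \<Gamma> \<pi> L s \<pi> \<Delta>.
      cinner (V \<Delta> h) (V \<Delta> k) = cinner (coeff \<Delta> h) (coeff \<Delta> k) / of_nat (idx \<Delta>)"
    using virtual unfolding virtual_completion_def by (elim conjE)
  then show ?thesis using assms unfolding sum_domain_\<pi>[OF assms(1), symmetric] by blast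
qed

lemma coeff_P\<^sub>0_add:
  "\<Delta> \<in> S \<Longrightarrow> h \<in> conv\<^sub>0 \<Longrightarrow> k \<in> conv\<^sub>0 \<Longrightarrow>
    coeff \<Delta> (P\<^sub>0 (h + k)) = coeff \<Delta> (P\<^sub>0 h) + coeff \<Delta> (P\<^sub>0 k)"
  by (simp add: conv\<^sub>0_def proj_add[OF H\<^sub>0_closed] coeff_add)

lemma coeff_P\<^sub>0_scaleC:
  "\<Delta> \<in> S \<Longrightarrow> h \<in> conv\<^sub>0 \<Longrightarrow> coeff \<Delta> (P\<^sub>0 (scaleC a h)) = scaleC a (coeff \<Delta> (P\<^sub>0 h))"
  by (simp add: conv\<^sub>0_def proj_scaleC[OF H\<^sub>0_closed] coeff_scaleC)

lemma V\<^sub>0_eq_iff: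
  assumes "\<Delta> \<in> S" "h \<in> conv\<^sub>0" "k \<in> conv\<^sub>0"
  shows "V\<^sub>0 \<Delta> h = V\<^sub>0 \<Delta> k \<longleftrightarrow> coeff \<Delta> (P\<^sub>0 h) = coeff \<Delta> (P\<^sub>0 k)"
  by (rule scaled_isometry_eq_iff[OF csubspace_conv\<^sub>0 idx_pos[OF assms(1)] coeff_P\<^sub>0_add[OF assms(1)]
        coeff_P\<^sub>0_scaleC[OF assms(1)] V\<^sub>0_cinner[OF assms(1)]])
     (use assms in auto)

lemma V\<^sub>0_sum:
  assumes "\<Delta> \<in> S" "\<And>i. i \<in> I \<Longrightarrow> h i \<in> conv\<^sub>0"
  shows "V\<^sub>0 \<Delta> (sum h I) = (\<Sum>i\<in>I. V\<^sub>0 \<Delta> (h i))"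
  by (rule scaled_isometry_sum[OF csubspace_conv\<^sub>0 idx_pos[OF assms(1)] coeff_P\<^sub>0_add[OF assms(1)]
        coeff_P\<^sub>0_scaleC[OF assms(1)] V\<^sub>0_cinner[OF assms(1)]])
     (use assms in auto)

lemma csubspace_V\<^sub>0:
  assumes "\<Delta> \<in> S"
  shows "csubspace (V\<^sub>0 \<Delta> ` conv\<^sub>0)"
  by (rule csubspace_scaled_isometry_image[OF csubspace_conv\<^sub>0 idx_pos[OF assms(1)] coeff_P\<^sub>0_add[OF assms(1)]
        coeff_P\<^sub>0_scaleC[OF assms(1)] V\<^sub>0_cinner[OF assms(1)]])
     (use assms in auto)

lemma V_eq_iff:
  assumes "\<Delta> \<in> S" "h \<in> conv" "k \<in> conv"
  shows "V \<Delta> h = V \<Delta> k \<longleftrightarrow> coeff \<Delta> h = coeff \<Delta> k"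
  by (rule scaled_isometry_eq_iff[OF csubspace_conv idx_pos[OF assms(1)] coeff_add[OF assms(1)]
        coeff_scaleC[OF assms(1)] V_cinner[OF assms(1)]])
     (use assms in auto)

lemma V_add:
  assumes "\<Delta> \<in> S" "h \<in> conv" "k \<in> conv"
  shows "V \<Delta> (h + k) = V \<Delta> h + V \<Delta> k"
  by (rule scaled_isometry_add[OF csubspace_conv idx_pos[OF assms(1)] coeff_add[OF assms(1)]
        coeff_scaleC[OF assms(1)] V_cinner[OF assms(1)]])
     (use assms in auto)

lemma V_scaleC:
  assumes "\<Delta> \<in> S" "h \<in> conv"
  shows "V \<Delta> (scaleC a h) = scaleC a (V \<Delta> h)"
  by (rule scaled_isometry_scaleC[OF csubspace_conv idx_pos[OF assms(1)] coeff_add[OF assms(1)]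
        coeff_scaleC[OF assms(1)] V_cinner[OF assms(1)]])
     (use assms in auto)

lemma coeff_P\<^sub>0_in_level: "\<Delta> \<in> S \<Longrightarrow> h \<in> conv\<^sub>0 \<Longrightarrow> coeff \<Delta> (P\<^sub>0 h) \<in> level \<Delta>"
  by (rule coeff_in_level) (simp_all add: conv\<^sub>0_def)

text \<open>Idempotence is not computed: it is the identification of a formal sum with that of its
  coefficient, read through \<open>V\<^sub>0_eq_iff\<close>.\<close>

lemma coeff_P\<^sub>0_idem:
  assumes "\<Delta> \<in> S" "h \<in> conv\<^sub>0"
  shows "coeff \<Delta> (P\<^sub>0 (coeff \<Delta> (P\<^sub>0 h))) = coeff \<Delta> (P\<^sub>0 h)"
  using V\<^sub>0_eq_iff[OF assms level_subset_conv\<^sub>0[OF assms(1) coeff_P\<^sub>0_in_level[OF assms]]] V\<^sub>0_coeff[OF assms]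
  by simp

section \<open>Comparison of two levels\<close>

lemma rep_L_in_level:
  assumes "\<Delta> \<in> S" "i \<in> {1..idx \<Delta>}" "l \<in> L"
  shows "\<pi> (s \<Delta> i) l \<in> level \<Delta>"
proof -
  have z: "\<pi> g 0 = 0" if "g \<in> carrier G" for g
    using that \<pi>_scaleC[of g 0 0] by simp
  have "assemble \<Delta> (\<lambda>j. if j = i then l else 0) = (\<Sum>j=1..idx \<Delta>. if j = i then \<pi> (s \<Delta> i) l else 0)"
    unfolding assemble_def using rep_carrier[OF assms(1)] by (intro sum.cong refl) (simp add: z)
  also have "\<dots> = \<pi> (s \<Delta> i) l" using assms(2) by simp
  finally show ?thesis
    using assemble_in_level[of "\<lambda>j. if j = i then l else 0" \<Delta>] assms(3) csubspace_zero[OF L_csubspace] by simp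
qed

text \<open>The representatives \<open>q s\<^sub>i\<close> that arise on passing to a smaller group are in general not those
  chosen by \<open>s\<close>; this is why an arbitrary \<open>a\<close> is allowed here.\<close>

lemma V\<^sub>0_cinner_has_sum:
  assumes \<Delta>: "\<Delta> \<in> S" and k: "k \<in> conv\<^sub>0" and a: "a \<in> \<Gamma>" and l: "l \<in> L"
  shows "((\<lambda>\<gamma>. cinner (\<pi> \<gamma> (P\<^sub>0 k)) (\<pi> a l)) has_sum
    of_nat (idx \<Delta>) * cinner (V\<^sub>0 \<Delta> k) (V\<^sub>0 \<Delta> (\<pi> a l))) \<Delta>"
proof -
  obtain \<delta> j where j: "\<delta> \<in> \<Delta>" "j \<in> {1..idx \<Delta>}" "a = \<delta> \<otimes> s \<Delta> j"
    using rep_decompose[OF \<Delta> a] by blast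
  define y where "y = \<pi> (s \<Delta> j) l"
  have y: "y \<in> level \<Delta>" unfolding y_def by (rule rep_L_in_level[OF \<Delta> j(2) l])
  have \<delta>: "\<delta> \<in> carrier G" "\<delta> \<in> \<Gamma>" using S_carrier[OF \<Delta>] S_subset[OF \<Delta>] j(1) by auto
  have \<pi>a: "\<pi> a l = \<pi> \<delta> y" unfolding y_def j(3) by (rule \<pi>_mult[OF \<delta>(1) rep_carrier[OF \<Delta> j(2)]])
  have y0: "y \<in> conv\<^sub>0" by (rule level_subset_conv\<^sub>0[OF \<Delta> y])
  \<comment> \<open>A left factor from \<Delta> does not change the sum over \<Delta>, so
    \<open>a\<close> may be replaced by its chosen representative.\<close>
  have "V\<^sub>0 \<Delta> (\<pi> a l) = V\<^sub>0 \<Delta> y"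
    unfolding \<pi>a V\<^sub>0_eq_iff[OF \<Delta> conv\<^sub>0_translate[OF y0 \<delta>(2)] y0]
    by (simp add: P\<^sub>0_\<pi> \<delta> coeff_translate[OF \<Delta> j(1)])
  then have "of_nat (idx \<Delta>) * cinner (V\<^sub>0 \<Delta> k) (V\<^sub>0 \<Delta> (\<pi> a l)) = cinner (coeff \<Delta> (P\<^sub>0 k)) (coeff \<Delta> (P\<^sub>0 y))"
    using idx_pos[OF \<Delta>] by (simp add: V\<^sub>0_cinner[OF \<Delta> k y0])
  \<comment> \<open>The operation \<open>P\<^sub>0\<close> followed by \<open>coeff\<close> is moved
    from \<open>y\<close> to the first argument, where it is absorbed by idempotence.\<close>
  also have "\<dots> = cinner (coeff \<Delta> (P\<^sub>0 k)) y"
    using coeff_P\<^sub>0_selfadjoint[OF \<Delta> coeff_P\<^sub>0_in_level[OF \<Delta> k] y] coeff_P\<^sub>0_idem[OF \<Delta> k] by simp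
  finally have eq: "of_nat (idx \<Delta>) * cinner (V\<^sub>0 \<Delta> k) (V\<^sub>0 \<Delta> (\<pi> a l)) = cinner (coeff \<Delta> (P\<^sub>0 k)) y" .
  have "((\<lambda>\<gamma>. cinner (\<pi> \<gamma> (P\<^sub>0 k)) y) has_sum cinner (coeff \<Delta> (P\<^sub>0 k)) y) \<Delta>"
    using k by (intro coeff_cinner \<Delta> y) (simp add: conv\<^sub>0_def)
  \<comment> \<open>Shifting the summation by \<open>inv \<delta>\<close> restores the factor
    \<delta> in the second argument.\<close>
  then have "((\<lambda>\<gamma>. cinner (\<pi> (inv \<delta> \<otimes> \<gamma>) (P\<^sub>0 k)) y) has_sum cinner (coeff \<Delta> (P\<^sub>0 k)) y) \<Delta>"
    using has_sum_reindex_bij_betw[OF mult_bij_left[OF subgroup.m_inv_closed[OF S_subgroup[OF \<Delta>] j(1)] S_subgroup[OF \<Delta>]],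
        of "\<lambda>\<gamma>. cinner (\<pi> \<gamma> (P\<^sub>0 k)) y"] by blast
  then show ?thesis
    unfolding eq unfolding \<pi>a
    by (rule has_sum_cong[THEN iffD1, rotated])
       (use \<delta> S_carrier[OF \<Delta>] in \<open>simp add: \<pi>_mult \<pi>_adjoint[of "inv \<delta>"]\<close>)
qed

text \<open>The matrix coefficients are summed over \<Delta> in blocks \<open>inv r\<close> times
  \<open>\<Delta>'\<close>. In the block of \<open>r\<close> the representative moves to the second
  argument, and by the inclusion of levels the vectors \<open>\<pi> r (\<pi> a l)\<close>, summed
  over \<open>R\<close> at level \<open>\<Delta>'\<close>, give the class of
  \<open>\<pi> a l\<close> at level \<Delta>.\<close>

lemma V\<^sub>0_cinner_refine:
  assumes \<Delta>: "\<Delta> \<in> S" and \<Delta>': "\<Delta>' \<in> S" and sub: "\<Delta>' \<subseteq> \<Delta>" and k: "k \<in> conv\<^sub>0" and a: "a \<in> \<Gamma>" and l: "l \<in> L"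
  shows "of_nat (index G \<Delta> \<Delta>') * cinner (V\<^sub>0 \<Delta>' k) (V\<^sub>0 \<Delta> (\<pi> a l)) = cinner (V\<^sub>0 \<Delta> k) (V\<^sub>0 \<Delta> (\<pi> a l))"
proof -
  obtain R where R: "right_transversal G \<Delta> \<Delta>' R" using right_transversal_exists by blast
  have finR: "finite R" by (rule finite_right_transversal[OF R S_finite_index[OF \<Delta>'] S_subset[OF \<Delta>]])
  have RD: "r \<in> \<Gamma>" if "r \<in> R" for r using R S_subset[OF \<Delta>] that by (auto simp: right_transversal_def)
  define f where "f \<gamma> = cinner (\<pi> \<gamma> (P\<^sub>0 k)) (\<pi> a l)" for \<gamma>
  let ?A = "of_nat (idx \<Delta>) * cinner (V\<^sub>0 \<Delta> k) (V\<^sub>0 \<Delta> (\<pi> a l))"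
  let ?g = "\<lambda>r. of_nat (idx \<Delta>') * cinner (V\<^sub>0 \<Delta>' k) (V\<^sub>0 \<Delta>' (\<pi> r (\<pi> a l)))"
  have "(f has_sum ?A) \<Delta>" unfolding f_def by (rule V\<^sub>0_cinner_has_sum[OF \<Delta> k a l])
  then have "((\<lambda>p. f (case p of (r, \<gamma>) \<Rightarrow> inv r \<otimes> \<gamma>)) has_sum ?A) (R \<times> \<Delta>')"
    using has_sum_reindex_bij_betw[OF right_transversal_bij_inv[OF S_subgroup[OF \<Delta>'] S_subgroup[OF \<Delta>] sub R], of f]
    by blast
  then have "(?g has_sum ?A) R"
  proof (rule has_sum_SigmaD, unfold prod.case)
    fix r assume r: "r \<in> R"
    have c: "r \<in> carrier G" "a \<in> carrier G" using RD[OF r] a \<Gamma>_carrier by auto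
    have "((\<lambda>\<gamma>. cinner (\<pi> \<gamma> (P\<^sub>0 k)) (\<pi> (r \<otimes> a) l)) has_sum ?g r) \<Delta>'"
      using V\<^sub>0_cinner_has_sum[OF \<Delta>' k subgroup.m_closed[OF \<Gamma>_subgroup RD[OF r] a] l] by (simp add: \<pi>_mult c)
    then show "((\<lambda>\<gamma>. f (inv r \<otimes> \<gamma>)) has_sum ?g r) \<Delta>'"
      by (rule has_sum_cong[THEN iffD1, rotated])
         (use c S_carrier[OF \<Delta>'] in \<open>simp add: f_def \<pi>_mult \<pi>_adjoint[of "inv r"]\<close>)
  qed
  then have "?A = (\<Sum>r\<in>R. ?g r)" using finR by (simp add: has_sum_finite_iff)
  also have "\<dots> = of_nat (idx \<Delta>') * cinner (V\<^sub>0 \<Delta>' k) (V\<^sub>0 \<Delta> (\<pi> a l))"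
  proof -
    have u: "\<pi> a l \<in> conv\<^sub>0"
      by (rule conv\<^sub>0_translate[OF _ a])
         (use l L_subset_conv translate_P\<^sub>0_L_conv[of \<one> l] in \<open>simp add: conv\<^sub>0_def \<pi>_one\<close>)
    have "V\<^sub>0 \<Delta> (\<pi> a l) = (\<Sum>r\<in>R. V\<^sub>0 \<Delta>' (\<pi> r (\<pi> a l)))"
      unfolding V\<^sub>0_refine[OF \<Delta> \<Delta>' sub R u] by (intro V\<^sub>0_sum[OF \<Delta>'] conv\<^sub>0_translate u RD)
    then show ?thesis by (simp add: cinner_sum_right sum_distrib_left)
  qed
  \<comment> \<open>The two normalisations differ by this factor, the only source of the index in
    the claim.\<close>
  also have "idx \<Delta>' = idx \<Delta> * index G \<Delta> \<Delta>'"
    by (rule index_mult[OF S_subgroup[OF \<Delta>'] S_subgroup[OF \<Delta>] sub R \<Gamma>_subgroup S_subset[OF \<Delta>]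
          bspec[OF reps \<Delta>]])
  finally have "of_nat (idx \<Delta>) * cinner (V\<^sub>0 \<Delta> k) (V\<^sub>0 \<Delta> (\<pi> a l)) =
      of_nat (idx \<Delta>) * (of_nat (index G \<Delta> \<Delta>') * cinner (V\<^sub>0 \<Delta>' k) (V\<^sub>0 \<Delta> (\<pi> a l)))"
    by (simp only: of_nat_mult mult.assoc)
  then show ?thesis using idx_pos[OF \<Delta>] by simp
qed

text \<open>Orthogonality to level \<Delta> need only be tested on translates of \<open>L\<close>,
  the vectors treated in \<open>V\<^sub>0_cinner_refine\<close>.\<close>

lemma V\<^sub>0_spanned:
  assumes "\<Delta> \<in> S" "h \<in> conv\<^sub>0"
  shows "V\<^sub>0 \<Delta> h = (\<Sum>i=1..idx \<Delta>. V\<^sub>0 \<Delta> (\<pi> (s \<Delta> i) (entry \<Delta> i (coeff \<Delta> (P\<^sub>0 h)))))"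
proof -
  have "V\<^sub>0 \<Delta> h = V\<^sub>0 \<Delta> (assemble \<Delta> (\<lambda>i. entry \<Delta> i (coeff \<Delta> (P\<^sub>0 h))))"
    using V\<^sub>0_coeff[OF assms] assemble_entry[OF assms(1) coeff_P\<^sub>0_in_level[OF assms]] by simp
  also have "\<dots> = (\<Sum>i=1..idx \<Delta>. V\<^sub>0 \<Delta> (\<pi> (s \<Delta> i) (entry \<Delta> i (coeff \<Delta> (P\<^sub>0 h)))))"
    unfolding assemble_def
    by (intro V\<^sub>0_sum assms level_subset_conv\<^sub>0[OF assms(1)] rep_L_in_level entry_in_L)
  finally show ?thesis .
qed

lemma index_S_pos:
  assumes "\<Delta> \<in> S" "\<Delta>' \<in> S" "\<Delta>' \<subseteq> \<Delta>"
  shows "0 < index G \<Delta> \<Delta>'"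
proof -
  obtain R where "right_transversal G \<Delta> \<Delta>' R" using right_transversal_exists by blast
  then have "idx \<Delta>' = idx \<Delta> * index G \<Delta> \<Delta>'"
    by (rule index_mult[OF S_subgroup[OF assms(2)] S_subgroup[OF assms(1)] assms(3) _ \<Gamma>_subgroup
          S_subset[OF assms(1)] bspec[OF reps assms(1)]])
  then show ?thesis using idx_pos[OF assms(2)] by (metis gr0I mult_0_right less_irrefl)
qed

text \<open>The index stands on the left, so that the expression has the shape of
  \<open>hecke_operator\<close>.\<close>

lemma proj_V\<^sub>0:
  assumes \<Delta>: "\<Delta> \<in> S" and \<Delta>': "\<Delta>' \<in> S" and sub: "\<Delta>' \<subseteq> \<Delta>" and k: "k \<in> conv\<^sub>0"
  shows "scaleC (of_nat (index G \<Delta> \<Delta>')) (proj (V\<^sub>0 \<Delta> ` conv\<^sub>0) (V\<^sub>0 \<Delta>' k)) = V\<^sub>0 \<Delta> k"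
proof -
  let ?m = "of_nat (index G \<Delta> \<Delta>') :: complex"
  have m: "?m \<noteq> 0" using index_S_pos[OF \<Delta> \<Delta>' sub] by simp
  have "proj (V\<^sub>0 \<Delta> ` conv\<^sub>0) (V\<^sub>0 \<Delta>' k) = scaleC (1 / ?m) (V\<^sub>0 \<Delta> k)"
  proof (rule proj_eqI[OF csubspace_V\<^sub>0[OF \<Delta>]])
    show "scaleC (1 / ?m) (V\<^sub>0 \<Delta> k) \<in> V\<^sub>0 \<Delta> ` conv\<^sub>0"
      by (intro csubspace_scaleC csubspace_V\<^sub>0 \<Delta> imageI k)
    fix z assume "z \<in> V\<^sub>0 \<Delta> ` conv\<^sub>0"
    then obtain h where h: "h \<in> conv\<^sub>0" "z = V\<^sub>0 \<Delta> h" by blast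
    have "cinner (V\<^sub>0 \<Delta>' k) (V\<^sub>0 \<Delta> (\<pi> (s \<Delta> i) l)) = cinner (scaleC (1 / ?m) (V\<^sub>0 \<Delta> k)) (V\<^sub>0 \<Delta> (\<pi> (s \<Delta> i) l))"
      if "i \<in> {1..idx \<Delta>}" "l \<in> L" for i l
      using V\<^sub>0_cinner_refine[OF \<Delta> \<Delta>' sub k rep_in_\<Gamma>[OF \<Delta> that(1)] that(2)] m
      by (simp add: cinner_scaleC_left field_simps)
    then have "cinner (V\<^sub>0 \<Delta>' k) z = cinner (scaleC (1 / ?m) (V\<^sub>0 \<Delta> k)) z"
      unfolding h(2) V\<^sub>0_spanned[OF \<Delta> h(1)] cinner_sum_right by (intro sum.cong refl) (simp add: entry_in_L)
    then show "cinner (V\<^sub>0 \<Delta>' k - scaleC (1 / ?m) (V\<^sub>0 \<Delta> k)) z = 0" by (simp add: cinner_diff_left)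
  qed
  then show ?thesis using m by (simp add: scaleC_scaleC)
qed

text \<open>The vector is rewritten at level \<open>conj_meet G \<Delta> (inv \<sigma>)\<close>,
  moved by \<sigma> to level \<open>conj_meet G \<Delta> \<sigma>\<close>, and projected back to
  \<Delta>, where the index cancels. All translates of \<open>P\<^sub>0 z\<close> are admissible,
  being sums of translates of \<open>P\<^sub>0 x\<close> with \<open>x\<close> in a level
  space.\<close>

lemma hecke_operator_V\<^sub>0:
  assumes \<Delta>: "\<Delta> \<in> S" and \<sigma>: "\<sigma> \<in> carrier G" and x: "x \<in> level \<Delta>"
    and R: "right_transversal G \<Delta> (conj_meet G \<Delta> (inv \<sigma>)) R"
  shows "\<pi> \<sigma> (P\<^sub>0 (\<Sum>r\<in>R. \<pi> r x)) \<in> conv\<^sub>0"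
    and "hecke_operator G \<iota> \<Phi>\<^sub>0 (V\<^sub>0 \<Delta> ` conv\<^sub>0) \<Delta> \<sigma> (V\<^sub>0 \<Delta> x) = V\<^sub>0 \<Delta> (\<pi> \<sigma> (P\<^sub>0 (\<Sum>r\<in>R. \<pi> r x)))"
proof -
  let ?\<Delta>\<^sub>1 = "conj_meet G \<Delta> (inv \<sigma>)" and ?\<Delta>\<^sub>2 = "conj_meet G \<Delta> \<sigma>"
  have sub: "conj_meet G \<Delta> g \<subseteq> \<Delta>" for g by (simp add: conj_meet_def)
  have \<Delta>\<^sub>1: "?\<Delta>\<^sub>1 \<in> S" "?\<Delta>\<^sub>1 \<subseteq> \<Delta>" and \<Delta>\<^sub>2: "?\<Delta>\<^sub>2 \<in> S" "?\<Delta>\<^sub>2 \<subseteq> \<Delta>"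
    by (intro S_conj_meet sub \<Delta> \<sigma> inv_closed)+
  have R\<Gamma>: "r \<in> \<Gamma>" if "r \<in> R" for r using R S_subset[OF \<Delta>] that by (auto simp: right_transversal_def)
  then have Rc: "r \<in> carrier G" if "r \<in> R" for r using that \<Gamma>_carrier by blast
  define z where "z = (\<Sum>r\<in>R. \<pi> r x)"
  have x0: "x \<in> conv\<^sub>0" by (rule level_subset_conv\<^sub>0[OF \<Delta> x])
  have z: "z \<in> conv\<^sub>0" unfolding z_def by (intro csubspace_sum csubspace_conv\<^sub>0 conv\<^sub>0_translate x0 R\<Gamma>)
  have P\<^sub>0z: "\<pi> g (P\<^sub>0 z) = (\<Sum>r\<in>R. \<pi> (g \<otimes> r) (P\<^sub>0 x))" if "g \<in> carrier G" for g
    using that Rc by (simp add: z_def proj_sum[OF H\<^sub>0_closed] P\<^sub>0_\<pi> \<pi>_sum \<pi>_mult)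
  have trans: "\<pi> g (P\<^sub>0 z) \<in> conv\<^sub>0" if "g \<in> carrier G" for g
    unfolding P\<^sub>0z[OF that]
    by (intro csubspace_sum csubspace_conv\<^sub>0 translate_P\<^sub>0_level_conv\<^sub>0[OF _ \<Delta> x] m_closed that Rc)
  then have P\<^sub>0z_conv: "P\<^sub>0 z \<in> conv\<^sub>0" using trans[of \<one>] by (simp add: \<pi>_one)
  show "\<pi> \<sigma> (P\<^sub>0 (\<Sum>r\<in>R. \<pi> r x)) \<in> conv\<^sub>0" using trans[OF \<sigma>] by (simp add: z_def)
  have "V\<^sub>0 \<Delta> x = V\<^sub>0 ?\<Delta>\<^sub>1 z" unfolding z_def by (rule V\<^sub>0_refine[OF \<Delta> \<Delta>\<^sub>1 R x0])
  \<comment> \<open>The class depends on \<open>z\<close> only through \<open>P\<^sub>0 z\<close>,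
    and for \<open>P\<^sub>0 z\<close> the side condition of \<open>virtual_rep\<close> on
    \<open>\<pi> \<sigma> h\<close> is known.\<close>
  also have "\<dots> = V\<^sub>0 ?\<Delta>\<^sub>1 (P\<^sub>0 z)"
    using V\<^sub>0_eq_iff[OF \<Delta>\<^sub>1(1) z P\<^sub>0z_conv] by (simp add: P\<^sub>0_idem)
  finally have Vx: "V\<^sub>0 \<Delta> x = V\<^sub>0 ?\<Delta>\<^sub>1 (P\<^sub>0 z)" .
  have conj: "conj_subgroup G \<sigma> ?\<Delta>\<^sub>1 = ?\<Delta>\<^sub>2" by (rule conj_subgroup_conj_meet_inv[OF S_subgroup[OF \<Delta>] \<sigma>])
  have "\<forall>g\<in>carrier G. \<forall>\<Delta>\<in>S. let \<Delta>\<^sub>1 = conj_meet G \<Delta> (inv g) in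
        \<forall>h\<in>sum_domain G \<Gamma> \<pi> L s \<pi>\<^sub>0 \<Delta>\<^sub>1.
          V\<^sub>0 \<Delta>\<^sub>1 h \<in> virtual_level G \<Gamma> \<pi> L s \<pi>\<^sub>0 V\<^sub>0 \<Delta> \<and>
          \<pi> g h \<in> sum_domain G \<Gamma> \<pi> L s \<pi>\<^sub>0 (conj_subgroup G g \<Delta>\<^sub>1) \<longrightarrow>
            \<Phi>\<^sub>0 (\<iota> g) (V\<^sub>0 \<Delta>\<^sub>1 h) = V\<^sub>0 (conj_subgroup G g \<Delta>\<^sub>1) (\<pi> g h)"
    using rep\<^sub>0 unfolding virtual_rep_def by (elim conjE)
  then have "\<forall>h\<in>sum_domain G \<Gamma> \<pi> L s \<pi>\<^sub>0 ?\<Delta>\<^sub>1.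
          V\<^sub>0 ?\<Delta>\<^sub>1 h \<in> virtual_level G \<Gamma> \<pi> L s \<pi>\<^sub>0 V\<^sub>0 \<Delta> \<and>
          \<pi> \<sigma> h \<in> sum_domain G \<Gamma> \<pi> L s \<pi>\<^sub>0 (conj_subgroup G \<sigma> ?\<Delta>\<^sub>1) \<longrightarrow>
            \<Phi>\<^sub>0 (\<iota> \<sigma>) (V\<^sub>0 ?\<Delta>\<^sub>1 h) = V\<^sub>0 (conj_subgroup G \<sigma> ?\<Delta>\<^sub>1) (\<pi> \<sigma> h)"
    using \<sigma> \<Delta> unfolding Let_def by blast
  then have "V\<^sub>0 ?\<Delta>\<^sub>1 (P\<^sub>0 z) \<in> V\<^sub>0 \<Delta> ` conv\<^sub>0 \<Longrightarrow>
      \<Phi>\<^sub>0 (\<iota> \<sigma>) (V\<^sub>0 ?\<Delta>\<^sub>1 (P\<^sub>0 z)) = V\<^sub>0 ?\<Delta>\<^sub>2 (\<pi> \<sigma> (P\<^sub>0 z))"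
    unfolding conj virtual_level_def sum_domain_\<pi>\<^sub>0[OF \<Delta>] sum_domain_\<pi>\<^sub>0[OF \<Delta>\<^sub>1(1)] sum_domain_\<pi>\<^sub>0[OF \<Delta>\<^sub>2(1)]
    using P\<^sub>0z_conv trans[OF \<sigma>] by blast
  \<comment> \<open>The other side condition, membership in level \<Delta>, holds because the vector
    is \<open>V\<^sub>0 \<Delta> x\<close>.\<close>
  then have \<Phi>: "\<Phi>\<^sub>0 (\<iota> \<sigma>) (V\<^sub>0 \<Delta> x) = V\<^sub>0 ?\<Delta>\<^sub>2 (\<pi> \<sigma> (P\<^sub>0 z))"
    unfolding Vx[symmetric] using x0 by blast
  have "proj (V\<^sub>0 \<Delta> ` conv\<^sub>0) (V\<^sub>0 \<Delta> x) = V\<^sub>0 \<Delta> x"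
    by (rule proj_eqI[OF csubspace_V\<^sub>0[OF \<Delta>]]) (use x0 in simp_all)
  then show "hecke_operator G \<iota> \<Phi>\<^sub>0 (V\<^sub>0 \<Delta> ` conv\<^sub>0) \<Delta> \<sigma> (V\<^sub>0 \<Delta> x) = V\<^sub>0 \<Delta> (\<pi> \<sigma> (P\<^sub>0 (\<Sum>r\<in>R. \<pi> r x)))"
    unfolding hecke_operator_def z_def[symmetric]
    using \<Phi> proj_V\<^sub>0[OF \<Delta> \<Delta>\<^sub>2 trans[OF \<sigma>]] by simp
qed

subsection \<open>The extension by zero\<close>

abbreviation embedding where
  "embedding \<Delta> \<equiv> level_embedding (V\<^sub>0 \<Delta>) (V \<Delta>) conv\<^sub>0 H\<^sub>0"

text \<open>Well-definedness: representatives of the same vector have the same coefficient of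
  \<open>P\<^sub>0 h\<close>, and \<open>V \<Delta> (P\<^sub>0 h)\<close> depends on that
  coefficient alone.\<close>

lemma embedding_V\<^sub>0:
  assumes "\<Delta> \<in> S" "h \<in> conv\<^sub>0"
  shows "embedding \<Delta> (V\<^sub>0 \<Delta> h) = V \<Delta> (P\<^sub>0 h)"
  unfolding level_embedding_def
proof (rule the_equality)
  fix w assume "\<exists>k\<in>conv\<^sub>0. V\<^sub>0 \<Delta> h = V\<^sub>0 \<Delta> k \<and> w = V \<Delta> (P\<^sub>0 k)"
  then obtain k where k: "k \<in> conv\<^sub>0" "V\<^sub>0 \<Delta> h = V\<^sub>0 \<Delta> k" "w = V \<Delta> (P\<^sub>0 k)" by blast
  then have "coeff \<Delta> (P\<^sub>0 h) = coeff \<Delta> (P\<^sub>0 k)" using V\<^sub>0_eq_iff[OF assms] by blast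
  then show "w = V \<Delta> (P\<^sub>0 h)"
    using V_eq_iff[OF assms(1), of "P\<^sub>0 h" "P\<^sub>0 k"] assms(2) k by (simp add: conv\<^sub>0_def)
qed (use assms in blast)

lemma embedding_inj:
  assumes "\<Delta> \<in> S"
  shows "inj_on (embedding \<Delta>) (V\<^sub>0 \<Delta> ` conv\<^sub>0)"
proof (rule inj_onI, elim imageE)
  fix u v h k
  assume eq: "embedding \<Delta> u = embedding \<Delta> v" and h: "h \<in> conv\<^sub>0" "u = V\<^sub>0 \<Delta> h"
    and k: "k \<in> conv\<^sub>0" "v = V\<^sub>0 \<Delta> k"
  have "V \<Delta> (P\<^sub>0 h) = V \<Delta> (P\<^sub>0 k)" using eq h k by (simp add: embedding_V\<^sub>0 assms)
  then have "coeff \<Delta> (P\<^sub>0 h) = coeff \<Delta> (P\<^sub>0 k)"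
    using V_eq_iff[OF assms, of "P\<^sub>0 h" "P\<^sub>0 k"] h k by (simp add: conv\<^sub>0_def)
  then show "u = v" using V\<^sub>0_eq_iff[OF assms h(1) k(1)] h k by simp
qed

lemma embedding_image: "\<Delta> \<in> S \<Longrightarrow> embedding \<Delta> ` V\<^sub>0 \<Delta> ` conv\<^sub>0 = (\<lambda>h. V \<Delta> (P\<^sub>0 h)) ` conv\<^sub>0"
  by (simp add: image_image embedding_V\<^sub>0)

text \<open>In terms of coefficients, \<open>x\<close> minus
  \<open>coeff \<Delta> (P\<^sub>0 x)\<close> has to be orthogonal to the vectors fixed by
  \<open>P\<^sub>0\<close> followed by \<open>coeff \<Delta>\<close>; this is self-adjointness on
  the level space.\<close>

lemma proj_embedding_image:
  assumes \<Delta>: "\<Delta> \<in> S" and x: "x \<in> level \<Delta>"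
  shows "proj (embedding \<Delta> ` V\<^sub>0 \<Delta> ` conv\<^sub>0) (V \<Delta> x) = V \<Delta> (P\<^sub>0 x)"
  unfolding embedding_image[OF \<Delta>]
proof (rule proj_eqI)
  have inner: "cinner (V \<Delta> (P\<^sub>0 h)) (V \<Delta> (P\<^sub>0 k)) = cinner (coeff \<Delta> (P\<^sub>0 h)) (coeff \<Delta> (P\<^sub>0 k)) / of_nat (idx \<Delta>)"
    if "h \<in> conv\<^sub>0" "k \<in> conv\<^sub>0" for h k
    using that by (simp add: V_cinner[OF \<Delta>] conv\<^sub>0_def)
  show "csubspace ((\<lambda>h. V \<Delta> (P\<^sub>0 h)) ` conv\<^sub>0)"
    by (rule csubspace_scaled_isometry_image[OF csubspace_conv\<^sub>0 idx_pos[OF \<Delta>] coeff_P\<^sub>0_add[OF \<Delta>]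
          coeff_P\<^sub>0_scaleC[OF \<Delta>] inner])
  have x0: "x \<in> conv\<^sub>0" by (rule level_subset_conv\<^sub>0[OF \<Delta> x])
  then show "V \<Delta> (P\<^sub>0 x) \<in> (\<lambda>h. V \<Delta> (P\<^sub>0 h)) ` conv\<^sub>0" by blast
  fix z assume "z \<in> (\<lambda>h. V \<Delta> (P\<^sub>0 h)) ` conv\<^sub>0"
  then obtain h where h: "h \<in> conv\<^sub>0" "z = V \<Delta> (P\<^sub>0 h)" by blast
  define a where "a = coeff \<Delta> (P\<^sub>0 h)"
  have "cinner (coeff \<Delta> (P\<^sub>0 x)) a = cinner x (coeff \<Delta> (P\<^sub>0 a))"
    unfolding a_def by (rule coeff_P\<^sub>0_selfadjoint[OF \<Delta> x coeff_P\<^sub>0_in_level[OF \<Delta> h(1)]])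
  also have "\<dots> = cinner (coeff \<Delta> x) a"
    unfolding a_def coeff_P\<^sub>0_idem[OF \<Delta> h(1)] coeff_level[OF \<Delta> x] ..
  finally show "cinner (V \<Delta> x - V \<Delta> (P\<^sub>0 x)) z = 0"
    using x0 h by (simp add: cinner_diff_left V_cinner[OF \<Delta>] conv\<^sub>0_def a_def)
qed

lemma extend_by_zero_V:
  assumes \<Delta>: "\<Delta> \<in> S" and x: "x \<in> level \<Delta>"
  shows "extend_by_zero (embedding \<Delta>) (V\<^sub>0 \<Delta> ` conv\<^sub>0) A (V \<Delta> x) = embedding \<Delta> (A (V\<^sub>0 \<Delta> x))"
proof -
  have x0: "x \<in> conv\<^sub>0" by (rule level_subset_conv\<^sub>0[OF \<Delta> x])
  have "inv_into (V\<^sub>0 \<Delta> ` conv\<^sub>0) (embedding \<Delta>) (V \<Delta> (P\<^sub>0 x)) = V\<^sub>0 \<Delta> x"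
    unfolding embedding_V\<^sub>0[OF \<Delta> x0, symmetric] by (rule inv_into_f_f[OF embedding_inj[OF \<Delta>]]) (use x0 in blast)
  then show ?thesis by (simp add: extend_by_zero_def proj_embedding_image[OF \<Delta> x])
qed

lemma extended_hecke_operator:
  assumes \<Delta>: "\<Delta> \<in> S" and \<sigma>: "\<sigma> \<in> carrier G" and x: "x \<in> level \<Delta>"
    and R: "right_transversal G \<Delta> (conj_meet G \<Delta> (inv \<sigma>)) R"
  shows "extend_by_zero (embedding \<Delta>) (V\<^sub>0 \<Delta> ` conv\<^sub>0) (hecke_operator G \<iota> \<Phi>\<^sub>0 (V\<^sub>0 \<Delta> ` conv\<^sub>0) \<Delta> \<sigma>) (V \<Delta> x) =
    V \<Delta> (\<pi> \<sigma> (P\<^sub>0 (\<Sum>r\<in>R. \<pi> r x)))"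
  unfolding extend_by_zero_V[OF \<Delta> x] hecke_operator_V\<^sub>0(2)[OF assms] embedding_V\<^sub>0[OF \<Delta> hecke_operator_V\<^sub>0(1)[OF assms]]
  by (simp add: P\<^sub>0_\<pi> P\<^sub>0_idem \<sigma>)

end

section \<open>Matrix entries of the Hecke operators\<close>

lemma delta_tensor_sum: "delta_tensor c (sum f A) d = (\<Sum>i\<in>A. delta_tensor c (f i) d)"
  by (simp add: delta_tensor_def)

lemma sum_delta_tensor_at:
  assumes "inj_on c I" "finite I" "j \<in> I"
  shows "(\<Sum>i\<in>I. delta_tensor (c i) (f i) (c j)) = f j"
proof -
  have "(\<Sum>i\<in>I. delta_tensor (c i) (f i) (c j)) = (\<Sum>i\<in>I. if i = j then f i else 0)"
    using assms by (intro sum.cong refl) (auto simp: delta_tensor_def inj_on_def)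
  then show ?thesis using assms by simp
qed

context virtual_setting
begin

text \<open>Each piece of the finite partition is a right coset of a member of the family, where the
  Hilbert-Schmidt clause of \<open>technical_condition\<close> applies.\<close>

lemma hecke_matrix_entry:
  assumes \<Delta>: "\<Delta> \<in> S" and \<sigma>: "\<sigma> \<in> carrier G" and i: "i \<in> {1..idx \<Delta>}" and j: "j \<in> {1..idx \<Delta>}"
  shows "\<exists>B. hs_has_sum (\<lambda>\<theta>. compress P (\<pi>\<^sub>0 \<theta>))
    ((inv (s \<Delta> i) <# ((\<Delta> #> \<sigma>) <#> \<Delta>)) #> s \<Delta> j) B"
proof -
  obtain R where R: "right_transversal G \<Delta> (conj_meet G \<Delta> (inv \<sigma>)) R"
    using right_transversal_exists by blast
  let ?J = "conj_meet G \<Delta> (inv (s \<Delta> i))"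
  have J: "?J \<in> S" by (intro S_conj_meet \<Delta> inv_closed rep_carrier i)
  have "finite R"
    by (rule finite_right_transversal[OF R S_finite_index[OF S_conj_meet[OF \<Delta> inv_closed[OF \<sigma>]]] S_subset[OF \<Delta>]])
  then obtain K where K: "finite K" "disjoint K" "\<Union>K = (inv (s \<Delta> i) <# ((\<Delta> #> \<sigma>) <#> \<Delta>)) #> s \<Delta> j"
      "\<forall>Y\<in>K. \<exists>g\<in>carrier G. Y = ?J #> g"
    using shifted_double_coset_partition[OF S_subgroup[OF \<Delta>] \<sigma> R \<Gamma>_subgroup S_subset[OF \<Delta>]
        rep_in_\<Gamma>[OF \<Delta> i] rep_carrier[OF \<Delta> j] S_finite_index[OF J]] by metis
  show ?thesis
    unfolding K(3)[symmetric]
  proof (rule hs_has_sum_finite_Union[OF K(1) _ K(2)])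
    fix Y assume "Y \<in> K"
    then obtain g where "g \<in> carrier G" "Y = ?J #> g" using K(4) by blast
    then show "\<exists>T. hs_has_sum (\<lambda>\<theta>. compress P (\<pi>\<^sub>0 \<theta>)) Y T" using TC_hs_sum[OF _ J] by simp
  qed
qed

text \<open>Both sides are the sum over \<gamma> of the \<open>i\<close>-th entries of the
  translates. Expanding \<open>x\<close> in its entries and commuting \<open>P\<^sub>0\<close> past
  \<pi> turns each term into a compressed operator at \<open>t j \<gamma> r\<close>, and the pairs
  of \<gamma> and \<open>r\<close> parametrise the translated double coset without
  repetition.\<close>

lemma hecke_matrix:
  assumes \<Delta>: "\<Delta> \<in> S" and \<sigma>: "\<sigma> \<in> carrier G" and x: "x \<in> level \<Delta>"
    and R: "right_transversal G \<Delta> (conj_meet G \<Delta> (inv \<sigma>)) R" and i: "i \<in> {1..idx \<Delta>}"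
    and B: "\<And>j. j \<in> {1..idx \<Delta>} \<Longrightarrow> hs_has_sum (\<lambda>\<theta>. compress P (\<pi>\<^sub>0 \<theta>))
      ((inv (s \<Delta> i) <# ((\<Delta> #> \<sigma>) <#> \<Delta>)) #> s \<Delta> j) (B j)"
  shows "entry \<Delta> i (coeff \<Delta> (\<pi> \<sigma> (P\<^sub>0 (\<Sum>r\<in>R. \<pi> r x)))) = (\<Sum>j=1..idx \<Delta>. B j (entry \<Delta> j x))"
proof (rule has_sum_unique)
  let ?y = "\<pi> \<sigma> (P\<^sub>0 (\<Sum>r\<in>R. \<pi> r x))"
  have "?y \<in> conv" using hecke_operator_V\<^sub>0(1)[OF \<Delta> \<sigma> x R] by (simp add: conv\<^sub>0_def)
  then show "((\<lambda>\<gamma>. entry \<Delta> i (\<pi> \<gamma> ?y)) has_sum entry \<Delta> i (coeff \<Delta> ?y)) \<Delta>"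
    by (rule entry_coeff[OF _ \<Delta> i])
  have Rc: "r \<in> carrier G" if "r \<in> R" for r
    using R S_carrier[OF \<Delta>] that by (auto simp: right_transversal_def)
  have finR: "finite R"
    by (rule finite_right_transversal[OF R S_finite_index[OF S_conj_meet[OF \<Delta> inv_closed[OF \<sigma>]]] S_subset[OF \<Delta>]])
  have ic: "s \<Delta> i \<in> carrier G" by (rule rep_carrier[OF \<Delta> i])
  define t where "t j \<gamma> r = inv (s \<Delta> i) \<otimes> \<gamma> \<otimes> (\<sigma> \<otimes> r \<otimes> s \<Delta> j)" for j \<gamma> r
  let ?f = "\<lambda>j \<gamma> r. compress P (\<pi>\<^sub>0 (t j \<gamma> r)) (entry \<Delta> j x)"
  have "((\<lambda>\<gamma>. \<Sum>r\<in>R. ?f j \<gamma> r) has_sum B j (entry \<Delta> j x)) \<Delta>" if j: "j \<in> {1..idx \<Delta>}" for j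
  proof -
    have "((\<lambda>p. compress P (\<pi>\<^sub>0 (case p of (\<gamma>, r) \<Rightarrow> t j \<gamma> r)) (entry \<Delta> j x)) has_sum B j (entry \<Delta> j x)) (\<Delta> \<times> R)"
      unfolding t_def
      using hs_has_sum_has_sum[OF B[OF j], of "entry \<Delta> j x"]
        has_sum_reindex_bij_betw[OF shifted_double_coset_bij[OF S_subgroup[OF \<Delta>] \<sigma> R ic rep_carrier[OF \<Delta> j]],
          of "\<lambda>\<theta>. compress P (\<pi>\<^sub>0 \<theta>) (entry \<Delta> j x)"] by blast
    \<comment> \<open>The sum over pairs is iterated with the finite sum over \<open>R\<close>
      inside, as the sum over \<Delta> of the coefficient demands.\<close>
    then show ?thesis
      by (rule has_sum_SigmaD) (unfold prod.case, rule has_sum_finite[OF finR])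
  qed
  then have "((\<lambda>\<gamma>. \<Sum>j=1..idx \<Delta>. \<Sum>r\<in>R. ?f j \<gamma> r) has_sum (\<Sum>j=1..idx \<Delta>. B j (entry \<Delta> j x))) \<Delta>"
    by (rule has_sum_finite_sum)
  then show "((\<lambda>\<gamma>. entry \<Delta> i (\<pi> \<gamma> ?y)) has_sum (\<Sum>j=1..idx \<Delta>. B j (entry \<Delta> j x))) \<Delta>"
  proof (rule has_sum_cong[THEN iffD1, rotated])
    fix \<gamma> assume "\<gamma> \<in> \<Delta>"
    then have \<gamma>: "\<gamma> \<in> carrier G" using S_carrier[OF \<Delta>] by blast
    have f: "?f j \<gamma> r = entry \<Delta> i (\<pi> \<gamma> (\<pi> \<sigma> (P\<^sub>0 (\<pi> r (\<pi> (s \<Delta> j) (entry \<Delta> j x))))))"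
      if "j \<in> {1..idx \<Delta>}" "r \<in> R" for j r
      using rep_carrier[OF \<Delta> that(1)] Rc[OF that(2)] ic \<gamma> \<sigma>
      by (simp add: t_def compress_\<pi>\<^sub>0 entry_in_L entry_def[of \<Delta> i] P\<^sub>0_\<pi> \<pi>_mult)
    have "?y = (\<Sum>j=1..idx \<Delta>. \<Sum>r\<in>R. \<pi> \<sigma> (P\<^sub>0 (\<pi> r (\<pi> (s \<Delta> j) (entry \<Delta> j x)))))"
    proof -
      have "?y = (\<Sum>r\<in>R. \<pi> \<sigma> (P\<^sub>0 (\<pi> r x)))" by (simp add: proj_sum[OF H\<^sub>0_closed] \<pi>_sum \<sigma>)
      also have "\<dots> = (\<Sum>r\<in>R. \<Sum>j=1..idx \<Delta>. \<pi> \<sigma> (P\<^sub>0 (\<pi> r (\<pi> (s \<Delta> j) (entry \<Delta> j x)))))"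
        using Rc \<sigma>
        by (intro sum.cong refl, subst assemble_entry[OF \<Delta> x, symmetric])
           (simp add: assemble_def \<pi>_sum proj_sum[OF H\<^sub>0_closed])
      also have "\<dots> = (\<Sum>j=1..idx \<Delta>. \<Sum>r\<in>R. \<pi> \<sigma> (P\<^sub>0 (\<pi> r (\<pi> (s \<Delta> j) (entry \<Delta> j x)))))"
        by (rule sum.swap)
      finally show ?thesis .
    qed
    then have "entry \<Delta> i (\<pi> \<gamma> ?y) =
        (\<Sum>j=1..idx \<Delta>. \<Sum>r\<in>R. entry \<Delta> i (\<pi> \<gamma> (\<pi> \<sigma> (P\<^sub>0 (\<pi> r (\<pi> (s \<Delta> j) (entry \<Delta> j x)))))))"
      by (simp only: \<pi>_sum[OF \<gamma>] entry_sum[OF \<Delta> i])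
    also have "\<dots> = (\<Sum>j=1..idx \<Delta>. \<Sum>r\<in>R. ?f j \<gamma> r)"
      by (intro sum.cong refl) (rule f[symmetric])
    finally show "(\<Sum>j=1..idx \<Delta>. \<Sum>r\<in>R. ?f j \<gamma> r) = entry \<Delta> i (\<pi> \<gamma> ?y)" ..
  qed
qed

subsection \<open>The level space as a tensor product\<close>

text \<open>The square root compensates the division by \<open>idx \<Delta>\<close> in the scalar
  product of virtual vectors. A vector is reached through an arbitrary preimage under
  \<open>V \<Delta>\<close>, which is harmless because the coefficient does not depend on
  it.\<close>

definition coordinates :: "'g set \<Rightarrow> 'l \<Rightarrow> 'g set \<Rightarrow> 'a" where
  "coordinates \<Delta> w = (\<lambda>c. \<Sum>i=1..idx \<Delta>. delta_tensor (\<Delta> #> s \<Delta> i)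
     ((1 / sqrt (real (idx \<Delta>))) *\<^sub>R entry \<Delta> i (coeff \<Delta> (inv_into conv (V \<Delta>) w))) c)"

lemma coordinates_V:
  assumes "\<Delta> \<in> S" "h \<in> conv"
  shows "coordinates \<Delta> (V \<Delta> h) = (\<lambda>c. \<Sum>i=1..idx \<Delta>. delta_tensor (\<Delta> #> s \<Delta> i)
     ((1 / sqrt (real (idx \<Delta>))) *\<^sub>R entry \<Delta> i (coeff \<Delta> h)) c)"
proof -
  let ?h = "inv_into conv (V \<Delta>) (V \<Delta> h)"
  have "V \<Delta> ?h = V \<Delta> h" "?h \<in> conv" using assms(2) by (simp_all add: f_inv_into_f inv_into_into)
  then have "coeff \<Delta> ?h = coeff \<Delta> h" using V_eq_iff[OF assms(1) _ assms(2)] by blast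
  then show ?thesis by (simp add: coordinates_def)
qed

lemma rep_coset_bij: "\<Delta> \<in> S \<Longrightarrow> bij_betw (\<lambda>i. \<Delta> #> s \<Delta> i) {1..idx \<Delta>} (rcosets\<^bsub>G\<lparr>carrier := \<Gamma>\<rparr>\<^esub> \<Delta>)"
  using reps unfolding coset_reps_def by blast

lemma coordinates_at:
  assumes "\<Delta> \<in> S" "h \<in> conv" "j \<in> {1..idx \<Delta>}"
  shows "coordinates \<Delta> (V \<Delta> h) (\<Delta> #> s \<Delta> j) = (1 / sqrt (real (idx \<Delta>))) *\<^sub>R entry \<Delta> j (coeff \<Delta> h)"
  unfolding coordinates_V[OF assms(1,2)]
  by (rule sum_delta_tensor_at[OF bij_betw_imp_inj_on[OF rep_coset_bij[OF assms(1)]] finite_atLeastAtMost assms(3)])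

lemma coordinates_outside:
  assumes "\<Delta> \<in> S" "h \<in> conv" "c \<notin> rcosets\<^bsub>G\<lparr>carrier := \<Gamma>\<rparr>\<^esub> \<Delta>"
  shows "coordinates \<Delta> (V \<Delta> h) c = 0"
proof -
  have "c \<noteq> \<Delta> #> s \<Delta> i" if "i \<in> {1..idx \<Delta>}" for i
    using assms(3) bij_betwE[OF rep_coset_bij[OF assms(1)]] that by blast
  then show ?thesis
    unfolding coordinates_V[OF assms(1,2)] delta_tensor_def by (intro sum.neutral ballI) simp
qed

lemma coordinates_in_L:
  assumes "\<Delta> \<in> S" "h \<in> conv" "c \<in> rcosets\<^bsub>G\<lparr>carrier := \<Gamma>\<rparr>\<^esub> \<Delta>"
  shows "coordinates \<Delta> (V \<Delta> h) c \<in> L"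
proof -
  obtain j where "j \<in> {1..idx \<Delta>}" "c = \<Delta> #> s \<Delta> j"
    using assms(3) bij_betw_imp_surj_on[OF rep_coset_bij[OF assms(1)]] by blast
  then show ?thesis
    using coordinates_at[OF assms(1,2)] by (simp add: csubspace_scaleR[OF L_csubspace] entry_in_L)
qed

text \<open>Every vector of the level is the class of its coefficient, which is such a sum; hence
  this formula determines the unitary.\<close>

lemma coordinates_assemble:
  assumes \<Delta>: "\<Delta> \<in> S" and l: "\<And>i. l i \<in> L"
  shows "coordinates \<Delta> (V \<Delta> (assemble \<Delta> l)) =
    (\<lambda>c. \<Sum>i=1..idx \<Delta>. delta_tensor (\<Delta> #> s \<Delta> i) ((1 / sqrt (real (idx \<Delta>))) *\<^sub>R l i) c)"
proof -
  have lev: "assemble \<Delta> l \<in> level \<Delta>" using l by (rule assemble_in_level)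
  show ?thesis
    unfolding coordinates_V[OF \<Delta> level_subset_conv[OF \<Delta> lev]] coeff_level[OF \<Delta> lev]
    using entry_assemble[where l = l, OF \<Delta> _ l] by (intro ext sum.cong refl) simp
qed

lemma coordinates_unitary:
  assumes \<Delta>: "\<Delta> \<in> S"
  shows "l2_unitary (V \<Delta> ` conv) (rcosets\<^bsub>G\<lparr>carrier := \<Gamma>\<rparr>\<^esub> \<Delta>) L (coordinates \<Delta>)"
proof -
  let ?I = "{1..idx \<Delta>}" and ?Q = "rcosets\<^bsub>G\<lparr>carrier := \<Gamma>\<rparr>\<^esub> \<Delta>"
  note bij = rep_coset_bij[OF \<Delta>] and finQ = S_finite_index[OF \<Delta>]
  have tens: "coordinates \<Delta> (V \<Delta> h) \<in> l2_tensor ?Q L" if "h \<in> conv" for h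
    using that finQ by (simp add: l2_tensor_def coordinates_in_L[OF \<Delta>] coordinates_outside[OF \<Delta>])
  have eqI: "u = v" if "u \<in> l2_tensor ?Q L" "v \<in> l2_tensor ?Q L"
    "\<And>j. j \<in> ?I \<Longrightarrow> u (\<Delta> #> s \<Delta> j) = v (\<Delta> #> s \<Delta> j)" for u v :: "'g set \<Rightarrow> 'a"
  proof
    fix c show "u c = v c"
    proof (cases "c \<in> ?Q")
      case True
      then obtain j where "j \<in> ?I" "c = \<Delta> #> s \<Delta> j" using bij_betw_imp_surj_on[OF bij] by blast
      then show ?thesis using that(3) by simp
    qed (use that(1,2) in \<open>simp add: l2_tensor_def\<close>)
  qed
  have add: "coordinates \<Delta> (u + v) = (\<lambda>c. coordinates \<Delta> u c + coordinates \<Delta> v c)"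
    if uv: "u \<in> V \<Delta> ` conv" "v \<in> V \<Delta> ` conv" for u v
  proof -
    obtain h k where hk: "h \<in> conv" "k \<in> conv" "u = V \<Delta> h" "v = V \<Delta> k" using uv by blast
    have "h + k \<in> conv" using hk by (intro csubspace_add csubspace_conv)
    then show ?thesis
      unfolding hk(3,4) V_add[OF \<Delta> hk(1,2), symmetric]
      by (simp add: coordinates_V[OF \<Delta>] hk coeff_add[OF \<Delta>] entry_add[OF \<Delta>] scaleR_add_right
          sum.distrib[symmetric] delta_tensor_def if_distrib cong: if_cong)
  qed
  have scale: "coordinates \<Delta> (scaleC a u) = (\<lambda>c. scaleC a (coordinates \<Delta> u c))"
    if u: "u \<in> V \<Delta> ` conv" for a u
  proof -
    obtain h where h: "h \<in> conv" "u = V \<Delta> h" using u by blast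
    have ah: "scaleC a h \<in> conv" using h by (intro csubspace_scaleC csubspace_conv)
    have sR: "(r *\<^sub>R scaleC a y) = scaleC a (r *\<^sub>R y)" for r and y :: 'a
      by (simp add: scaleC_of_real[symmetric] scaleC_scaleC mult.commute)
    show ?thesis
      unfolding h(2) V_scaleC[OF \<Delta> h(1), symmetric] coordinates_V[OF \<Delta> ah] coordinates_V[OF \<Delta> h(1)]
        coeff_scaleC[OF \<Delta> h(1)] scaleC_sum_right
      by (intro ext sum.cong refl) (simp add: entry_scaleC[OF \<Delta>] sR delta_tensor_def)
  qed
  have inner: "l2_inner ?Q (coordinates \<Delta> u) (coordinates \<Delta> v) = cinner u v"
    if uv: "u \<in> V \<Delta> ` conv" "v \<in> V \<Delta> ` conv" for u v
  proof -
    obtain h k where hk: "h \<in> conv" "k \<in> conv" "u = V \<Delta> h" "v = V \<Delta> k" using uv by blast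
    have "l2_inner ?Q (coordinates \<Delta> u) (coordinates \<Delta> v) =
        (\<Sum>c\<in>?Q. cinner (coordinates \<Delta> u c) (coordinates \<Delta> v c))"
      by (simp add: l2_inner_def finQ)
    also have "\<dots> = (\<Sum>i=1..idx \<Delta>. cinner (coordinates \<Delta> u (\<Delta> #> s \<Delta> i)) (coordinates \<Delta> v (\<Delta> #> s \<Delta> i)))"
      by (rule sum.reindex_bij_betw[OF bij, symmetric])
    also have "\<dots> = (\<Sum>i=1..idx \<Delta>. cinner (entry \<Delta> i (coeff \<Delta> h)) (entry \<Delta> i (coeff \<Delta> k)) / of_nat (idx \<Delta>))"
    proof (intro sum.cong refl)
      fix i assume i: "i \<in> ?I"
      have sq: "complex_of_real (1 / sqrt (real (idx \<Delta>))) * complex_of_real (1 / sqrt (real (idx \<Delta>))) = 1 / of_nat (idx \<Delta>)"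
        unfolding of_real_mult[symmetric] by simp
      show "cinner (coordinates \<Delta> u (\<Delta> #> s \<Delta> i)) (coordinates \<Delta> v (\<Delta> #> s \<Delta> i)) =
          cinner (entry \<Delta> i (coeff \<Delta> h)) (entry \<Delta> i (coeff \<Delta> k)) / of_nat (idx \<Delta>)"
        unfolding hk(3,4) coordinates_at[OF \<Delta> hk(1) i] coordinates_at[OF \<Delta> hk(2) i]
          cinner_scaleR_left cinner_scaleR_right mult.assoc[symmetric] sq by simp
    qed
    also have "\<dots> = cinner (coeff \<Delta> h) (coeff \<Delta> k) / of_nat (idx \<Delta>)"
      unfolding cinner_level[OF \<Delta> coeff_in_level[OF hk(2) \<Delta>]] by (rule sum_divide_distrib[symmetric])
    also have "\<dots> = cinner u v" unfolding hk(3,4) by (rule V_cinner[OF \<Delta> hk(1,2), symmetric])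
    finally show ?thesis .
  qed
  have onto: "coordinates \<Delta> ` V \<Delta> ` conv = l2_tensor ?Q L"
  proof (intro equalityI subsetI)
    fix f assume f: "f \<in> l2_tensor ?Q L"
    \<comment> \<open>The inverse of the normalisation gives the preimage; outside the range of
      indices the value is 0 because \<open>assemble_in_level\<close> needs \<open>L\<close>
      everywhere.\<close>
    define l where "l i = (if i \<in> ?I then sqrt (real (idx \<Delta>)) *\<^sub>R f (\<Delta> #> s \<Delta> i) else 0)" for i
    have l: "l i \<in> L" for i
    proof (cases "i \<in> ?I")
      case True
      then have "f (\<Delta> #> s \<Delta> i) \<in> L" using f bij_betwE[OF bij] unfolding l2_tensor_def by blast
      then show ?thesis using True by (simp add: l_def csubspace_scaleR[OF L_csubspace])
    qed (simp only: l_def if_False csubspace_zero[OF L_csubspace])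
    have lev: "assemble \<Delta> l \<in> level \<Delta>" using l by (rule assemble_in_level)
    note conv = level_subset_conv[OF \<Delta> lev]
    have "coordinates \<Delta> (V \<Delta> (assemble \<Delta> l)) = f"
    proof (rule eqI[OF tens[OF conv] f])
      fix j assume j: "j \<in> ?I"
      have lj: "l j = sqrt (real (idx \<Delta>)) *\<^sub>R f (\<Delta> #> s \<Delta> j)" using j by (simp only: l_def if_True)
      show "coordinates \<Delta> (V \<Delta> (assemble \<Delta> l)) (\<Delta> #> s \<Delta> j) = f (\<Delta> #> s \<Delta> j)"
        unfolding coordinates_at[OF \<Delta> conv j] coeff_level[OF \<Delta> lev] entry_assemble[where l = l, OF \<Delta> j l] lj
        using idx_pos[OF \<Delta>] by simp
    qed
    then show "f \<in> coordinates \<Delta> ` V \<Delta> ` conv" using conv by blast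
  qed (use tens in blast)
  show ?thesis
    unfolding l2_unitary_def l2_isometry_def
    using tens add scale inner onto by blast
qed

lemma hecke_matrix_form:
  assumes \<Delta>: "\<Delta> \<in> S" and \<sigma>: "\<sigma> \<in> carrier G" and h: "h \<in> conv"
    and B: "\<And>i j. i \<in> {1..idx \<Delta>} \<Longrightarrow> j \<in> {1..idx \<Delta>} \<Longrightarrow> hs_has_sum (\<lambda>\<theta>. compress P (\<pi>\<^sub>0 \<theta>))
      ((inv (s \<Delta> i) <# ((\<Delta> #> \<sigma>) <#> \<Delta>)) #> s \<Delta> j) (B i j)"
  defines "A \<equiv> extend_by_zero (embedding \<Delta>) (V\<^sub>0 \<Delta> ` conv\<^sub>0)
    (hecke_operator G \<iota> \<Phi>\<^sub>0 (V\<^sub>0 \<Delta> ` conv\<^sub>0) \<Delta> \<sigma>)"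
  shows "A (V \<Delta> h) \<in> V \<Delta> ` conv"
    and "coordinates \<Delta> (A (V \<Delta> h)) = (\<lambda>c. \<Sum>i=1..idx \<Delta>. \<Sum>j=1..idx \<Delta>.
      unit_tensor (\<Delta> #> s \<Delta> i) (\<Delta> #> s \<Delta> j) (B i j) (coordinates \<Delta> (V \<Delta> h)) c)"
proof -
  obtain R where R: "right_transversal G \<Delta> (conj_meet G \<Delta> (inv \<sigma>)) R"
    using right_transversal_exists by blast
  define x where "x = coeff \<Delta> h"
  have x: "x \<in> level \<Delta>" unfolding x_def by (rule coeff_in_level[OF h \<Delta>])
  \<comment> \<open>Passing to the coefficient puts the representative into the level space, where
    the formula for the extended Hecke operator is available.\<close>
  have Vh: "V \<Delta> h = V \<Delta> x"
    using V_eq_iff[OF \<Delta> h level_subset_conv[OF \<Delta> x]] coeff_level[OF \<Delta> x] by (simp add: x_def)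
  let ?y = "\<pi> \<sigma> (P\<^sub>0 (\<Sum>r\<in>R. \<pi> r x))" and ?a = "1 / sqrt (real (idx \<Delta>))"
  have y: "?y \<in> conv" using hecke_operator_V\<^sub>0(1)[OF \<Delta> \<sigma> x R] by (simp add: conv\<^sub>0_def)
  have A: "A (V \<Delta> h) = V \<Delta> ?y"
    unfolding A_def Vh by (rule extended_hecke_operator[OF \<Delta> \<sigma> x R])
  show "A (V \<Delta> h) \<in> V \<Delta> ` conv" unfolding A using y by blast
  show "coordinates \<Delta> (A (V \<Delta> h)) = (\<lambda>c. \<Sum>i=1..idx \<Delta>. \<Sum>j=1..idx \<Delta>.
      unit_tensor (\<Delta> #> s \<Delta> i) (\<Delta> #> s \<Delta> j) (B i j) (coordinates \<Delta> (V \<Delta> h)) c)"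
    unfolding A coordinates_V[OF \<Delta> y]
  proof (intro ext sum.cong refl)
    fix c i assume i: "i \<in> {1..idx \<Delta>}"
    \<comment> \<open>By linearity the normalisation passes through the entries, so it disappears
      from the matrix.\<close>
    have lin: "bounded_linear (B i j)" if "j \<in> {1..idx \<Delta>}" for j
      using B[OF i that] unfolding hs_has_sum_def hilbert_schmidt_def
      by (intro bounded_clinear_imp_bounded_linear) (elim conjE)
    have "entry \<Delta> i (coeff \<Delta> ?y) = (\<Sum>j=1..idx \<Delta>. B i j (entry \<Delta> j x))"
      by (rule hecke_matrix[OF \<Delta> \<sigma> x R i]) (rule B[OF i])
    then have "?a *\<^sub>R entry \<Delta> i (coeff \<Delta> ?y) = (\<Sum>j=1..idx \<Delta>. ?a *\<^sub>R B i j (entry \<Delta> j x))"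
      by (simp only: scaleR_sum_right)
    also have "\<dots> = (\<Sum>j=1..idx \<Delta>. B i j (coordinates \<Delta> (V \<Delta> h) (\<Delta> #> s \<Delta> j)))"
    proof (intro sum.cong refl)
      fix j assume j: "j \<in> {1..idx \<Delta>}"
      show "?a *\<^sub>R B i j (entry \<Delta> j x) = B i j (coordinates \<Delta> (V \<Delta> h) (\<Delta> #> s \<Delta> j))"
        unfolding coordinates_at[OF \<Delta> h j] x_def[symmetric]
        by (rule linear_scale[OF bounded_linear.linear[OF lin[OF j]], symmetric])
    qed
    finally show "delta_tensor (\<Delta> #> s \<Delta> i) (?a *\<^sub>R entry \<Delta> i (coeff \<Delta> ?y)) c =
        (\<Sum>j=1..idx \<Delta>. unit_tensor (\<Delta> #> s \<Delta> i) (\<Delta> #> s \<Delta> j) (B i j) (coordinates \<Delta> (V \<Delta> h)) c)"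
      by (simp only: unit_tensor_def delta_tensor_sum)
  qed
qed

end

theorem theorem2:
  fixes G :: "('g, 'm) monoid_scheme" and \<Gamma> :: "'g set"
    and C :: "('c, 'n) monoid_scheme" and T :: "'c topology" and \<iota> :: "'g \<Rightarrow> 'c"
    and \<pi>\<^sub>0 \<pi> :: "'g \<Rightarrow> 'a::chilbert \<Rightarrow> 'a" and H\<^sub>0 L :: "'a set"
    and s :: "'g set \<Rightarrow> nat \<Rightarrow> 'g"
    and V\<^sub>0 :: "'g set \<Rightarrow> 'a \<Rightarrow> 'k::chilbert" and V :: "'g set \<Rightarrow> 'a \<Rightarrow> 'l::chilbert"
    and \<Phi>\<^sub>0 :: "'c \<Rightarrow> 'k \<Rightarrow> 'k"
    and \<Gamma>\<^sub>0 :: "'g set"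
  defines "D \<equiv> sum_domain G \<Gamma> \<pi> L s \<pi>\<^sub>0 \<Gamma>\<^sub>0"
    and "HV\<^sub>0 \<equiv> virtual_level G \<Gamma> \<pi> L s \<pi>\<^sub>0 V\<^sub>0 \<Gamma>\<^sub>0"
    and "HV \<equiv> virtual_level G \<Gamma> \<pi> L s \<pi> V \<Gamma>\<^sub>0"
    and "cosets \<equiv> rcosets\<^bsub>G\<lparr>carrier := \<Gamma>\<rparr>\<^esub> \<Gamma>\<^sub>0"
    and "N \<equiv> index G \<Gamma> \<Gamma>\<^sub>0"
    and "r \<equiv> s \<Gamma>\<^sub>0"
  assumes pair: "hecke_pair G \<Gamma>"
    and completion: "schlichting_completion G \<Gamma> C T \<iota>"
    and TC: "technical_condition G \<Gamma> \<pi>\<^sub>0 H\<^sub>0 \<pi> L"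
    and reps: "\<forall>\<Delta>\<in>subgroup_family G \<Gamma>. coset_reps G \<Gamma> \<Delta> (s \<Delta>)"
    and virtual\<^sub>0: "virtual_completion G \<Gamma> \<pi> L s \<pi>\<^sub>0 V\<^sub>0"
    and rep\<^sub>0: "virtual_rep G \<Gamma> \<pi> L s \<pi>\<^sub>0 V\<^sub>0 C T \<iota> \<Phi>\<^sub>0"
    and virtual: "virtual_completion G \<Gamma> \<pi> L s \<pi> V"
    and level: "\<Gamma>\<^sub>0 \<in> subgroup_family G \<Gamma>"
  shows "\<exists>U. l2_unitary HV cosets L U \<and>
    (\<forall>l. (\<forall>i. l i \<in> L) \<longrightarrow>
      U (V \<Gamma>\<^sub>0 (\<Sum>i=1..N. \<pi> (r i) (l i))) =
        (\<lambda>c. \<Sum>i=1..N. delta_tensor (\<Gamma>\<^sub>0 #>\<^bsub>G\<^esub> r i) ((1 / sqrt (real N)) *\<^sub>R l i) c)) \<and>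
    (\<forall>\<sigma>\<in>carrier G. \<exists>B.
      (\<forall>i\<in>{1..N}. \<forall>j\<in>{1..N}.
        hs_has_sum (\<lambda>\<theta>. compress (proj L) (\<pi>\<^sub>0 \<theta>))
          ((inv\<^bsub>G\<^esub> (r i) <#\<^bsub>G\<^esub> ((\<Gamma>\<^sub>0 #>\<^bsub>G\<^esub> \<sigma>) <#>\<^bsub>G\<^esub> \<Gamma>\<^sub>0)) #>\<^bsub>G\<^esub> r j) (B i j)) \<and>
      (\<forall>w\<in>HV.
        extend_by_zero (level_embedding (V\<^sub>0 \<Gamma>\<^sub>0) (V \<Gamma>\<^sub>0) D H\<^sub>0) HV\<^sub>0
            (hecke_operator G \<iota> \<Phi>\<^sub>0 HV\<^sub>0 \<Gamma>\<^sub>0 \<sigma>) w \<in> HV \<and>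
        U (extend_by_zero (level_embedding (V\<^sub>0 \<Gamma>\<^sub>0) (V \<Gamma>\<^sub>0) D H\<^sub>0) HV\<^sub>0
             (hecke_operator G \<iota> \<Phi>\<^sub>0 HV\<^sub>0 \<Gamma>\<^sub>0 \<sigma>) w) =
          (\<lambda>c. \<Sum>i=1..N. \<Sum>j=1..N.
             unit_tensor (\<Gamma>\<^sub>0 #>\<^bsub>G\<^esub> r i) (\<Gamma>\<^sub>0 #>\<^bsub>G\<^esub> r j) (B i j) (U w) c)))"
proof -
  interpret virtual_setting G \<Gamma> \<pi>\<^sub>0 H\<^sub>0 \<pi> L s V\<^sub>0 V C T \<iota> \<Phi>\<^sub>0
    using pair TC reps virtual\<^sub>0 rep\<^sub>0 virtual by unfold_locales
  have eqs: "D = conv\<^sub>0" "HV\<^sub>0 = V\<^sub>0 \<Gamma>\<^sub>0 ` conv\<^sub>0" "HV = V \<Gamma>\<^sub>0 ` conv"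
    unfolding D_def HV\<^sub>0_def HV_def virtual_level_def sum_domain_\<pi>\<^sub>0[OF level] sum_domain_\<pi>[OF level] by simp_all
  show ?thesis
    unfolding eqs cosets_def N_def r_def
  \<comment> \<open>The unitary is fixed before \<sigma>, so one equivalence serves all Hecke
    operators of this level; only the entries \<open>B\<close> depend on \<sigma>.\<close>
  proof (intro exI[of _ "coordinates \<Gamma>\<^sub>0"] conjI allI impI ballI)
    show "l2_unitary (V \<Gamma>\<^sub>0 ` conv) (rcosets\<^bsub>G\<lparr>carrier := \<Gamma>\<rparr>\<^esub> \<Gamma>\<^sub>0) L (coordinates \<Gamma>\<^sub>0)"
      by (rule coordinates_unitary[OF level])
    fix l :: "nat \<Rightarrow> 'a" assume "\<forall>i. l i \<in> L"
    then show "coordinates \<Gamma>\<^sub>0 (V \<Gamma>\<^sub>0 (\<Sum>i=1..idx \<Gamma>\<^sub>0. \<pi> (s \<Gamma>\<^sub>0 i) (l i))) =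
        (\<lambda>c. \<Sum>i=1..idx \<Gamma>\<^sub>0. delta_tensor (\<Gamma>\<^sub>0 #>\<^bsub>G\<^esub> s \<Gamma>\<^sub>0 i) ((1 / sqrt (real (idx \<Gamma>\<^sub>0))) *\<^sub>R l i) c)"
      unfolding assemble_def[symmetric] by (intro coordinates_assemble level) simp
  next
    fix \<sigma> assume \<sigma>: "\<sigma> \<in> carrier G"
    have "\<forall>i\<in>{1..idx \<Gamma>\<^sub>0}. \<forall>j\<in>{1..idx \<Gamma>\<^sub>0}. \<exists>B. hs_has_sum (\<lambda>\<theta>. compress P (\<pi>\<^sub>0 \<theta>))
        ((inv\<^bsub>G\<^esub> (s \<Gamma>\<^sub>0 i) <#\<^bsub>G\<^esub> ((\<Gamma>\<^sub>0 #>\<^bsub>G\<^esub> \<sigma>) <#>\<^bsub>G\<^esub> \<Gamma>\<^sub>0)) #>\<^bsub>G\<^esub> s \<Gamma>\<^sub>0 j) B"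
      by (intro ballI hecke_matrix_entry level \<sigma>)
    then obtain B where B: "\<forall>i\<in>{1..idx \<Gamma>\<^sub>0}. \<forall>j\<in>{1..idx \<Gamma>\<^sub>0}. hs_has_sum (\<lambda>\<theta>. compress P (\<pi>\<^sub>0 \<theta>))
        ((inv\<^bsub>G\<^esub> (s \<Gamma>\<^sub>0 i) <#\<^bsub>G\<^esub> ((\<Gamma>\<^sub>0 #>\<^bsub>G\<^esub> \<sigma>) <#>\<^bsub>G\<^esub> \<Gamma>\<^sub>0)) #>\<^bsub>G\<^esub> s \<Gamma>\<^sub>0 j) (B i j)"
      by metis
    note form = hecke_matrix_form[OF level \<sigma> _ bspec[OF bspec[OF B]]]
    show "\<exists>B. (\<forall>i\<in>{1..idx \<Gamma>\<^sub>0}. \<forall>j\<in>{1..idx \<Gamma>\<^sub>0}. hs_has_sum (\<lambda>\<theta>. compress P (\<pi>\<^sub>0 \<theta>))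
          ((inv\<^bsub>G\<^esub> (s \<Gamma>\<^sub>0 i) <#\<^bsub>G\<^esub> ((\<Gamma>\<^sub>0 #>\<^bsub>G\<^esub> \<sigma>) <#>\<^bsub>G\<^esub> \<Gamma>\<^sub>0)) #>\<^bsub>G\<^esub> s \<Gamma>\<^sub>0 j) (B i j)) \<and>
        (\<forall>w\<in>V \<Gamma>\<^sub>0 ` conv.
          extend_by_zero (embedding \<Gamma>\<^sub>0) (V\<^sub>0 \<Gamma>\<^sub>0 ` conv\<^sub>0)
            (hecke_operator G \<iota> \<Phi>\<^sub>0 (V\<^sub>0 \<Gamma>\<^sub>0 ` conv\<^sub>0) \<Gamma>\<^sub>0 \<sigma>) w \<in> V \<Gamma>\<^sub>0 ` conv \<and>
          coordinates \<Gamma>\<^sub>0 (extend_by_zero (embedding \<Gamma>\<^sub>0) (V\<^sub>0 \<Gamma>\<^sub>0 ` conv\<^sub>0)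
            (hecke_operator G \<iota> \<Phi>\<^sub>0 (V\<^sub>0 \<Gamma>\<^sub>0 ` conv\<^sub>0) \<Gamma>\<^sub>0 \<sigma>) w) =
          (\<lambda>c. \<Sum>i=1..idx \<Gamma>\<^sub>0. \<Sum>j=1..idx \<Gamma>\<^sub>0.
            unit_tensor (\<Gamma>\<^sub>0 #>\<^bsub>G\<^esub> s \<Gamma>\<^sub>0 i) (\<Gamma>\<^sub>0 #>\<^bsub>G\<^esub> s \<Gamma>\<^sub>0 j) (B i j) (coordinates \<Gamma>\<^sub>0 w) c))"
    proof (intro exI[of _ B] conjI[OF B] ballI)
      fix w assume "w \<in> V \<Gamma>\<^sub>0 ` conv"
      then obtain h where h: "h \<in> conv" and w: "w = V \<Gamma>\<^sub>0 h" by blast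
      show "extend_by_zero (embedding \<Gamma>\<^sub>0) (V\<^sub>0 \<Gamma>\<^sub>0 ` conv\<^sub>0)
            (hecke_operator G \<iota> \<Phi>\<^sub>0 (V\<^sub>0 \<Gamma>\<^sub>0 ` conv\<^sub>0) \<Gamma>\<^sub>0 \<sigma>) w \<in> V \<Gamma>\<^sub>0 ` conv \<and>
          coordinates \<Gamma>\<^sub>0 (extend_by_zero (embedding \<Gamma>\<^sub>0) (V\<^sub>0 \<Gamma>\<^sub>0 ` conv\<^sub>0)
            (hecke_operator G \<iota> \<Phi>\<^sub>0 (V\<^sub>0 \<Gamma>\<^sub>0 ` conv\<^sub>0) \<Gamma>\<^sub>0 \<sigma>) w) =
          (\<lambda>c. \<Sum>i=1..idx \<Gamma>\<^sub>0. \<Sum>j=1..idx \<Gamma>\<^sub>0.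
            unit_tensor (\<Gamma>\<^sub>0 #>\<^bsub>G\<^esub> s \<Gamma>\<^sub>0 i) (\<Gamma>\<^sub>0 #>\<^bsub>G\<^esub> s \<Gamma>\<^sub>0 j) (B i j) (coordinates \<Gamma>\<^sub>0 w) c)"
        unfolding w by (intro conjI form h)
    qed
  qed
qed

end
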